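(* Let $j,k\in\mathbb{N}$ with $1\le j<k$, and let $X,Y$ be rearrangement-invariant Banach function spaces over $\mathbb{R}^n$ (with Lebesgue measure) such that $Y^{\frac kj}$ is locally embedded into $X$, i.e. $Y^{\frac{k}{j}}\stackrel{\mathrm{loc}}{\hookrightarrow} X$. Then there is a constant $C>0$, independent of $u$, such that $$\|\nabla^j u\|_{X}\le C\,\|(\nabla^k u)^{**}\|_{Y}^{\frac{j}{k}}\;\|u^{**}\|_{((Y^{\frac{k}{j}})^{X})^{1-\frac{j}{k}}}^{1-\frac{j}{k}}$$ holds for all $k$-times weakly differentiable functions $u$ on $\mathbb{R}^n$.
   Context: Banach function spaces are understood in the sense of Bennett–Sharpley: a Banach function norm is a functional $\|\cdot\|_X$ on measurable functions, with values in $[0,\infty]$ and $\|f\|_X=\||f|\|_X$, such that for nonnegative measurable $f,g,f_m$ and measurable sets $E$: it is a norm (positively homogeneous, subadditive, zero iff $f=0$ a.e.); $0\le g\le f$ a.e. implies $\|g\|_X\le\|f\|_X$; $0\le f_m\uparrow f$ a.e. implies $\|f_m\|_X\uparrow\|f\|_X$; $|E|<\infty$ implies $\|\chi_E\|_X<\infty$; $|E|<\infty$ implies $\int_E f\le C_E\|f\|_X$ with $C_E$ independent of $f$. The space is rearrangement-invariant if $\|f\|_X=\|g\|_X$ whenever $|\{|f|>s\}|=|\{|g|>s\}|$ for all $s>0$. Local embedding: $Y\stackrel{\mathrm{loc}}{\hookrightarrow}X$ means that for every measurable $E\subset\mathbb{R}^n$ with $|E|<\infty$ there is a constant $C_E$,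 depending only on $E$, with $\|u\chi_E\|_X\le C_E\|u\chi_E\|_Y$ for every measurable $u$. Powers: for $\alpha>0$, $\|u\|_{X^\alpha}:=\left(\||u|^\alpha\|_X\right)^{1/\alpha}$. Multiplier space: if $Y\stackrel{\mathrm{loc}}{\hookrightarrow}X$, then $Y^X$ is the space given by $\|f\|_{Y^X}:=\sup_{\|g\|_Y\le1}\|fg\|_X$. Thus $(Y^{k/j})^X$ is the multiplier space formed with $Y^{k/j}$ in place of $Y$, and $((Y^{k/j})^X)^{1-j/k}$ is its power with $\alpha=1-j/k$. Rearrangements: for a scalar or vector-valued measurable $u$ on $\mathbb{R}^n$, $u^*(t):=\inf\{s\in(0,\infty):|\{|u|>s\}|\le t\}$ (with $\inf\emptyset=+\infty$) and $u^{**}(t):=\frac1t\int_0^t u^*(s)\,ds$, $t>0$, where $|\cdot|$ is the Euclidean norm for vector-valued $u$. For a rearrangement-invariant functional $\|\cdot\|_W$ over $\mathbb{R}^n$ and a non-increasing function $h$ on $(0,\infty)$ such as $u^{**}$, $\|h\|_W$ means the value of the representing functional on $(0,\infty)$ (Luxemburg representation), i.e. $\|v\|_W$ for any function $v$ on $\mathbb{R}^n$ equimeasurable with $h$. A function $u$ is $k$-times weakly differentiable if $u\in L^1_{\mathrm{loc}}(\mathbb{R}^n)$ has all weak partial derivatives up to order $k$ in $L^1_{\mathrm{loc}}(\mathbb{R}^n)$. $\nabla^j u$ is the vector of all weak partial derivatives of order $j$, and $\|\nabla^j u\|_X:=\||\nabla^j u|\|_X$. *)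

theory Defs
  imports "HOL-Analysis.Analysis"
begin

section \<open>Extended nonnegative arithmetic\<close>

text \<open>Real power of an extended nonnegative number, for positive exponents: \<open>0\<close> and \<open>\<infinity>\<close> are fixed.\<close>

definition ennpowr :: "ennreal \<Rightarrow> real \<Rightarrow> ennreal" where
  "ennpowr x a = (if x = \<infinity> then \<infinity> else ennreal (enn2real x powr a))"

text \<open>
  Product of norms with the convention \<open>0 \<cdot> \<infinity> = \<infinity>\<close>, under which an upper bound with an infinite
  factor is void.  The library convention \<open>0 * \<infinity> = 0\<close> would make interpolation inequalities false:
  if \<open>u\<close> is a nonconstant affine function and \<open>X = Y = L\<^sup>\<infinity>\<close>, the second-order factor vanishes and
  the zeroth-order one is infinite, but the gradient is a nonzero constant.
\<close>

definition norm_prod :: "ennreal \<Rightarrow> ennreal \<Rightarrow> ennreal" where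
  "norm_prod a b = (if a = \<infinity> \<or> b = \<infinity> then \<infinity> else a * b)"


section \<open>Rearrangements\<close>

definition equimeasurable ::
  "'a measure \<Rightarrow> ('a \<Rightarrow> ennreal) \<Rightarrow> 'b measure \<Rightarrow> ('b \<Rightarrow> ennreal) \<Rightarrow> bool" where
  "equimeasurable M f N g \<longleftrightarrow>
     (\<forall>s::real. s > 0 \<longrightarrow>
        emeasure M {x \<in> space M. f x > ennreal s} = emeasure N {y \<in> space N. g y > ennreal s})"

definition decr_rearr :: "(real^'n \<Rightarrow> ennreal) \<Rightarrow> real \<Rightarrow> ennreal" where
  "decr_rearr f t =
     Inf {ennreal s | s::real. s > 0 \<and> emeasure lebesgue {x. f x > ennreal s} \<le> ennreal t}"

definition max_rearr :: "(real^'n \<Rightarrow> ennreal) \<Rightarrow> real \<Rightarrow> ennreal" where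
  "max_rearr f t = ennreal (1 / t) * (\<integral>\<^sup>+s\<in>{0<..<t}. decr_rearr f s \<partial>lborel)"


section \<open>Banach function spaces\<close>

text \<open>
  A Banach function norm is represented by its restriction to nonnegative measurable functions; the
  norm of a real-valued or vector-valued function is the value at its modulus.  The values of
  the functional at non-measurable functions are irrelevant.
\<close>

locale banach_function_norm =
  fixes \<rho> :: "(real^'n \<Rightarrow> ennreal) \<Rightarrow> ennreal"
  assumes zero_iff:
      "f \<in> borel_measurable lebesgue \<Longrightarrow> \<rho> f = 0 \<longleftrightarrow> (AE x in lebesgue. f x = 0)"
    and homogeneous:
      "f \<in> borel_measurable lebesgue \<Longrightarrow> 0 \<le> c \<Longrightarrow> \<rho> (\<lambda>x. ennreal c * f x) = ennreal c * \<rho> f"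
    and subadditive:
      "f \<in> borel_measurable lebesgue \<Longrightarrow> g \<in> borel_measurable lebesgue \<Longrightarrow>
         \<rho> (\<lambda>x. f x + g x) \<le> \<rho> f + \<rho> g"
    and lattice:
      "f \<in> borel_measurable lebesgue \<Longrightarrow> g \<in> borel_measurable lebesgue \<Longrightarrow>
         (AE x in lebesgue. g x \<le> f x) \<Longrightarrow> \<rho> g \<le> \<rho> f"
    and fatou:
      "(\<And>m. F m \<in> borel_measurable lebesgue) \<Longrightarrow> f \<in> borel_measurable lebesgue \<Longrightarrow>
         (AE x in lebesgue. incseq (\<lambda>m::nat. F m x) \<and> (\<lambda>m. F m x) \<longlonglongrightarrow> f x) \<Longrightarrow>
         incseq (\<lambda>m. \<rho> (F m)) \<and> (\<lambda>m. \<rho> (F m)) \<longlonglongrightarrow> \<rho> f"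
    and finite_indicator:
      "E \<in> sets lebesgue \<Longrightarrow> emeasure lebesgue E < \<infinity> \<Longrightarrow> \<rho> (indicator E) < \<infinity>"
    and local_integrability:
      "E \<in> sets lebesgue \<Longrightarrow> emeasure lebesgue E < \<infinity> \<Longrightarrow>
         \<exists>C>0. \<forall>f \<in> borel_measurable lebesgue. (\<integral>\<^sup>+x\<in>E. f x \<partial>lebesgue) \<le> ennreal C * \<rho> f"

locale ri_banach_function_norm = banach_function_norm +
  assumes rearrangement_invariant:
      "f \<in> borel_measurable lebesgue \<Longrightarrow> g \<in> borel_measurable lebesgue \<Longrightarrow>
         equimeasurable lebesgue f lebesgue g \<Longrightarrow> \<rho> f = \<rho> g"

definition locally_embedded ::
  "((real^'n \<Rightarrow> ennreal) \<Rightarrow> ennreal) \<Rightarrow> ((real^'n \<Rightarrow> ennreal) \<Rightarrow> ennreal) \<Rightarrow> bool" where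
  "locally_embedded Y X \<longleftrightarrow>
     (\<forall>E \<in> sets lebesgue. emeasure lebesgue E < \<infinity> \<longrightarrow>
        (\<exists>C>0. \<forall>u \<in> borel_measurable lebesgue.
           X (\<lambda>x. u x * indicator E x) \<le> ennreal C * Y (\<lambda>x. u x * indicator E x)))"

definition power_norm ::
  "((real^'n \<Rightarrow> ennreal) \<Rightarrow> ennreal) \<Rightarrow> real \<Rightarrow> (real^'n \<Rightarrow> ennreal) \<Rightarrow> ennreal" where
  "power_norm X \<alpha> u = ennpowr (X (\<lambda>x. ennpowr (u x) \<alpha>)) (1 / \<alpha>)"

text \<open>The norm of the multiplier space \<open>Y\<^sup>X\<close>.\<close>

definition multiplier_norm ::
  "((real^'n \<Rightarrow> ennreal) \<Rightarrow> ennreal) \<Rightarrow> ((real^'n \<Rightarrow> ennreal) \<Rightarrow> ennreal) \<Rightarrow>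
   (real^'n \<Rightarrow> ennreal) \<Rightarrow> ennreal" where
  "multiplier_norm Y X f =
     (SUP g \<in> {g \<in> borel_measurable lebesgue. Y g \<le> 1}. X (\<lambda>x. f x * g x))"

text \<open>
  The representing functional on \<open>(0,\<infinity>)\<close>, for non-increasing \<open>h\<close>.  The chosen \<open>v\<close> exists,
  for instance \<open>h\<close> composed with the volume of the ball of radius \<open>norm x\<close>, and the choice is
  immaterial when \<open>W\<close> is rearrangement-invariant.
\<close>

definition repr_norm ::
  "((real^'n \<Rightarrow> ennreal) \<Rightarrow> ennreal) \<Rightarrow> (real \<Rightarrow> ennreal) \<Rightarrow> ennreal" where
  "repr_norm W h =
     W (SOME v. v \<in> borel_measurable lebesgue \<and>
                equimeasurable lebesgue v (lebesgue_on {0<..}) h)"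


section \<open>Weak derivatives\<close>

definition partial_deriv :: "'n \<Rightarrow> (real^'n \<Rightarrow> real) \<Rightarrow> real^'n \<Rightarrow> real" where
  "partial_deriv i \<phi> x = frechet_derivative \<phi> (at x) (axis i 1)"

definition iter_partial_deriv :: "'n list \<Rightarrow> (real^'n \<Rightarrow> real) \<Rightarrow> real^'n \<Rightarrow> real" where
  "iter_partial_deriv js = foldr partial_deriv js"

text \<open>
  Compactly supported \<open>C\<^sup>\<infinity>\<close> functions: differentiability of all iterated partial derivatives
  entails their continuity.
\<close>

definition test_function :: "(real^'n \<Rightarrow> real) \<Rightarrow> bool" where
  "test_function \<phi> \<longleftrightarrow>
     (\<forall>js. iter_partial_deriv js \<phi> differentiable_on UNIV) \<and> compact (closure {x. \<phi> x \<noteq> 0})"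

definition locally_integrable :: "(real^'n \<Rightarrow> real) \<Rightarrow> bool" where
  "locally_integrable u \<longleftrightarrow>
     u \<in> borel_measurable lebesgue \<and> (\<forall>K. compact K \<longrightarrow> set_integrable lebesgue K u)"

definition multi_indices :: "nat \<Rightarrow> ('n::finite \<Rightarrow> nat) set" where
  "multi_indices m = {\<alpha>. (\<Sum>i\<in>UNIV. \<alpha> i) = m}"

text \<open>
  The multi-index derivative of a test function is computed along any list of coordinates
  in which each \<open>i\<close> occurs \<open>\<alpha> i\<close> times; by symmetry of mixed derivatives all such lists
  give the same result.
\<close>

definition has_weak_deriv ::
  "('n \<Rightarrow> nat) \<Rightarrow> (real^'n \<Rightarrow> real) \<Rightarrow> (real^'n \<Rightarrow> real) \<Rightarrow> bool" where
  "has_weak_deriv \<alpha> u v \<longleftrightarrow>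
     locally_integrable u \<and> locally_integrable v \<and>
     (\<forall>\<phi> js. test_function \<phi> \<and> count_list js = \<alpha> \<longrightarrow>
        (LINT x|lebesgue. u x * iter_partial_deriv js \<phi> x) =
        (- 1) ^ (\<Sum>i\<in>UNIV. \<alpha> i) * (LINT x|lebesgue. v x * \<phi> x))"

definition weakly_differentiable :: "nat \<Rightarrow> (real^'n \<Rightarrow> real) \<Rightarrow> bool" where
  "weakly_differentiable k u \<longleftrightarrow>
     locally_integrable u \<and> (\<forall>m\<le>k. \<forall>\<alpha> \<in> multi_indices m. \<exists>v. has_weak_deriv \<alpha> u v)"

text \<open>A weak derivative is determined up to null sets, so any representative may be chosen.\<close>

definition weak_deriv :: "('n \<Rightarrow> nat) \<Rightarrow> (real^'n \<Rightarrow> real) \<Rightarrow> real^'n \<Rightarrow> real" where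
  "weak_deriv \<alpha> u = (SOME v. has_weak_deriv \<alpha> u v)"

text \<open>The Euclidean length of the vector of all weak derivatives of order \<open>m\<close>.\<close>

definition abs_grad :: "nat \<Rightarrow> (real^'n \<Rightarrow> real) \<Rightarrow> real^'n \<Rightarrow> ennreal" where
  "abs_grad m u x = ennreal (L2_set (\<lambda>\<alpha>. weak_deriv \<alpha> u x) (multi_indices m))"

end

theory Submission
  imports Defs
begin

text \<open>
  Pointwise, with \<open>M\<close> the Hardy--Littlewood maximal operator,
  \<open>|\<nabla>\<^sup>j u| \<le> C (M |\<nabla>\<^sup>k u|)\<^bsup>j/k\<^esup> (M u)\<^bsup>1-j/k\<^esup>\<close> almost everywhere.  To see this, let \<open>f\<close> be
  a compactly supported smooth kernel on the line with unit integral such that \<open>2 f (2 t) - f t\<close> is a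
  \<open>(k-j)\<close>-fold derivative of such a kernel, and average a weak derivative \<open>w\<close> of order \<open>j\<close> against the
  tensor power of \<open>f\<close> at scale \<open>r\<close>.  Moving all derivatives to the kernel bounds the mean by
  \<open>r\<^bsup>-j\<^esup> M u\<close>; moving from scale \<open>r\<close> to \<open>r/2\<close> costs \<open>r\<^bsup>k-j\<^esup> M |\<nabla>\<^sup>k u|\<close>, and these
  costs sum geometrically until the mean reaches \<open>w\<close> at Lebesgue points.  It remains to optimise in \<open>r\<close>.

  Hoelder's inequality for the multiplier space reduces the claim to bounds for the norms of the two
  maximal functions.  By Vitali's covering lemma the distribution of \<open>M h\<close> is dominated, up to
  constants, by that of \<open>h\<^sup>*\<^sup>*\<close>, and both norms are monotone in the distribution: for the multiplier norm,
  a test function \<open>g\<close> for \<open>F\<close> is transported, level set by level set of \<open>F\<close>, to a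
  test function for any \<open>v\<close> with larger distribution.
\<close>

section \<open>Smooth kernels on the line\<close>

text \<open>Vanishing moments are needed for the following reason. Halving the scale changes the
  mean of \<open>w\<close> by its mean against a difference of kernels. Only if that difference is a
  full \<open>(k-j)\<close>-fold derivative can \<open>k-j\<close> derivatives be moved onto
  \<open>w\<close>, at the price \<open>r^(k-j)\<close>; a plain bump supplies a single one. In
  several variables the dilation is done one coordinate at a time, so each error is a pure
  \<open>(k-j)\<close>-fold derivative in one direction and kernels on the line suffice.

  On the norm side, maximal functions are compared with averaged rearrangements in distribution
  only, not pointwise, and the multiplier norm is a supremum over test functions that carries no
  rearrangement axiom. The volume inside centred balls parametrises any measurable set by its
  measure and thereby moves test functions between sets of equal measure; discretising dyadically
  costs a factor 2.

  The pointwise bound could fail where one maximal function is 0 and the other infinite, since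
  \<open>0 * top = 0\<close>. If a factor on the right is infinite, \<open>norm_prod\<close> makes
  the claim trivial; otherwise finite norms force both maximal functions to be finite almost
  everywhere.\<close>

definition smooth_real :: "(real \<Rightarrow> real) \<Rightarrow> bool" where
  "smooth_real f \<longleftrightarrow> (\<forall>n x. (deriv ^^ n) f differentiable (at x))"

lemma smooth_realD: "smooth_real f \<Longrightarrow> (deriv ^^ n) f differentiable (at x)"
  by (simp add: smooth_real_def)

lemma smooth_real_has_derivative:
  assumes "smooth_real f"
  shows "((deriv ^^ n) f has_real_derivative (deriv ^^ Suc n) f x) (at x)"
  using smooth_realD[OF assms, of n x]
  by (simp add: DERIV_deriv_iff_real_differentiable)

lemma smooth_real_deriv_funpow: "smooth_real f \<Longrightarrow> smooth_real ((deriv ^^ n) f)"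
  unfolding smooth_real_def by (metis comp_apply funpow_add)

lemma smooth_real_continuous: "smooth_real f \<Longrightarrow> continuous_on S f"
  by (metis smooth_real_has_derivative DERIV_isCont continuous_at_imp_continuous_on funpow_0)

text \<open>Smoothness is the largest class closed under differentiation, so membership in any
  closed class \<open>P\<close> suffices. This avoids formulas for all iterated derivatives.\<close>

lemma smooth_real_coinduct:
  assumes "P f"
    and step: "\<And>f. P f \<Longrightarrow> \<exists>f'. P f' \<and> (\<forall>x. (f has_real_derivative f' x) (at x))"
  shows "smooth_real f"
proof -
  have *: "P g \<Longrightarrow> P (deriv g) \<and> (\<forall>x. g differentiable (at x))" for g
  proof -
    assume "P g"
    then obtain f' where f': "P f'" "\<And>x. (g has_real_derivative f' x) (at x)"
      using step by blast
    then have "deriv g = f'" by (intro ext DERIV_imp_deriv)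
    with f' show ?thesis by (metis real_differentiable_def)
  qed
  have "P ((deriv ^^ n) f)" for n
    by (induction n) (use assms(1) * in auto)
  with * show ?thesis unfolding smooth_real_def by blast
qed

text \<open>Adjoining \<open>F\<close> to the smooth functions keeps the class closed under
  differentiation.\<close>

lemma smooth_real_antideriv:
  assumes "smooth_real f" and F: "\<And>x. (F has_real_derivative f x) (at x)"
  shows "smooth_real F"
proof (rule smooth_real_coinduct[where P = "\<lambda>g. g = F \<or> smooth_real g"])
  fix g assume "g = F \<or> smooth_real g"
  then show "\<exists>f'. (f' = F \<or> smooth_real f') \<and> (\<forall>x. (g has_real_derivative f' x) (at x))"
  proof
    assume "g = F" then show ?thesis using assms by blast
  next
    assume "smooth_real g"
    then have "smooth_real (deriv g)" "\<forall>x. (g has_real_derivative deriv g x) (at x)"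
      using smooth_real_deriv_funpow[of g 1] smooth_real_has_derivative[of g 0] by auto
    then show ?thesis by blast
  qed
qed simp

lemma deriv_funpow_affine:
  assumes "smooth_real f"
  shows "(deriv ^^ n) (\<lambda>t. f (c * t + d)) = (\<lambda>t. c ^ n * (deriv ^^ n) f (c * t + d))"
proof (induction n)
  case (Suc n)
  have "((\<lambda>t. c ^ n * (deriv ^^ n) f (c * t + d)) has_real_derivative
      c ^ Suc n * (deriv ^^ Suc n) f (c * x + d)) (at x)" for x
    by (rule derivative_eq_intros DERIV_chain2[OF smooth_real_has_derivative[OF assms]] refl | simp)+
  then show ?case using Suc by (auto intro!: ext DERIV_imp_deriv)
qed simp

lemma smooth_real_lincomb:
  assumes "smooth_real f" "smooth_real g"
  shows "smooth_real (\<lambda>t. a * f t + b * g t)"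
    and "(deriv ^^ n) (\<lambda>t. a * f t + b * g t) = (\<lambda>t. a * (deriv ^^ n) f t + b * (deriv ^^ n) g t)"
proof -
  have D: "((\<lambda>t. a * (deriv ^^ n) f t + b * (deriv ^^ n) g t) has_real_derivative
      a * (deriv ^^ Suc n) f x + b * (deriv ^^ Suc n) g x) (at x)" for x n
    by (rule derivative_eq_intros smooth_real_has_derivative assms refl | simp)+
  show eq: "(deriv ^^ n) (\<lambda>t. a * f t + b * g t) = (\<lambda>t. a * (deriv ^^ n) f t + b * (deriv ^^ n) g t)" for n
  proof (induction n)
    case (Suc n)
    then show ?case using D[of n] by (auto intro!: ext DERIV_imp_deriv)
  qed simp
  show "smooth_real (\<lambda>t. a * f t + b * g t)"
    unfolding smooth_real_def eq using D real_differentiable_def by blast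
qed

lemma smooth_real_affine:
  assumes "smooth_real f"
  shows "smooth_real (\<lambda>t. f (c * t + d))"
proof -
  have "((\<lambda>t. c ^ n * (deriv ^^ n) f (c * t + d)) has_real_derivative
      c ^ Suc n * (deriv ^^ Suc n) f (c * x + d)) (at x)" for x n
    by (rule derivative_eq_intros DERIV_chain2[OF smooth_real_has_derivative[OF assms]] refl | simp)+
  then show ?thesis unfolding smooth_real_def deriv_funpow_affine[OF assms]
    using real_differentiable_def by blast
qed

section \<open>Smooth kernels supported in the unit interval\<close>

text \<open>The interval starts at 0 instead of being centred there, so that a rescaled kernel
  occupies a cube whose lower corner is the base point. It contains 0, so passing to
  \<open>f (2 * t)\<close> stays in the class.\<close>

definition unit_kernel :: "(real \<Rightarrow> real) \<Rightarrow> bool" where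
  "unit_kernel f \<longleftrightarrow> smooth_real f \<and> (\<forall>t. t \<notin> {0..1} \<longrightarrow> f t = 0)"

lemma unit_kernel_deriv_funpow:
  assumes "unit_kernel f"
  shows "unit_kernel ((deriv ^^ n) f)"
proof (induction n)
  case (Suc n)
  let ?g = "(deriv ^^ n) f"
  have "deriv ?g t = 0" if "t \<notin> {0..1}" for t
  proof -
    \<comment> \<open>The complement of the support interval is open, so \<open>?g\<close> vanishes
      near \<open>t\<close> and not merely at \<open>t\<close>.\<close>
    have "open (- {0..1::real})" by (intro open_Compl) auto
    then have "eventually (\<lambda>y. y \<in> - {0..1}) (nhds t)"
      using that by (intro eventually_nhds_in_open) auto
    then have "eventually (\<lambda>y. ?g y = 0) (nhds t)"
      by eventually_elim (use Suc in \<open>auto simp: unit_kernel_def\<close>)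
    then have "deriv ?g t = deriv (\<lambda>_. 0) t"
      by (rule deriv_cong_ev) simp
    then show ?thesis by simp
  qed
  then show ?case using smooth_real_deriv_funpow[of f "Suc n"] assms
    by (auto simp: unit_kernel_def)
qed (use assms in simp)

lemma unit_kernel_bounded:
  assumes "unit_kernel f"
  obtains B where "B > 0" "\<And>t. \<bar>f t\<bar> \<le> B"
proof -
  have "compact (f ` {0..1})"
    using assms by (intro compact_continuous_image smooth_real_continuous) (auto simp: unit_kernel_def)
  then obtain B where "B > 0" "\<forall>x\<in>f ` {0..1}. norm x \<le> B"
    using compact_imp_bounded bounded_pos by blast
  then have "\<bar>f t\<bar> \<le> B" for t
    using assms by (cases "t \<in> {0..1}") (auto simp: unit_kernel_def)
  with \<open>B > 0\<close> that show ?thesis by blast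
qed

lemma unit_kernel_integrable:
  assumes "unit_kernel f"
  shows "integrable lborel f"
proof -
  have "set_integrable lborel {0..1} f"
    unfolding set_integrable_def
    using assms by (intro borel_integrable_compact smooth_real_continuous)
      (auto simp: unit_kernel_def)
  moreover have "indicator {0..1} t *\<^sub>R f t = f t" for t
    using assms by (cases "t \<in> {0..1}") (auto simp: unit_kernel_def)
  ultimately have "integrable lborel (\<lambda>t. f t)" by (simp only: set_integrable_def)
  then show ?thesis .
qed

lemma unit_kernel_lincomb:
  assumes "unit_kernel f" "unit_kernel g"
  shows "unit_kernel (\<lambda>t. a * f t + b * g t)"
  using assms smooth_real_lincomb by (auto simp: unit_kernel_def)

lemma unit_kernel_dilate:
  assumes "unit_kernel f"
  shows "unit_kernel (\<lambda>t. f (2 * t))"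
  using assms smooth_real_affine[of f 2 0] by (auto simp: unit_kernel_def)

text \<open>The family of functions \<open>p w\<^sup>-\<^sup>m exp (- 1 / w)\<close> on \<open>(0, 1)\<close> with \<open>w = t (1 - t)\<close> and
  a polynomial \<open>p\<close> is closed under differentiation.\<close>

definition flat_fun :: "real poly \<Rightarrow> nat \<Rightarrow> real \<Rightarrow> real" where
  "flat_fun p m t = (if 0 < t \<and> t < 1
     then poly p t * (1 / (t * (1 - t))) ^ m * exp (- (1 / (t * (1 - t)))) else 0)"

text \<open>Raise \<open>s / k <= exp (s / k)\<close> to the power \<open>k\<close>. For
  \<open>k = 0\<close> the right-hand side is \<open>0 ^ 0 = 1\<close>.\<close>

lemma power_mult_exp_minus_le:
  fixes s :: real
  assumes "s \<ge> 0"
  shows "s ^ k * exp (- s) \<le> real k ^ k"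
proof (cases "k = 0")
  case False
  have "s / k \<le> exp (s / k)" using exp_ge_add_one_self[of "s/k"] by linarith
  then have "(s / k) ^ k \<le> exp (s / k) ^ k" using assms by (intro power_mono) auto
  also have "\<dots> = exp s" using False by (simp flip: exp_of_nat_mult)
  finally show ?thesis using False by (simp add: power_divide exp_minus field_simps)
qed (use assms in simp)

text \<open>A quadratic bound at each endpoint yields differentiability at 0 and 1, where the case
  distinction in \<open>flat_fun\<close> switches.\<close>

lemma flat_fun_quadratic_bound: 
  obtains K where "\<And>t. \<bar>flat_fun p m t\<bar> \<le> K * t\<^sup>2" "\<And>t. \<bar>flat_fun p m t\<bar> \<le> K * (1 - t)\<^sup>2"
proof -
  have "compact (poly p ` {0..1})" by (intro compact_continuous_image continuous_intros) auto
  then obtain B where "B > 0" and B: "\<forall>x\<in>poly p ` {0..1}. norm x \<le> B"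
    using compact_imp_bounded bounded_pos by blast
  \<comment> \<open>Two powers of \<open>w = t * (1 - t)\<close> are borrowed from the exponential,
    which absorbs \<open>(1 / w) ^ (m + 2)\<close> at the cost \<open>(m + 2) ^ (m + 2)\<close>;
    \<open>B\<close> bounds the polynomial.\<close>
  define K where "K = B * real (m + 2) ^ (m + 2)"
  have K: "K \<ge> 0" unfolding K_def using \<open>B > 0\<close> by simp
  have main: "\<bar>flat_fun p m t\<bar> \<le> K * (t * (1 - t))\<^sup>2" for t
  proof (cases "0 < t \<and> t < 1")
    case True
    define w where "w = t * (1 - t)"
    have w: "w > 0" using True by (simp add: w_def)
    have "(1 / w) ^ m * exp (- (1 / w)) = w\<^sup>2 * ((1 / w) ^ (m + 2) * exp (- (1 / w)))"
      using w by (simp add: power_add field_simps power2_eq_square)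
    also have "\<dots> \<le> w\<^sup>2 * real (m + 2) ^ (m + 2)"
      using w by (intro mult_left_mono power_mult_exp_minus_le) auto
    finally have "(1 / w) ^ m * exp (- (1 / w)) \<le> w\<^sup>2 * real (m + 2) ^ (m + 2)" .
    moreover have "\<bar>poly p t\<bar> \<le> B" using B True by auto
    ultimately have "\<bar>poly p t\<bar> * ((1 / w) ^ m * exp (- (1 / w))) \<le> B * (w\<^sup>2 * real (m + 2) ^ (m + 2))"
      using \<open>B > 0\<close> w by (intro mult_mono[of "\<bar>poly p t\<bar>" B]) simp_all
    then show ?thesis using True w
      by (simp add: flat_fun_def w_def[symmetric] abs_mult K_def mult_ac)
  qed (use K in \<open>auto simp: flat_fun_def\<close>)
  have "(t * (1 - t))\<^sup>2 \<le> t\<^sup>2" "(t * (1 - t))\<^sup>2 \<le> (1 - t)\<^sup>2" if "0 < t" "t < 1" for t :: real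
  proof -
    have "t * (1 - t) \<le> t" "t * (1 - t) \<le> 1 - t" "0 \<le> t * (1 - t)"
      using that mult_left_le[of "1 - t" t] mult_left_le_one_le[of "1 - t" t] by auto
    then show "(t * (1 - t))\<^sup>2 \<le> t\<^sup>2" "(t * (1 - t))\<^sup>2 \<le> (1 - t)\<^sup>2" by (auto intro!: power_mono)
  qed
  then have "\<bar>flat_fun p m t\<bar> \<le> K * t\<^sup>2" "\<bar>flat_fun p m t\<bar> \<le> K * (1 - t)\<^sup>2" for t
    using order_trans[OF main[of t]] K mult_left_mono[OF _ K]
    by (cases "0 < t \<and> t < 1"; force simp: flat_fun_def)+
  with that show ?thesis by blast
qed

lemma has_real_derivative_zero_if_quadratic_bound:
  fixes f :: "real \<Rightarrow> real"
  assumes "\<And>t. \<bar>f t\<bar> \<le> K * (t - a)\<^sup>2"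
  shows "(f has_real_derivative 0) (at a)"
proof -
  have fa: "f a = 0" using assms[of a] by simp
  have "((\<lambda>h. f (a + h) / h) \<longlongrightarrow> 0) (at 0)"
  proof (rule Lim_null_comparison)
    show "\<forall>\<^sub>F h in at 0. norm (f (a + h) / h) \<le> K * \<bar>h\<bar>"
    proof (rule eventually_at_filter[THEN iffD2], rule always_eventually, intro allI impI)
      fix h :: real assume "h \<noteq> 0"
      then show "norm (f (a + h) / h) \<le> K * \<bar>h\<bar>"
        using assms[of "a + h"] by (simp add: divide_le_eq power2_eq_square mult.assoc)
    qed
    show "((\<lambda>h. K * \<bar>h\<bar>) \<longlongrightarrow> 0) (at 0)"
      by (auto intro!: tendsto_eq_intros)
  qed
  then show ?thesis by (simp add: DERIV_def fa)
qed

text \<open>With \<open>w = poly W t\<close> and \<open>D\<close> the derivative of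
  \<open>W\<close>, the derivative of \<open>1 / w\<close> is \<open>- D / w^2\<close>. The product
  rule yields the powers \<open>m\<close>, \<open>m + 1\<close> and \<open>m + 2\<close> of
  \<open>1 / w\<close>; the factors \<open>W\<^sup>2\<close> and \<open>W\<close> bring the first
  two to the common exponent \<open>m + 2\<close>.\<close>

lemma flat_fun_has_derivative:
  defines "W \<equiv> [:0, 1, -1:]" and "D \<equiv> [:1, -2:]"
  shows "(flat_fun p m has_real_derivative
     flat_fun (pderiv p * W\<^sup>2 - smult (real m) (p * D * W) + p * D) (m + 2) t) (at t)"
proof -
  consider "t < 0 \<or> t > 1" | "t = 0" | "t = 1" | "0 < t" "t < 1" by linarith
  then show ?thesis
  proof cases
    case 1
    have "open (- {0..1::real})" by (intro open_Compl) auto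
    then have "eventually (\<lambda>y. y \<in> - {0..1}) (nhds t)"
      using 1 by (intro eventually_nhds_in_open) auto
    then have ev: "eventually (\<lambda>y. flat_fun p m y = 0) (nhds t)"
      by eventually_elim (auto simp: flat_fun_def)
    show ?thesis using 1 by (subst DERIV_cong_ev[OF refl ev refl]) (auto simp: flat_fun_def)
  next
    case 2
    obtain K where "\<And>t. \<bar>flat_fun p m t\<bar> \<le> K * t\<^sup>2" using flat_fun_quadratic_bound by blast
    then show ?thesis using has_real_derivative_zero_if_quadratic_bound[of "flat_fun p m" K 0] 2
      by (simp add: flat_fun_def)
  next
    case 3
    obtain K where "\<And>t. \<bar>flat_fun p m t\<bar> \<le> K * (1 - t)\<^sup>2" using flat_fun_quadratic_bound by blast
    then show ?thesis using has_real_derivative_zero_if_quadratic_bound[of "flat_fun p m" K 1] 3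
      by (simp add: flat_fun_def power2_commute)
  next
    case 4
    define w where "w = t * (1 - t)"
    define s where "s = 1 / w"
    have w: "w > 0" and ws: "w * s = 1" using 4 by (simp_all add: w_def s_def)
    have "eventually (\<lambda>y. y \<in> {0<..<1}) (nhds t)"
      using 4 by (intro eventually_nhds_in_open) auto
    then have ev: "eventually (\<lambda>y. flat_fun p m y =
        poly p y * (1 / (y * (1 - y))) ^ m * exp (- (1 / (y * (1 - y))))) (nhds t)"
      by eventually_elim (auto simp: flat_fun_def)
    have ds: "((\<lambda>y. 1 / (y * (1 - y))) has_real_derivative - ((1 - 2 * t) * s\<^sup>2)) (at t)"
    proof -
      have "((\<lambda>y. y * (1 - y)) has_real_derivative 1 - 2 * t) (at t)"
        by (auto intro!: derivative_eq_intros)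
      from DERIV_inverse_fun[OF this] show ?thesis
        using w by (simp add: s_def w_def[symmetric] inverse_eq_divide power_one_over power2_eq_square)
    qed
    have sv: "1 / (t * (1 - t)) = s" by (simp add: s_def w_def)
    have dp: "((\<lambda>y. (1 / (y * (1 - y))) ^ m) has_real_derivative
        - (real m * (1 - 2 * t) * s ^ (m + 1))) (at t)"
      using DERIV_power[OF ds, of m] unfolding sv
      by (cases m) (auto simp: power2_eq_square mult_ac)
    have de: "((\<lambda>y. exp (- (1 / (y * (1 - y))))) has_real_derivative
        exp (- s) * ((1 - 2 * t) * s\<^sup>2)) (at t)"
      using DERIV_fun_exp[OF DERIV_minus[OF ds]] unfolding sv by simp
    have "((\<lambda>y. poly p y * (1 / (y * (1 - y))) ^ m * exp (- (1 / (y * (1 - y))))) has_real_derivative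
        (poly (pderiv p) t * s ^ m - poly p t * (real m * (1 - 2 * t) * s ^ (m + 1))
         + poly p t * s ^ m * ((1 - 2 * t) * s\<^sup>2)) * exp (- s)) (at t)"
      by (rule DERIV_cong[OF DERIV_mult[OF DERIV_mult[OF poly_DERIV dp] de]], unfold sv)
         (simp add: algebra_simps)
    moreover have "(poly (pderiv p) t * s ^ m - poly p t * (real m * (1 - 2 * t) * s ^ (m + 1))
         + poly p t * s ^ m * ((1 - 2 * t) * s\<^sup>2)) * exp (- s)
      = flat_fun (pderiv p * W\<^sup>2 - smult (real m) (p * D * W) + p * D) (m + 2) t"
    proof -
      have 1: "s ^ m = w\<^sup>2 * s ^ (m + 2)" 
      proof -
        have "w\<^sup>2 * s ^ (m + 2) = (w * s)\<^sup>2 * s ^ m"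
          by (simp only: power_mult_distrib power_add mult_ac)
        then show ?thesis by (simp add: ws)
      qed
      have 2: "s ^ (m + 1) = w * s ^ (m + 2)"
      proof -
        have "w * s ^ (m + 2) = (w * s) * s ^ (m + 1)" by simp
        then show ?thesis by (simp add: ws)
      qed
      have 3: "s ^ m * ((1 - 2 * t) * s\<^sup>2) = (1 - 2 * t) * s ^ (m + 2)" by (simp add: power_add power2_eq_square)
      have "poly W t = w" "poly D t = 1 - 2 * t"
        by (simp_all add: W_def D_def w_def algebra_simps)
      then have "flat_fun (pderiv p * W\<^sup>2 - smult (real m) (p * D * W) + p * D) (m + 2) t
        = (poly (pderiv p) t * w\<^sup>2 - real m * (poly p t * (1 - 2 * t) * w) + poly p t * (1 - 2 * t))
            * s ^ (m + 2) * exp (- s)"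
        using 4 by (simp only: flat_fun_def sv) simp
      also have "\<dots> = (poly (pderiv p) t * (w\<^sup>2 * s ^ (m + 2)) - real m * (poly p t * (1 - 2 * t) * (w * s ^ (m + 2)))
          + poly p t * ((1 - 2 * t) * s ^ (m + 2))) * exp (- s)"
        by (simp only: algebra_simps)
      finally show ?thesis unfolding 1[symmetric] 2[symmetric] 3[symmetric]
        by (simp only: mult_ac)
    qed
    ultimately show ?thesis by (subst DERIV_cong_ev[OF refl ev refl]) simp
  qed
qed

lemma unit_kernel_flat_fun: "unit_kernel (flat_fun p m)"
  unfolding unit_kernel_def
proof (intro conjI allI impI)
  show "smooth_real (flat_fun p m)"
  proof (rule smooth_real_coinduct[where P = "\<lambda>g. \<exists>p m. g = flat_fun p m"])
    fix f :: "real \<Rightarrow> real" assume "\<exists>p m. f = flat_fun p m"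
    then show "\<exists>f'. (\<exists>p m. f' = flat_fun p m) \<and> (\<forall>x. (f has_real_derivative f' x) (at x))"
      using flat_fun_has_derivative by blast
  qed blast
qed (auto simp: flat_fun_def)

lemma unit_kernel_exists: "\<exists>f. unit_kernel f \<and> integral\<^sup>L lborel f = 1"
proof -
  let ?f = "flat_fun 1 0"
  have k: "unit_kernel ?f" by (rule unit_kernel_flat_fun)
  have int: "integrable lborel ?f" by (rule unit_kernel_integrable[OF k])
  have nn: "?f t \<ge> 0" for t by (simp add: flat_fun_def)
  have "integral\<^sup>L lborel ?f \<noteq> 0"
  proof
    assume "integral\<^sup>L lborel ?f = 0"
    then have "AE t in lborel. ?f t = 0"
      using integral_nonneg_eq_0_iff_AE[OF int] nn by simp
    then have "AE t in lborel. t \<notin> {0<..<1::real}"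
      by eventually_elim (auto simp: flat_fun_def)
    then have "{t\<in>space lborel. \<not> (t \<notin> {0<..<1::real})} \<in> null_sets lborel"
      by (subst (asm) AE_iff_null_sets[symmetric]) (auto simp: AE_iff_null)
    then have "emeasure lborel {0<..<1::real} = 0"
      by (simp add: null_sets_def greaterThanLessThan_def greaterThan_def lessThan_def Int_def)
    then show False by simp
  qed
  then have "integral\<^sup>L lborel (\<lambda>t. (1 / integral\<^sup>L lborel ?f) * ?f t + 0 * ?f t) = 1"
    by simp
  with unit_kernel_lincomb[OF k k] show ?thesis by blast
qed

text \<open>\<open>f\<close> and its dilate \<open>2 * f (2 * t)\<close> have the same integral, so
  the primitive of their difference vanishes again beyond the support. With \<open>H\<close> a
  primitive of \<open>f\<close> it is \<open>H t - H (2 * t)\<close>.\<close>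

lemma unit_kernel_dilation_difference:
  assumes "unit_kernel f"
  shows "\<exists>F. unit_kernel F \<and> deriv F = (\<lambda>t. f t - 2 * f (2 * t))"
proof -
  have sm: "smooth_real f" and z: "\<And>t. t \<notin> {0..1} \<Longrightarrow> f t = 0"
    using assms by (auto simp: unit_kernel_def)
  \<comment> \<open>Starting at -1 instead of 0 puts the point 0 in the interior of the interval,
    where the fundamental theorem gives a two-sided derivative.\<close>
  define H where "H x = integral {-1..x} f" for x
  have int: "f integrable_on {a..b}" for a b
    by (intro integrable_continuous_real smooth_real_continuous sm)
  have H0: "H x = 0" if "x \<le> 0" for x
  proof -
    have "f t = 0" if "t \<in> {-1..x}" for t
    proof (cases "t = 0")
      \<comment> \<open>At the endpoint 0 the support condition is silent; continuity from the left
        gives the value 0.\<close>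
      case True
      have "isCont f 0"
        using DERIV_isCont[OF smooth_real_has_derivative[OF sm, of 0]] by simp
      then have lim: "(f \<longlongrightarrow> f 0) (at_left 0)" by (simp add: isCont_def filterlim_at_split)
      have "eventually (\<lambda>t. f t = 0) (at_left (0::real))"
        unfolding eventually_at_left_field by (rule exI[of _ "-1"]) (simp add: z)
      then have "(f \<longlongrightarrow> 0) (at_left 0)" by (rule tendsto_eventually)
      from tendsto_unique[OF _ lim this] True show ?thesis by simp
    qed (use that \<open>x \<le> 0\<close> z in auto)
    then have "integral {-1..x} f = integral {-1..x} (\<lambda>_. 0::real)"
      by (intro Henstock_Kurzweil_Integration.integral_cong) auto
    then show ?thesis by (simp add: H_def)
  qed
  have H1: "H x = H 1" if "x \<ge> 1" for x
  proof -
    have "H x = integral {-1..1} f + integral {1..x} f"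
      unfolding H_def using that int by (intro Henstock_Kurzweil_Integration.integral_combine[symmetric]) auto
    moreover have "integral {1..x} f = 0"
    proof -
      have "negligible {1::real}" by simp
      then have "integral {1..x} f = integral {1..x} (\<lambda>_. 0::real)"
        by (rule integral_spike) (use z in auto)
      then show ?thesis by simp
    qed
    ultimately show ?thesis by (simp add: H_def)
  qed
  have dH: "(H has_real_derivative f x) (at x)" for x
  proof (cases "x > -1")
    case True
    have "(H has_real_derivative f x) (at x within {-1..x+1})"
      unfolding H_def by (intro integral_has_real_derivative smooth_real_continuous sm) (use True in auto)
    then show ?thesis using True by (simp add: at_within_Icc_at)
  next
    case False
    have "eventually (\<lambda>y. y \<in> {..<0}) (nhds x)"
      using False by (intro eventually_nhds_in_open) auto
    then have ev: "eventually (\<lambda>y. H y = 0) (nhds x)"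
      by eventually_elim (auto simp: H0)
    show ?thesis using False z[of x] by (subst DERIV_cong_ev[OF refl ev refl]) auto
  qed
  define F where "F x = H x - H (2 * x)" for x
  have dF: "(F has_real_derivative f x - 2 * f (2 * x)) (at x)" for x
  proof -
    have "((\<lambda>x. H (2 * x)) has_real_derivative f (2 * x) * 2) (at x)"
      by (rule DERIV_chain2[OF dH]) (auto intro!: derivative_eq_intros)
    from DERIV_diff[OF dH this] show ?thesis by (simp add: F_def[abs_def] mult.commute)
  qed
  have "smooth_real (\<lambda>x. f x - 2 * f (2 * x))"
    using smooth_real_lincomb(1)[OF sm smooth_real_affine[OF sm, of 2 0], of 1 "-2"] by simp
  then have "smooth_real F" using dF by (rule smooth_real_antideriv)
  \<comment> \<open>To the left of 0 both terms vanish, and to the right of 1 both equal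
    \<open>H 1\<close>.\<close>
  moreover have "F t = 0" if "t \<notin> {0..1}" for t
    using that H0[of t] H0[of "2*t"] H1[of t] H1[of "2*t"] by (cases "t < 0") (auto simp: F_def)
  ultimately have "unit_kernel F" by (auto simp: unit_kernel_def)
  moreover have "deriv F = (\<lambda>t. f t - 2 * f (2 * t))" using dF by (auto intro!: ext DERIV_imp_deriv)
  ultimately show ?thesis by blast
qed

section \<open>Kernels with vanishing moments\<close>

lemma integral_dilate:
  fixes f :: "real \<Rightarrow> real"
  shows "(\<integral>t. 2 * f (2 * t) \<partial>lborel) = integral\<^sup>L lborel f"
  using lborel_integral_real_affine[of 2 f 0] by simp

text \<open>The moments of \<open>f\<close> of order \<open>1, \<dots>, m\<close> vanish.  The induction step replaces \<open>f\<close> by a combination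
  of \<open>f\<close> and \<open>f (2 t)\<close> that kills the next moment.\<close>

lemma moment_kernel_exists:
  "\<exists>f g. unit_kernel f \<and> integral\<^sup>L lborel f = 1 \<and> unit_kernel g \<and>
     (\<lambda>t. 2 * f (2 * t) - f t) = (deriv ^^ Suc m) g"
proof (induction m)
  case 0
  obtain f where f: "unit_kernel f" "integral\<^sup>L lborel f = 1" using unit_kernel_exists by blast
  obtain F where F: "unit_kernel F" "deriv F = (\<lambda>t. f t - 2 * f (2 * t))"
    using unit_kernel_dilation_difference[OF f(1)] by blast
  have sF: "smooth_real F" using F by (simp add: unit_kernel_def)
  have "unit_kernel (\<lambda>t. -1 * F t + 0 * F t)" by (rule unit_kernel_lincomb[OF F(1) F(1)])
  moreover have "(deriv ^^ Suc 0) (\<lambda>t. -1 * F t + 0 * F t) = (\<lambda>t. 2 * f (2 * t) - f t)"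
    unfolding smooth_real_lincomb(2)[OF sF sF] using F(2) by simp
  ultimately show ?case using f
    by (intro exI[of _ f] exI[of _ "\<lambda>t. -1 * F t + 0 * F t"] conjI) simp_all
next
  case (Suc m)
  then obtain f g where f: "unit_kernel f" "integral\<^sup>L lborel f = 1" and g: "unit_kernel g"
    and eq: "(\<lambda>t. 2 * f (2 * t) - f t) = (deriv ^^ Suc m) g" by blast
  \<comment> \<open>The dilate \<open>2 * f (2 * t)\<close> has \<open>1 / q\<close> times the
    moment of order \<open>m + 1\<close> of \<open>f\<close>, so
    \<open>f t - q * (2 * f (2 * t))\<close> has none. Its integral is \<open>1 - q\<close>, which
    the factor \<open>c\<close> below normalises to 1.\<close>
  define q :: real where "q = 2 ^ Suc m"
  have q: "q \<noteq> 1" using one_less_power[of "2::real" "Suc m"] by (simp add: q_def)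
  obtain G where G: "unit_kernel G" "deriv G = (\<lambda>t. g t - 2 * g (2 * t))"
    using unit_kernel_dilation_difference[OF g] by blast
  define c where "c = 1 / (1 - q)"
  have c: "c * (1 - q) = 1" using q by (simp add: c_def)
  define f' where "f' t = c * f t + (- 2 * q * c) * f (2 * t)" for t
  define g' where "g' t = c * G t + 0 * G t" for t
  have "unit_kernel f'" "unit_kernel g'"
    unfolding f'_def g'_def using f G by (intro unit_kernel_lincomb unit_kernel_dilate; simp)+
  moreover have "integral\<^sup>L lborel f' = 1"
  proof -
    have "integral\<^sup>L lborel f' = c * integral\<^sup>L lborel f + (- q * c) * (\<integral>t. 2 * f (2 * t) \<partial>lborel)"
      unfolding f'_def using unit_kernel_integrable[OF f(1)] unit_kernel_integrable[OF unit_kernel_dilate[OF f(1)]]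
      by (subst Bochner_Integration.integral_add) auto
    then show ?thesis using f(2) c unfolding integral_dilate by (simp add: algebra_simps)
  qed
  moreover have "(\<lambda>t. 2 * f' (2 * t) - f' t) = (deriv ^^ Suc (Suc m)) g'"
  proof -
    have sg: "smooth_real g" "smooth_real G" using g G by (auto simp: unit_kernel_def)
    have "(deriv ^^ Suc (Suc m)) g' = (\<lambda>t. c * (deriv ^^ Suc (Suc m)) G t)"
      unfolding g'_def smooth_real_lincomb(2)[OF sg(2) sg(2)] by simp
    \<comment> \<open>Differentiating \<open>g (2 * t)\<close> a further \<open>m + 1\<close> times
      releases exactly the factor \<open>q\<close> that occurs in \<open>f'\<close>; this is why the
      combination is a derivative of \<open>g t - 2 * g (2 * t)\<close>, that is, of
      \<open>deriv G\<close>.\<close>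
    also have "(deriv ^^ Suc (Suc m)) G = (deriv ^^ Suc m) (deriv G)"
      by (subst funpow_Suc_right) simp
    also have "\<dots> = (deriv ^^ Suc m) (\<lambda>t. 1 * g t + (-2) * g (2 * t + 0))" unfolding G by simp
    also have "\<dots> = (\<lambda>t. 1 * (deriv ^^ Suc m) g t + (-2) * (2 ^ Suc m * (deriv ^^ Suc m) g (2 * t + 0)))"
      by (subst smooth_real_lincomb(2)[OF sg(1) smooth_real_affine[OF sg(1)]])
         (subst deriv_funpow_affine[OF sg(1)], rule refl)
    also have "\<dots> = (\<lambda>t. (2 * f (2 * t) - f t) - 2 * q * (2 * f (2 * (2 * t)) - f (2 * t)))"
      unfolding eq[symmetric] by (simp add: q_def mult.assoc)
    finally have *: "(deriv ^^ Suc (Suc m)) g' =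
        (\<lambda>t. c * ((2 * f (2 * t) - f t) - 2 * q * (2 * f (2 * (2 * t)) - f (2 * t))))" .
    have "2 * f' (2 * t) - f' t = c * ((2 * f (2 * t) - f t) - 2 * q * (2 * f (2 * (2 * t)) - f (2 * t)))" for t
      unfolding f'_def by algebra
    then show ?thesis unfolding * by (rule ext)
  qed
  ultimately show ?case by (intro exI[of _ f'] exI[of _ g'] conjI)
qed

section \<open>Rearrangements and the maximal function\<close>

text \<open>As a rewrite rule this would replace a Lebesgue measure by that of the main part of the
  set.\<close>

declare emeasure_completion [simp del]

lemma emeasure_lebesgue_borel: "S \<in> sets borel \<Longrightarrow> emeasure lebesgue S = emeasure lborel S"
  by (simp add: emeasure_completion)

section \<open>Distribution functions and decreasing rearrangements\<close>

lemma superlevel_sets_lebesgue: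
  fixes f :: "'a::euclidean_space \<Rightarrow> ennreal"
  assumes "f \<in> borel_measurable lebesgue"
  shows "{x. f x > a} \<in> sets lebesgue"
  using borel_measurable_less[OF _ assms, of "\<lambda>_. a"] by simp

lemma borel_measurable_antimono_ennreal:
  fixes h :: "real \<Rightarrow> ennreal"
  assumes "antimono h"
  shows "h \<in> borel_measurable borel"
proof (rule borel_measurableI_greater)
  fix a
  have "is_interval {x. h x > a}"
    unfolding is_interval_1 using assms by (auto dest: antimonoD intro: less_le_trans)
  then show "{x \<in> space borel. h x > a} \<in> sets borel"
    by (simp add: real_interval_borel_measurable)
qed

lemma emeasure_lborel_greaterThan: "emeasure lborel {a::real<..} = \<infinity>"
proof (rule ccontr)
  assume "emeasure lborel {a<..} \<noteq> \<infinity>"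
  then obtain r where r: "emeasure lborel {a<..} = ennreal r" "r \<ge> 0"
    by (cases "emeasure lborel {a<..}") auto
  have "ennreal (r + 1) = emeasure lborel {a<..<a + (r + 1)}"
    using r by (subst emeasure_lborel_Ioo) auto
  also have "\<dots> \<le> emeasure lborel {a<..}" by (intro emeasure_mono) auto
  finally show False using r by simp
qed

text \<open>Write \<open>f x\<close> as the length of the interval from 0 to \<open>f x\<close> and
  exchange the integrals, for which sigma-finiteness is required.\<close>

lemma sigma_finite_layer_cake:
  assumes "sigma_finite_measure M" and [measurable]: "f \<in> borel_measurable M"
  shows "(\<integral>\<^sup>+x. f x \<partial>M) =
    (\<integral>\<^sup>+s. emeasure M {x \<in> space M. f x > ennreal s} * indicator {0<..} s \<partial>lborel)"
proof -
  interpret M: sigma_finite_measure M by fact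
  interpret pair_sigma_finite lborel M by standard
  have eq: "f x = (\<integral>\<^sup>+s. indicator {0<..} s * indicator {s. ennreal s < f x} s \<partial>lborel)" for x
  proof -
    have "(\<integral>\<^sup>+s. indicator {0<..} s * indicator {s. ennreal s < f x} s \<partial>lborel)
        = emeasure lborel ({0<..} \<inter> {s. ennreal s < f x})"
      unfolding indicator_inter_arith[symmetric] by (rule nn_integral_indicator) measurable
    also have "\<dots> = f x"
    proof (cases "f x")
      case (real r)
      then have "{0<..} \<inter> {s. ennreal s < f x} = {0<..<r}" by (auto simp: ennreal_less_iff)
      then show ?thesis using real by simp
    next
      case top
      then have "{0<..} \<inter> {s. ennreal s < f x} = {0<..}" by auto
      then show ?thesis using top by (simp add: emeasure_lborel_greaterThan)
    qed
    finally show ?thesis by simp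
  qed
  have "(\<integral>\<^sup>+x. f x \<partial>M) =
     (\<integral>\<^sup>+x. \<integral>\<^sup>+s. indicator {0<..} s * indicator {s. ennreal s < f x} s \<partial>lborel \<partial>M)"
    using eq by (intro nn_integral_cong) auto
  also have "\<dots> = (\<integral>\<^sup>+s. \<integral>\<^sup>+x. indicator {0<..} s * indicator {s. ennreal s < f x} s \<partial>M \<partial>lborel)"
    by (rule Fubini') measurable
  also have "\<dots> = (\<integral>\<^sup>+s. emeasure M {x \<in> space M. f x > ennreal s} * indicator {0<..} s \<partial>lborel)"
  proof (intro nn_integral_cong)
    fix s :: real
    have "(\<integral>\<^sup>+x. indicator {0<..} s * indicator {s. ennreal s < f x} s \<partial>M)
      = (\<integral>\<^sup>+x. indicator {0<..} s * indicator {x \<in> space M. f x > ennreal s} x \<partial>M)"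
      by (intro nn_integral_cong) (auto simp: indicator_def)
    also have "\<dots> = emeasure M {x \<in> space M. f x > ennreal s} * indicator {0<..} s"
      by (subst nn_integral_cmult) (auto simp: mult.commute)
    finally show "(\<integral>\<^sup>+x. indicator {0<..} s * indicator {s. ennreal s < f x} s \<partial>M)
      = emeasure M {x \<in> space M. f x > ennreal s} * indicator {0<..} s" .
  qed
  finally show ?thesis .
qed

lemma nn_integral_mono_distribution:
  fixes F :: "'a::euclidean_space \<Rightarrow> ennreal" and h :: "real \<Rightarrow> ennreal"
  assumes F: "F \<in> borel_measurable lebesgue" and h: "h \<in> borel_measurable borel"
    and le: "\<And>s. s > 0 \<Longrightarrow> emeasure lebesgue {x. F x > ennreal s} \<le> emeasure lborel {t. h t > ennreal s}"
  shows "(\<integral>\<^sup>+x. F x \<partial>lebesgue) \<le> (\<integral>\<^sup>+t. h t \<partial>lborel)"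
proof -
  \<comment> \<open>The layer cake formula is applied over \<open>lborel\<close>, so
    \<open>F\<close> is replaced by a Borel function that agrees with it almost everywhere.\<close>
  obtain F' where F': "F' \<in> borel_measurable lborel" and ae: "AE x in lborel. F x = F' x"
    using completion_ex_borel_measurable[OF F] by blast
  have "(\<integral>\<^sup>+x. F x \<partial>lebesgue) = (\<integral>\<^sup>+x. F' x \<partial>lborel)"
    using ae by (simp add: nn_integral_completion nn_integral_cong_AE)
  also have "\<dots> = (\<integral>\<^sup>+s. emeasure lborel {x \<in> space lborel. F' x > ennreal s} * indicator {0<..} s \<partial>lborel)"
    using F' by (intro sigma_finite_layer_cake sigma_finite_lborel)
  also have "\<dots> \<le> (\<integral>\<^sup>+s. emeasure lborel {t \<in> space lborel. h t > ennreal s} * indicator {0<..} s \<partial>lborel)"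
  proof (intro nn_integral_mono)
    fix s :: real
    have [measurable]: "F' \<in> borel_measurable borel" "F \<in> borel_measurable lebesgue" using F' F by simp_all
    have "emeasure lborel {x. F' x > ennreal s} = emeasure lebesgue {x. F' x > ennreal s}"
      by (intro emeasure_lebesgue_borel[symmetric]) measurable
    also have "\<dots> = emeasure lebesgue {x. F x > ennreal s}"
    proof (rule emeasure_eq_AE)
      show "AE x in lebesgue. (x \<in> {x. ennreal s < F' x}) = (x \<in> {x. ennreal s < F x})"
        using AE_completion[OF ae] by eventually_elim auto
      show "{x. ennreal s < F' x} \<in> sets lebesgue"
        by (rule sets_completionI_sets) measurable
      show "{x. ennreal s < F x} \<in> sets lebesgue"
        by (rule superlevel_sets_lebesgue[OF F])
    qed
    finally show "emeasure lborel {x \<in> space lborel. F' x > ennreal s} * indicator {0<..} s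
      \<le> emeasure lborel {t \<in> space lborel. h t > ennreal s} * indicator {0<..} s"
      using le[of s] by (auto simp: indicator_def)
  qed
  also have "\<dots> = (\<integral>\<^sup>+t. h t \<partial>lborel)"
    using h by (intro sigma_finite_layer_cake[symmetric] sigma_finite_lborel) simp
  finally show ?thesis .
qed

text \<open>The infimum behind \<open>decr_rearr\<close> loses nothing because the distribution
  function is right-continuous: the superlevel set at \<open>s\<close> is the increasing union of
  those at \<open>s + 1 / Suc n\<close>. The equivalence lets later claims about rearrangements be
  read off from distribution functions.\<close>

lemma decr_rearr_le_iff:
  assumes f: "f \<in> borel_measurable lebesgue" and "s > 0"
  shows "decr_rearr f t \<le> ennreal s \<longleftrightarrow> emeasure lebesgue {x. f x > ennreal s} \<le> ennreal t"
proof
  assume "emeasure lebesgue {x. f x > ennreal s} \<le> ennreal t"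
  then show "decr_rearr f t \<le> ennreal s"
    unfolding decr_rearr_def using \<open>s > 0\<close> by (intro Inf_lower) auto
next
  assume le: "decr_rearr f t \<le> ennreal s"
  have sets: "{x. f x > a} \<in> sets lebesgue" for a
    by (rule superlevel_sets_lebesgue[OF f])
  have *: "emeasure lebesgue {x. f x > ennreal (s + 1 / Suc n)} \<le> ennreal t" for n
  proof -
    have "decr_rearr f t < ennreal (s + 1 / Suc n)"
      using \<open>s > 0\<close> by (intro le_less_trans[OF le]) (simp add: ennreal_less_iff)
    then obtain s' where s': "s' > 0" "emeasure lebesgue {x. f x > ennreal s'} \<le> ennreal t"
      "ennreal s' < ennreal (s + 1 / Suc n)"
      unfolding decr_rearr_def Inf_less_iff by auto
    have "emeasure lebesgue {x. f x > ennreal (s + 1 / Suc n)} \<le> emeasure lebesgue {x. f x > ennreal s'}"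
      using s'(3) by (intro emeasure_mono sets) auto
    then show ?thesis using s'(2) by order
  qed
  have "{x. f x > ennreal s} = (\<Union>n. {x. f x > ennreal (s + 1 / Suc n)})"
  proof safe
    fix x assume "ennreal s < f x"
    show "x \<in> (\<Union>n. {x. f x > ennreal (s + 1 / Suc n)})"
    proof (cases "f x")
      case (real r)
      then have "s < r" using \<open>ennreal s < f x\<close> \<open>s > 0\<close> by (simp add: ennreal_less_iff)
      then obtain n where "1 / Suc n < r - s" using nat_approx_posE[of "r - s"] by auto
      then have "ennreal (s + 1 / Suc n) < f x" using real \<open>s > 0\<close>
        by (simp add: ennreal_less_iff del: ennreal_plus of_nat_Suc)
      then show ?thesis by blast
    qed auto
  next
    fix n x assume "ennreal (s + 1 / Suc n) < f x"
    moreover have "ennreal s \<le> ennreal (s + 1 / Suc n)" by (intro ennreal_leI) simp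
    ultimately show "ennreal s < f x" by order
  qed
  also have "emeasure lebesgue \<dots> = (SUP n. emeasure lebesgue {x. f x > ennreal (s + 1 / Suc n)})"
  proof (rule SUP_emeasure_incseq[symmetric])
    show "incseq (\<lambda>n. {x. f x > ennreal (s + 1 / Suc n)})"
    proof (intro incseq_SucI subsetI CollectI)
      fix n x assume "x \<in> {x. f x > ennreal (s + 1 / Suc n)}"
      moreover have "ennreal (s + 1 / Suc (Suc n)) \<le> ennreal (s + 1 / Suc n)"
        by (intro ennreal_leI) (simp add: frac_le)
      ultimately show "f x > ennreal (s + 1 / Suc (Suc n))" by (simp add: order.strict_trans1)
    qed
  qed (use sets in auto)
  also have "\<dots> \<le> ennreal t" using * by (intro SUP_least)
  finally show "emeasure lebesgue {x. f x > ennreal s} \<le> ennreal t" .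
qed

lemma decr_rearr_antimono: "antimono (decr_rearr f)"
  unfolding decr_rearr_def antimono_def
  by (intro allI impI Inf_superset_mono) (blast intro: order_trans ennreal_leI)

text \<open>Over a fixed interval of integration, monotonicity of the averages is inherited
  pointwise from \<open>decr_rearr\<close>.\<close>

lemma max_rearr_eq_unit_integral:
  assumes "t > 0"
  shows "max_rearr f t = (\<integral>\<^sup>+s\<in>{0<..<1}. decr_rearr f (t * s) \<partial>lborel)"
proof -
  have [measurable]: "decr_rearr f \<in> borel_measurable borel"
    by (rule borel_measurable_antimono_ennreal[OF decr_rearr_antimono])
  have "(\<integral>\<^sup>+s\<in>{0<..<t}. decr_rearr f s \<partial>lborel)
     = ennreal t * (\<integral>\<^sup>+s. decr_rearr f (t * s) * indicator {0<..<t} (t * s) \<partial>lborel)"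
    using assms by (subst nn_integral_real_affine[where c = t and t = 0]) auto
  also have "(\<lambda>s. indicator {0<..<t} (t * s) :: ennreal) = indicator {0<..<1}"
    using assms by (auto simp: indicator_def zero_less_mult_iff fun_eq_iff)
  then have "(\<integral>\<^sup>+s. decr_rearr f (t * s) * indicator {0<..<t} (t * s) \<partial>lborel)
    = (\<integral>\<^sup>+s\<in>{0<..<1}. decr_rearr f (t * s) \<partial>lborel)" by metis
  finally show ?thesis
    unfolding max_rearr_def using assms
    by (simp add: mult.assoc[symmetric] ennreal_mult[symmetric])
qed

lemma max_rearr_antimono:
  assumes "0 < a" "a \<le> b"
  shows "max_rearr f b \<le> max_rearr f a"
proof -
  have "max_rearr f b = (\<integral>\<^sup>+s\<in>{0<..<1}. decr_rearr f (b * s) \<partial>lborel)"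
    using assms by (intro max_rearr_eq_unit_integral) auto
  also have "\<dots> \<le> (\<integral>\<^sup>+s\<in>{0<..<1}. decr_rearr f (a * s) \<partial>lborel)"
    using assms by (intro nn_integral_mono)
      (auto simp: indicator_def intro!: antimonoD[OF decr_rearr_antimono] mult_right_mono)
  also have "\<dots> = max_rearr f a"
    using assms by (intro max_rearr_eq_unit_integral[symmetric]) auto
  finally show ?thesis .
qed

text \<open>Compare superlevel sets at each height \<open>s\<close>: on the left their measure is at
  most the minimum of \<open>e\<close> and the distribution of \<open>f\<close> at \<open>s\<close>,
  and on the right it equals that minimum.\<close>

lemma hardy_littlewood_indicator:
  assumes f: "f \<in> borel_measurable lebesgue" and E: "E \<in> sets lebesgue"
    and e: "emeasure lebesgue E = ennreal e" "e \<ge> 0"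
  shows "(\<integral>\<^sup>+x\<in>E. f x \<partial>lebesgue) \<le> (\<integral>\<^sup>+t\<in>{0<..<e}. decr_rearr f t \<partial>lborel)"
proof (rule nn_integral_mono_distribution)
  have [measurable]: "decr_rearr f \<in> borel_measurable borel"
    by (rule borel_measurable_antimono_ennreal[OF decr_rearr_antimono])
  show "(\<lambda>t. decr_rearr f t * indicator {0<..<e} t) \<in> borel_measurable borel" by measurable
  show "(\<lambda>x. f x * indicator E x) \<in> borel_measurable lebesgue" using f E by measurable
  fix s :: real assume s: "s > 0"
  have sets: "{x. f x > ennreal s} \<in> sets lebesgue"
    by (rule superlevel_sets_lebesgue[OF f])
  have "{x. f x * indicator E x > ennreal s} = {x. f x > ennreal s} \<inter> E"
    by (auto simp: indicator_def)
  then have le: "emeasure lebesgue {x. f x * indicator E x > ennreal s}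
      \<le> min (emeasure lebesgue {x. f x > ennreal s}) (ennreal e)"
    using sets E by (auto intro!: emeasure_mono simp flip: e(1))
  have "{t. decr_rearr f t * indicator {0<..<e} t > ennreal s}
     = {t\<in>{0<..<e}. emeasure lebesgue {x. f x > ennreal s} > ennreal t}"
    using decr_rearr_le_iff[OF f s] by (auto simp: indicator_def not_le[symmetric])
  also have "emeasure lborel \<dots> = min (emeasure lebesgue {x. f x > ennreal s}) (ennreal e)"
  proof (cases "emeasure lebesgue {x. f x > ennreal s}")
    case (real r)
    then have "{t\<in>{0<..<e}. emeasure lebesgue {x. f x > ennreal s} > ennreal t} = {0<..<min r e}"
      by (auto simp: ennreal_less_iff)
    then show ?thesis using real e by (simp add: min_def)
  next
    case top
    then have "{t\<in>{0<..<e}. emeasure lebesgue {x. f x > ennreal s} > ennreal t} = {0<..<e}" by auto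
    then show ?thesis using top e by simp
  qed
  finally show "emeasure lebesgue {x. f x * indicator E x > ennreal s}
     \<le> emeasure lborel {t. decr_rearr f t * indicator {0<..<e} t > ennreal s}" using le by simp
qed

section \<open>The Hardy-Littlewood maximal operator\<close>

text \<open>Centred averages, normalised by \<open>r ^ CARD('n)\<close> in place of the volume of
  the ball; the volume factor \<open>unit_ball_vol\<close> reappears in
  \<open>hl_const\<close>.\<close>

definition hl_max :: "(real^'n \<Rightarrow> ennreal) \<Rightarrow> real^'n \<Rightarrow> ennreal" where
  "hl_max f x = (SUP r\<in>{0<..}. ennreal (1 / r ^ CARD('n)) * (\<integral>\<^sup>+y\<in>cball x r. f y \<partial>lebesgue))"

lemma hl_max_upper:
  fixes f :: "real^'n \<Rightarrow> ennreal"
  assumes "r > 0"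
  shows "(\<integral>\<^sup>+y\<in>cball x r. f y \<partial>lebesgue) \<le> ennreal (r ^ CARD('n)) * hl_max f x"
proof -
  let ?I = "\<lambda>r. \<integral>\<^sup>+y\<in>cball x r. f y \<partial>lebesgue"
  have "ennreal (1 / r ^ CARD('n)) * ?I r \<le> hl_max f x"
    unfolding hl_max_def using assms by (intro SUP_upper) auto
  then have "ennreal (r ^ CARD('n)) * (ennreal (1 / r ^ CARD('n)) * ?I r)
    \<le> ennreal (r ^ CARD('n)) * hl_max f x"
    by (rule mult_left_mono) simp
  then show ?thesis
    using assms by (simp add: mult.assoc[symmetric] ennreal_mult[symmetric])
qed

lemma hl_max_greaterE:
  fixes f :: "real^'n \<Rightarrow> ennreal"
  assumes "hl_max f x > ennreal s" "s \<ge> 0"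
  obtains r where "r > 0" "(\<integral>\<^sup>+y\<in>cball x r. f y \<partial>lebesgue) > ennreal (s * r ^ CARD('n))"
proof -
  let ?I = "\<lambda>r. \<integral>\<^sup>+y\<in>cball x r. f y \<partial>lebesgue"
  obtain r where r: "r > 0" "ennreal s < ennreal (1 / r ^ CARD('n)) * ?I r"
    using assms(1) unfolding hl_max_def less_SUP_iff by auto
  have "ennreal (r ^ CARD('n)) * ennreal s <
      ennreal (r ^ CARD('n)) * (ennreal (1 / r ^ CARD('n)) * ?I r)"
    using r by (intro ennreal_mult_strict_left_mono) auto
  then have "?I r > ennreal (s * r ^ CARD('n))"
    using r(1) assms(2) by (simp add: mult.assoc[symmetric] ennreal_mult[symmetric] mult.commute)
  with r(1) that show ?thesis by blast
qed

lemma hl_max_greaterI: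
  fixes f :: "real^'n \<Rightarrow> ennreal"
  assumes "r > 0" "(\<integral>\<^sup>+y\<in>cball x r. f y \<partial>lebesgue) > ennreal (s * r ^ CARD('n))" "s \<ge> 0"
  shows "hl_max f x > ennreal s"
proof (rule ccontr)
  assume "\<not> hl_max f x > ennreal s"
  then have "(\<integral>\<^sup>+y\<in>cball x r. f y \<partial>lebesgue) \<le> ennreal (r ^ CARD('n)) * ennreal s"
    by (intro order_trans[OF hl_max_upper[OF assms(1)]] mult_left_mono) auto
  then show False using assms by (simp add: ennreal_mult[symmetric] mult.commute)
qed

text \<open>A strict inequality at radius \<open>r\<close> survives a slightly larger radius, and
  the enlarged ball about a nearby point contains the original one.\<close>

lemma open_hl_max_superlevel:
  fixes f :: "real^'n \<Rightarrow> ennreal"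
  assumes s: "s \<ge> 0"
  shows "open {x. hl_max f x > ennreal s}"
proof (rule openI)
  let ?I = "\<lambda>x r. \<integral>\<^sup>+y\<in>cball x r. f y \<partial>lebesgue"
  fix x assume "x \<in> {x. hl_max f x > ennreal s}"
  then obtain r where r: "r > 0" "?I x r > ennreal (s * r ^ CARD('n))"
    using hl_max_greaterE[OF _ s] by blast
  have "((\<lambda>\<delta>. ennreal (s * (r + \<delta>) ^ CARD('n))) \<longlongrightarrow> ennreal (s * (r + 0) ^ CARD('n))) (at_right 0)"
    by (intro tendsto_ennrealI tendsto_intros)
  then have "\<forall>\<^sub>F \<delta> in at_right 0. ennreal (s * (r + \<delta>) ^ CARD('n)) < ?I x r"
    using r(2) by (intro order_tendstoD(2)) auto
  moreover have "\<forall>\<^sub>F \<delta> in at_right (0::real). \<delta> > 0" by (rule eventually_at_right_less)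
  ultimately have "\<forall>\<^sub>F \<delta> in at_right 0. \<delta> > 0 \<and>
      ennreal (s * (r + \<delta>) ^ CARD('n)) < ?I x r"
    by eventually_elim auto
  then obtain \<delta> where \<delta>: "\<delta> > 0" "ennreal (s * (r + \<delta>) ^ CARD('n)) < ?I x r"
    using eventually_happens[of _ "at_right (0::real)"] by auto
  have "ball x \<delta> \<subseteq> {x. hl_max f x > ennreal s}"
  proof safe
    fix z assume "z \<in> ball x \<delta>"
    then have "cball x r \<subseteq> cball z (r + \<delta>)"
      by (intro cball_subset_cball_iff[THEN iffD2]) (auto simp: dist_commute)
    then have "?I x r \<le> (\<integral>\<^sup>+y\<in>cball z (r + \<delta>). f y \<partial>lebesgue)"
      by (intro nn_integral_mono) (auto simp: indicator_def)
    then show "hl_max f z > ennreal s"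
      using \<delta> r s by (intro hl_max_greaterI[of "r + \<delta>"]) (auto intro: less_le_trans)
  qed
  with \<delta>(1) show "\<exists>e>0. ball x e \<subseteq> {x. hl_max f x > ennreal s}" by blast
qed

lemma hl_max_measurable: "hl_max f \<in> borel_measurable lebesgue"
proof -
  have "hl_max f \<in> borel_measurable borel"
  proof (rule borel_measurableI_greater)
    fix a
    show "{x \<in> space borel. hl_max f x > a} \<in> sets borel"
    proof (cases a)
      case (real s)
      then show ?thesis using open_hl_max_superlevel[of s f] by simp
    qed simp
  qed
  then show ?thesis by (intro measurable_completion) simp
qed

lemma hl_max_mono: "(\<And>x. f x \<le> g x) \<Longrightarrow> hl_max f x \<le> hl_max g x"
  unfolding hl_max_def
  by (intro SUP_mono' mult_left_mono nn_integral_mono mult_right_mono) auto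

text \<open>\<open>E\<close> is a disjoint union of balls each of which carries a large integral of
  \<open>f\<close>, so the last estimate is additive over them, while the fivefold balls cover
  \<open>K\<close>. Compactness reduces the family to finitely many balls, hence to bounded
  radii.\<close>

lemma hl_max_vitali:
  fixes f :: "real^'n \<Rightarrow> ennreal"
  assumes f: "f \<in> borel_measurable lebesgue" and s: "s > 0" and K: "compact K"
    and sub: "K \<subseteq> {x. hl_max f x > ennreal s}"
  obtains E where "E \<in> sets lebesgue" "emeasure lebesgue E < \<infinity>"
    "emeasure lebesgue K \<le> ennreal (5 ^ CARD('n)) * emeasure lebesgue E"
    "ennreal s * emeasure lebesgue E \<le> ennreal (unit_ball_vol (real CARD('n))) * (\<integral>\<^sup>+x\<in>E. f x \<partial>lebesgue)"
proof -
  let ?I = "\<lambda>x r. \<integral>\<^sup>+y\<in>cball x r. f y \<partial>lebesgue"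
  let ?\<omega> = "unit_ball_vol (real CARD('n))"
  have *: "\<forall>x\<in>K. \<exists>r>0. ?I x r > ennreal (s * r ^ CARD('n))"
  proof
    fix x assume "x \<in> K"
    then have "hl_max f x > ennreal s" using sub by auto
    then show "\<exists>r>0. ?I x r > ennreal (s * r ^ CARD('n))"
      by (rule hl_max_greaterE) (use s in auto)
  qed
  obtain r where r: "\<And>x. x \<in> K \<Longrightarrow> r x > 0"
    "\<And>x. x \<in> K \<Longrightarrow> ?I x (r x) > ennreal (s * r x ^ CARD('n))"
  proof -
    have "\<forall>x. \<exists>r. x \<in> K \<longrightarrow> r > 0 \<and> ?I x r > ennreal (s * r ^ CARD('n))"
      using * by blast
    then obtain r where "\<forall>x. x \<in> K \<longrightarrow> r x > 0 \<and> ?I x (r x) > ennreal (s * r x ^ CARD('n))"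
      by (rule choice[THEN exE])
    then show ?thesis by (intro that[of r]) simp_all
  qed
  obtain F where F: "F \<subseteq> K" "finite F" "K \<subseteq> (\<Union>x\<in>F. ball x (r x))"
  proof (rule compactE_image[OF K, of K "\<lambda>x. ball x (r x)"])
    show "K \<subseteq> (\<Union>x\<in>K. ball x (r x))" using r(1) by force
  qed auto
  \<comment> \<open>Inserting 1 keeps the maximum well-defined when \<open>F\<close> is
    empty.\<close>
  define R where "R = Max (insert 1 (r ` F))"
  have R: "r x \<le> R" if "x \<in> F" for x
    unfolding R_def using F(2) that by (intro Max_ge) auto
  obtain C where C: "countable C" "C \<subseteq> F"
     "pairwise (\<lambda>i j. disjnt (cball i (r i)) (cball j (r j))) C"
     "K \<subseteq> (\<Union>i\<in>C. cball i (5 * r i))"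
  proof (rule Vitali_covering_lemma_cballs[of K "\<lambda>x. x" r F R])
    show "K \<subseteq> (\<Union>i\<in>F. cball i (r i))" by (rule subset_trans[OF F(3)]) (intro UN_mono subset_refl ball_subset_cball)
  qed (use r R F in auto)
  have fC: "finite C" using C(2) F(2) finite_subset by blast
  have disj: "disjoint_family_on (\<lambda>i. cball i (r i)) C"
    using C(3) by (auto simp: disjoint_family_on_def pairwise_def disjnt_def)
  have rC: "r i > 0" if "i \<in> C" for i using that C F r by blast
  define E where "E = (\<Union>i\<in>C. cball i (r i))"
  have vol: "emeasure lebesgue (cball i t) = ennreal (?\<omega> * t ^ CARD('n))" if "t \<ge> 0" for i :: "real^'n" and t
    using that by (simp add: emeasure_lebesgue_borel emeasure_cball)
  have E: "E \<in> sets lebesgue" unfolding E_def using fC by (rule sets.finite_UN) simp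
  have mE: "emeasure lebesgue E = (\<Sum>i\<in>C. ennreal (?\<omega> * r i ^ CARD('n)))"
  proof -
    have "emeasure lebesgue E = (\<Sum>i\<in>C. emeasure lebesgue (cball i (r i)))"
      unfolding E_def using disj fC by (intro sum_emeasure[symmetric]) auto
    also have "\<dots> = (\<Sum>i\<in>C. ennreal (?\<omega> * r i ^ CARD('n)))"
      using rC by (intro sum.cong vol) (auto intro: less_imp_le)
    finally show ?thesis .
  qed
  show ?thesis
  proof (rule that[OF E])
    have "emeasure lebesgue E = ennreal (\<Sum>i\<in>C. ?\<omega> * r i ^ CARD('n))"
      unfolding mE
    proof (rule sum_ennreal)
      fix i assume "i \<in> C"
      then have "r i > 0" by (rule rC)
      then show "0 \<le> ?\<omega> * r i ^ CARD('n)" by simp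
    qed
    then show "emeasure lebesgue E < \<infinity>" by simp
    have "emeasure lebesgue K \<le> emeasure lebesgue (\<Union>i\<in>C. cball i (5 * r i))"
      using C fC by (intro emeasure_mono sets.finite_UN) auto
    also have "\<dots> \<le> (\<Sum>i\<in>C. emeasure lebesgue (cball i (5 * r i)))"
      using fC by (intro emeasure_subadditive_finite) auto
    also have "\<dots> = (\<Sum>i\<in>C. ennreal (5 ^ CARD('n)) * ennreal (?\<omega> * r i ^ CARD('n)))"
    proof (intro sum.cong refl)
      fix i assume "i \<in> C"
      then have "r i > 0" by (rule rC)
      then show "emeasure lebesgue (cball i (5 * r i)) = ennreal (5 ^ CARD('n)) * ennreal (?\<omega> * r i ^ CARD('n))"
        by (subst vol) (auto simp: ennreal_mult[symmetric] power_mult_distrib mult_ac)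
    qed
    also have "\<dots> = ennreal (5 ^ CARD('n)) * emeasure lebesgue E"
      unfolding mE by (simp add: sum_distrib_left)
    finally show "emeasure lebesgue K \<le> ennreal (5 ^ CARD('n)) * emeasure lebesgue E" .
    have "ennreal s * emeasure lebesgue E = (\<Sum>i\<in>C. ennreal ?\<omega> * ennreal (s * r i ^ CARD('n)))"
      unfolding mE sum_distrib_left using s rC
      by (intro sum.cong refl) (auto simp: ennreal_mult[symmetric] mult_ac less_imp_le)
    also have "\<dots> \<le> (\<Sum>i\<in>C. ennreal ?\<omega> * ?I i (r i))"
    proof (intro sum_mono mult_left_mono)
      fix i assume "i \<in> C"
      then have "i \<in> K" using C F by blast
      then show "ennreal (s * r i ^ CARD('n)) \<le> ?I i (r i)"
        by (intro less_imp_le r(2))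
    qed simp
    also have "\<dots> = ennreal ?\<omega> * (\<Sum>i\<in>C. \<integral>\<^sup>+y\<in>cball i (r i). f y \<partial>lebesgue)"
      by (simp add: sum_distrib_left)
    also have "(\<Sum>i\<in>C. \<integral>\<^sup>+y\<in>cball i (r i). f y \<partial>lebesgue)
        = (\<integral>\<^sup>+y. (\<Sum>i\<in>C. f y * indicator (cball i (r i)) y) \<partial>lebesgue)"
    proof (rule nn_integral_sum[symmetric])
      fix i assume "i \<in> C"
      have [measurable]: "cball i (r i) \<in> sets lebesgue" by simp
      show "(\<lambda>y. f y * indicator (cball i (r i)) y) \<in> borel_measurable lebesgue" using f by measurable
    qed
    also have "\<dots> = (\<integral>\<^sup>+y\<in>E. f y \<partial>lebesgue)"
      unfolding E_def sum_distrib_left[symmetric] using disj fC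
      by (intro nn_integral_cong) (simp add: indicator_UN_disjoint)
    finally show "ennreal s * emeasure lebesgue E \<le> ennreal ?\<omega> * (\<integral>\<^sup>+x\<in>E. f x \<partial>lebesgue)" .
  qed
qed

text \<open>The factor \<open>5\<^sup>n\<close> comes from the covering lemma; the factor 2 leaves room for strict inequalities.\<close>

definition hl_const :: "'n::finite itself \<Rightarrow> real" where
  "hl_const _ = 2 * unit_ball_vol (real CARD('n)) * (5 ^ CARD('n) + 1)"

lemma hl_const_pos: "hl_const TYPE('n::finite) > 0"
  by (simp add: hl_const_def add_pos_pos)

lemma open_compact_exhaustion:
  fixes U :: "'a::euclidean_space set"
  assumes "open U"
  obtains K :: "nat \<Rightarrow> 'a set" where "\<And>i. compact (K i)" "incseq K" "(\<Union>i. K i) = U"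
proof -
  obtain D where D: "countable D" "\<And>X. X \<in> D \<Longrightarrow> \<exists>a b. X = cbox a b" "\<Union>D = U"
    using open_countable_Union_open_cbox[OF assms] by metis
  \<comment> \<open>The empty set is added because an enumeration needs a nonempty family.\<close>
  define K where "K = from_nat_into (insert {} D)"
  have rK: "range K = insert {} D" unfolding K_def using D(1) by (intro range_from_nat_into) auto
  have "compact X" if "X \<in> insert {} D" for X using D(2)[of X] that by auto
  then have K: "range K \<subseteq> Collect compact" "U = (\<Union>i. K i)" using D(3) by (auto simp: rK)
  define L where "L n = (\<Union>i\<le>n. K i)" for n
  have "compact (L n)" for n unfolding L_def using K(1) by (intro compact_UN) auto
  moreover have "incseq L" unfolding L_def incseq_def by force
  moreover have "(\<Union>i. L i) = U" unfolding L_def K(2) by auto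
  ultimately show ?thesis using that by blast
qed

lemma is_interval_max_rearr_superlevel: "is_interval {t \<in> {0<..}. max_rearr f t > a}"
  unfolding is_interval_1
proof (intro ballI allI impI)
  fix p q x
  assume "p \<in> {t \<in> {0<..}. max_rearr f t > a}" "q \<in> {t \<in> {0<..}. max_rearr f t > a}" "p \<le> x \<and> x \<le> q"
  then show "x \<in> {t \<in> {0<..}. max_rearr f t > a}"
    using max_rearr_antimono[of x q f] by (simp add: less_le_trans)
qed

text \<open>One half of the classical equivalence between the rearranged maximal function and the
  averages \<open>max_rearr\<close>. The left-hand set is open, so it suffices to treat its compact
  subsets \<open>K\<close>. The covering lemma supplies \<open>E\<close> of measure \<open>e\<close>
  with \<open>K\<close> of measure at most \<open>5 ^ CARD('n) * e\<close>, and an interval of that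
  length is found inside the right-hand set.\<close>

lemma hl_max_distribution_le:
  fixes f :: "real^'n \<Rightarrow> ennreal"
  assumes f: "f \<in> borel_measurable lebesgue" and s: "s > 0"
  shows "emeasure lebesgue {x. hl_max f x > ennreal (hl_const TYPE('n) * s)}
     \<le> emeasure lborel {t \<in> {0<..}. max_rearr f t > ennreal s}"
proof -
  let ?D = "{t \<in> {0<..}. max_rearr f t > ennreal s}"
  define \<omega> where "\<omega> = unit_ball_vol (real CARD('n))"
  let ?C = "hl_const TYPE('n)"
  let ?U = "{x. hl_max f x > ennreal (?C * s)}"
  have \<omega>: "\<omega> > 0" unfolding \<omega>_def by simp
  have C: "?C > 0" by (rule hl_const_pos)
  have "is_interval ?D"
    by (rule is_interval_max_rearr_superlevel)
  then have msets: "?D \<in> sets lborel"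
    by (simp add: real_interval_borel_measurable)
  have main: "emeasure lebesgue K \<le> emeasure lborel ?D"
    if K: "compact K" "K \<subseteq> ?U" for K
  proof -
    obtain E where E: "E \<in> sets lebesgue" "emeasure lebesgue E < \<infinity>"
      "emeasure lebesgue K \<le> ennreal (5 ^ CARD('n)) * emeasure lebesgue E"
      "ennreal (?C * s) * emeasure lebesgue E \<le> ennreal \<omega> * (\<integral>\<^sup>+x\<in>E. f x \<partial>lebesgue)"
      using hl_max_vitali[OF f _ K] mult_pos_pos[OF C s] unfolding \<omega>_def by blast
    obtain e where e: "emeasure lebesgue E = ennreal e" "e \<ge> 0"
      using E(2) by (cases "emeasure lebesgue E") auto
    have "ennreal \<omega> * ennreal (?C * s * e / \<omega>) = ennreal (?C * s) * emeasure lebesgue E"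
      using C s e \<omega> by (simp add: ennreal_mult[symmetric])
    also have "\<dots> \<le> ennreal \<omega> * (\<integral>\<^sup>+t\<in>{0<..<e}. decr_rearr f t \<partial>lborel)"
      by (rule order_trans[OF E(4) mult_left_mono[OF hardy_littlewood_indicator[OF f E(1) e]]]) simp
    finally have int: "ennreal (?C * s * e / \<omega>) \<le> (\<integral>\<^sup>+t\<in>{0<..<e}. decr_rearr f t \<partial>lborel)"
      using \<omega> by (subst (asm) ennreal_mult_le_mult_iff) auto
    \<comment> \<open>For \<open>t > e\<close> the average up to \<open>t\<close> is at least
      \<open>1 / t\<close> times the integral up to \<open>e\<close>, and \<open>hl_const\<close> is
      chosen so that this exceeds \<open>2 * s\<close> as long as
      \<open>t < (5 ^ CARD('n) + 1) * e\<close>. Such \<open>t\<close> form an interval of length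
      \<open>5 ^ CARD('n) * e\<close>.\<close>
    have "max_rearr f t > ennreal s" if t: "e < t" "t < (5 ^ CARD('n) + 1) * e" for t
    proof -
      have e0: "e > 0" using t e(2) by (cases "e = 0") auto
      then have t0: "t > 0" using t by linarith
      have "s * t < ?C * s * e / \<omega>"
      proof -
        have "?C * s * e / \<omega> = 2 * s * ((5 ^ CARD('n) + 1) * e)"
          using \<omega> by (simp add: hl_const_def \<omega>_def[symmetric])
        also have "\<dots> > 2 * s * t" using t s by (intro mult_strict_left_mono) auto
        finally have "2 * s * t < ?C * s * e / \<omega>" .
        moreover have "s * t > 0" using s t0 by simp
        ultimately show ?thesis by linarith
      qed
      then obtain A where A_def: "A = ?C * s * e / \<omega>" and At: "s * t < A" by (intro that[OF refl])
      from At have A: "s < (1 / t) * A" using t0 by (simp add: field_simps)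
      then have "0 < (1 / t) * A" using s by linarith
      then have A0: "A > 0" using t0 by (simp add: zero_less_divide_iff)
      have "ennreal s < ennreal ((1 / t) * A)"
        using \<open>0 < (1 / t) * A\<close> A by (rule ennreal_lessI)
      also have "\<dots> = ennreal (1 / t) * ennreal A"
        using A0 t0 by (intro ennreal_mult) simp_all
      also have "\<dots> \<le> ennreal (1 / t) * (\<integral>\<^sup>+r\<in>{0<..<t}. decr_rearr f r \<partial>lborel)"
        unfolding A_def using t
        by (intro mult_left_mono order_trans[OF int] nn_integral_mono) (auto simp: indicator_def)
      finally show ?thesis by (simp add: max_rearr_def)
    qed
    then have sub: "{e<..<(5 ^ CARD('n) + 1) * e} \<subseteq> ?D"
      using e by auto
    have "emeasure lebesgue K \<le> ennreal (5 ^ CARD('n) * e)"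
      using E(3) e by (simp add: ennreal_mult)
    also have "\<dots> = emeasure lborel {e<..<(5 ^ CARD('n) + 1) * e}"
      using e by (subst emeasure_lborel_Ioo) (auto simp: algebra_simps)
    also have "\<dots> \<le> emeasure lborel ?D"
      using sub msets by (intro emeasure_mono)
    finally show ?thesis .
  qed
  have "open ?U" using C s by (intro open_hl_max_superlevel) auto
  then obtain K where K: "\<And>i. compact (K i)" "incseq K" "(\<Union>i. K i) = ?U"
    by (rule open_compact_exhaustion) (auto simp: image_def)
  have "emeasure lebesgue ?U = (SUP i. emeasure lebesgue (K i))"
    unfolding K(3)[symmetric] using K(1,2) by (intro SUP_emeasure_incseq[symmetric])
      (auto intro!: sets_completionI_sets borel_compact)
  also have "\<dots> \<le> emeasure lborel ?D"
    using K by (intro SUP_least main) auto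
  finally show ?thesis .
qed

lemma emeasure_lebesgue_on_superlevel_max_rearr:
  "emeasure (lebesgue_on {0<..}) {t \<in> space (lebesgue_on {0<..}). max_rearr f t > ennreal s}
   = emeasure lborel {t \<in> {0<..}. max_rearr f t > ennreal s}"
proof -
  let ?I = "{t \<in> {0<..}. max_rearr f t > ennreal s}"
  have "is_interval ?I"
    by (rule is_interval_max_rearr_superlevel)
  then have Ib: "?I \<in> sets borel" by (rule real_interval_borel_measurable)
  have "emeasure (lebesgue_on {0<..}) ?I = emeasure lebesgue ?I"
    by (intro emeasure_restrict_space) auto
  also have "\<dots> = emeasure lborel ?I" using Ib by (rule emeasure_lebesgue_borel)
  finally show ?thesis by (simp add: space_restrict_space)
qed

section \<open>Transport between sets of equal measure\<close>

text \<open>The volume of \<open>B\<close> inside the ball of radius \<open>norm x\<close> is a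
  coordinate on \<open>B\<close> that carries Lebesgue measure to length. It depends continuously on
  the radius because spheres are null sets.\<close>

lemma emeasure_sublevel_volume:
  fixes B :: "(real^'n) set"
  assumes B: "B \<in> sets lebesgue" and T: "T \<le> emeasure lebesgue B"
  defines "L \<equiv> {x \<in> B. ennreal (measure lebesgue (B \<inter> ball 0 (norm x))) < T}"
  shows "L \<in> sets lebesgue" "emeasure lebesgue L = T"
proof -
  let ?d = "\<lambda>n. 1 / real (Suc n)"
  define M where "M r = emeasure lebesgue (B \<inter> ball 0 r)" for r
  have bs: "B \<inter> ball 0 r \<in> sets lebesgue" "B \<inter> cball 0 r \<in> sets lebesgue" for r using B by auto
  have bfin: "emeasure lebesgue (ball (0::real^'n) r) < \<infinity>" for r
    using emeasure_lborel_ball_finite[of "0::real^'n" r] by (simp add: emeasure_lebesgue_borel)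
  have fin: "M r < \<infinity>" for r
    unfolding M_def using bs by (intro le_less_trans[OF emeasure_mono bfin[of r]]) auto
  have M: "ennreal (measure lebesgue (B \<inter> ball 0 r)) = M r" for r
    unfolding M_def using fin[of r] by (simp add: M_def emeasure_eq_ennreal_measure less_top)
  have mono: "M r \<le> M r'" if "r \<le> r'" for r r'
    unfolding M_def using that bs by (intro emeasure_mono) auto
  define S where "S = {r. 0 \<le> r \<and> M r < T}"
  have L: "L = B \<inter> norm -` S" unfolding L_def M S_def by auto
  have "is_interval S" unfolding is_interval_1 S_def using mono by (auto intro: le_less_trans)
  then have "S \<in> sets borel" by (rule real_interval_borel_measurable)
  then have "norm -` S \<in> sets (borel :: (real^'n) measure)"
    using measurable_sets[OF borel_measurable_norm, of S] by simp
  then show Ls: "L \<in> sets lebesgue" unfolding L using B by auto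
  have cball_eq: "emeasure lebesgue (B \<inter> cball 0 r) = M r" for r
  proof -
    have "sphere (0::real^'n) r \<in> null_sets lebesgue"
      using negligible_sphere negligible_iff_null_sets by blast
    then have "emeasure lebesgue ((B \<inter> ball 0 r) \<union> sphere 0 r) = emeasure lebesgue (B \<inter> ball 0 r)"
      using bs by (intro emeasure_Un_null_set) auto
    moreover have "emeasure lebesgue (B \<inter> cball 0 r) \<le> emeasure lebesgue ((B \<inter> ball 0 r) \<union> sphere 0 r)"
      using bs by (intro emeasure_mono) auto
    moreover have "M r \<le> emeasure lebesgue (B \<inter> cball 0 r)"
      unfolding M_def using bs by (intro emeasure_mono) auto
    ultimately show ?thesis unfolding M_def by order
  qed
  show "emeasure lebesgue L = T"
  proof (cases "T = 0")
    case True
    then show ?thesis by (simp add: L_def)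
  next
    case False
    have S0: "0 \<in> S" unfolding S_def M_def using False by (simp add: zero_less_iff_neq_zero)
    \<comment> \<open>If the radii with volume below \<open>T\<close> are unbounded,
      \<open>L\<close> is all of \<open>B\<close>. Otherwise \<open>L\<close> lies between the
      traces on \<open>B\<close> of the open and the closed ball of radius \<open>Sup S\<close>, and
      continuity of the measure from below and from above identifies their common volume as
      \<open>T\<close>.\<close>
    show ?thesis
    proof (cases "bdd_above S")
      case unb: False
      have inS: "r \<in> S" if r: "r \<ge> 0" for r
      proof -
        obtain r' where "r' \<in> S" "r < r'" using unb unfolding bdd_above_def by (metis not_le)
        then show ?thesis using r mono[of r r'] by (auto simp: S_def)
      qed
      have "L = B" unfolding L using inS by auto
      moreover have "emeasure lebesgue B \<le> T"
      proof -
        have "B = (\<Union>n. B \<inter> ball 0 (real n))" using reals_Archimedean2 by fastforce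
        also have "emeasure lebesgue \<dots> = (SUP n. emeasure lebesgue (B \<inter> ball 0 (real n)))"
          using bs by (intro SUP_emeasure_incseq[symmetric]) (auto simp: incseq_def)
        also have "\<dots> \<le> T"
          using inS by (intro SUP_least) (auto simp: S_def M_def intro: less_imp_le)
        finally show ?thesis .
      qed
      ultimately show ?thesis using T by simp
    next
      case bdd: True
      define R where "R = Sup S"
      have R0: "R \<ge> 0" unfolding R_def using bdd S0 by (intro cSup_upper)
      have below: "r \<in> S" if r: "0 \<le> r" "r < R" for r
      proof -
        obtain r' where "r' \<in> S" "r < r'" using less_cSupD[of S r] r(2) S0 unfolding R_def by blast
        then show ?thesis using r mono[of r r'] by (auto simp: S_def)
      qed
      have above: "T \<le> M r" if "R < r" for r
      proof -
        have "r \<notin> S" using that cSup_upper[OF _ bdd, of r] unfolding R_def by auto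
        then show ?thesis using that R0 by (auto simp: S_def not_less)
      qed
      have "M R \<le> T"
      proof -
        have "B \<inter> ball 0 R = (\<Union>n. B \<inter> ball 0 (R - ?d n))"
        proof safe
          fix x assume "x \<in> B" "x \<in> ball 0 R"
          moreover then obtain n where "?d n < R - norm x"
            using nat_approx_posE[of "R - norm x"] by auto
          ultimately show "x \<in> (\<Union>n. B \<inter> ball 0 (R - ?d n))"
            by (intro UN_I[of n]) auto
        next
          fix x :: "real^'n" and n assume "x \<in> ball 0 (R - ?d n)"
          moreover have "?d n > 0" by simp
          ultimately show "x \<in> ball 0 R" unfolding mem_ball_0 by linarith
        qed
        then have "M R = emeasure lebesgue (\<Union>n. B \<inter> ball 0 (R - ?d n))" by (simp add: M_def)
        also have "\<dots> = (SUP n. emeasure lebesgue (B \<inter> ball 0 (R - ?d n)))"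
        proof (intro SUP_emeasure_incseq[symmetric])
          show "incseq (\<lambda>n. B \<inter> ball 0 (R - ?d n))"
            by (intro incseq_SucI Int_mono subset_refl subset_ball) (simp add: frac_le)
        qed (use bs in auto)
        also have "\<dots> \<le> T"
        proof (intro SUP_least)
          fix n
          show "emeasure lebesgue (B \<inter> ball 0 (R - ?d n)) \<le> T"
          proof (cases "R - ?d n \<ge> 0")
            case True
            have "?d n > 0" by simp
            then have "R - ?d n < R" by linarith
            from below[OF True this] show ?thesis by (simp add: S_def M_def less_imp_le)
          next
            case False
            then have "ball (0::real^'n) (R - ?d n) = {}" by (intro ball_empty) linarith
            then show ?thesis by (simp only: Int_empty_right emeasure_empty zero_le)
          qed
        qed
        finally show ?thesis .
      qed
      moreover have "T \<le> M R"
      proof -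
        have "B \<inter> cball 0 R = (\<Inter>n. B \<inter> ball 0 (R + ?d n))"
        proof safe
          fix x :: "real^'n" and n assume "x \<in> cball 0 R"
          moreover have "?d n > 0" by simp
          ultimately show "x \<in> ball 0 (R + ?d n)" unfolding mem_ball_0 mem_cball_0 by linarith
        next
          fix x assume *: "x \<in> (\<Inter>n. B \<inter> ball 0 (R + ?d n))"
          then show "x \<in> B" by auto
          show "x \<in> cball 0 R"
          proof (rule ccontr)
            assume "x \<notin> cball 0 R"
            then obtain n where "?d n < norm x - R"
              using nat_approx_posE[of "norm x - R"] by auto
            moreover have "x \<in> ball 0 (R + ?d n)" using * by blast
            ultimately show False unfolding mem_ball_0 by linarith
          qed
        qed
        then have "M R = emeasure lebesgue (\<Inter>n. B \<inter> ball 0 (R + ?d n))"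
          using cball_eq[of R] by simp
        also have "\<dots> = (INF n. emeasure lebesgue (B \<inter> ball 0 (R + ?d n)))"
        proof (intro INF_emeasure_decseq[symmetric])
          show "decseq (\<lambda>n. B \<inter> ball 0 (R + ?d n))"
            by (intro decseq_SucI Int_mono subset_refl subset_ball) (simp add: frac_le)
        qed (use bs fin in \<open>auto simp: M_def less_top\<close>)
        also have "\<dots> \<ge> T"
        proof (intro INF_greatest)
          fix n
          have "?d n > 0" by simp
          then show "T \<le> emeasure lebesgue (B \<inter> ball 0 (R + ?d n))"
            using above[of "R + ?d n"] unfolding M_def by linarith
        qed
        finally show ?thesis .
      qed
      moreover have "M R \<le> emeasure lebesgue L"
        unfolding M_def using Ls below by (intro emeasure_mono) (auto simp: L)
      moreover have "emeasure lebesgue L \<le> emeasure lebesgue (B \<inter> cball 0 R)"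
      proof (intro emeasure_mono bs)
        show "L \<subseteq> B \<inter> cball 0 R" unfolding L R_def using cSup_upper[OF _ bdd] by auto
      qed
      ultimately show ?thesis using cball_eq[of R] by order
    qed
  qed
qed

lemma mono_measure_Int_ball:
  fixes B :: "(real^'n) set"
  assumes "B \<in> sets lebesgue"
  shows "mono (\<lambda>r. measure lebesgue (B \<inter> ball 0 r))"
proof (rule monoI)
  fix r r' :: real assume "r \<le> r'"
  moreover have "ball (0::real^'n) r' \<in> lmeasurable" by simp
  then have "B \<inter> ball 0 r' \<in> lmeasurable"
    using assms by (metis fmeasurable_Int_fmeasurable inf_commute)
  ultimately show "measure lebesgue (B \<inter> ball 0 r) \<le> measure lebesgue (B \<inter> ball 0 r')"
    using assms by (intro measure_mono_fmeasurable) auto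
qed

lemma max_rearr_equimeasurable_exists:
  fixes f :: "real^'n \<Rightarrow> ennreal"
  shows "\<exists>v. v \<in> borel_measurable lebesgue \<and>
     equimeasurable lebesgue (v :: real^'n \<Rightarrow> ennreal) (lebesgue_on {0<..}) (max_rearr f)"
proof -
  define m where "m r = measure lebesgue (UNIV \<inter> ball (0::real^'n) r)" for r
  \<comment> \<open>The value \<open>top\<close> keeps \<open>h\<close> antitone on the whole line;
    \<open>max_rearr f\<close> itself is 0 at nonpositive arguments.\<close>
  define h where "h t = (if t > 0 then max_rearr f t else top)" for t
  define v where "v x = h (m (norm x))" for x :: "real^'n"
  have "mono m" unfolding m_def[abs_def] by (rule mono_measure_Int_ball) simp
  then have "m \<in> borel_measurable borel" by (rule borel_measurable_mono)
  then have "(\<lambda>x::real^'n. m (norm x)) \<in> borel_measurable borel" by measurable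
  moreover have "antimono h"
    unfolding h_def antimono_def using max_rearr_antimono[of _ _ f] by auto
  ultimately have "v \<in> borel_measurable borel"
    unfolding v_def[abs_def] by (intro measurable_compose[OF _ borel_measurable_antimono_ennreal])
  then have vm: "v \<in> borel_measurable lebesgue" by (intro measurable_completion) simp
  have lev: "{x::real^'n. ennreal (m (norm x)) < T} \<in> sets lebesgue" "emeasure lebesgue {x::real^'n. ennreal (m (norm x)) < T} = T" for T
    using emeasure_sublevel_volume[of "UNIV :: (real^'n) set" T]
    by (simp_all add: m_def emeasure_lebesgue_borel emeasure_lborel_UNIV)
  have "emeasure lebesgue {x. v x > ennreal s} = emeasure lborel {t \<in> {0<..}. max_rearr f t > ennreal s}" for s
  proof -
    let ?I = "{t \<in> {0<..}. max_rearr f t > ennreal s}"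
    define T where "T = emeasure lborel ?I"
    have Ib: "?I \<in> sets lborel"
      using real_interval_borel_measurable[OF is_interval_max_rearr_superlevel[where f = f and a = "ennreal s"]] by simp
    have low: "v x > ennreal s" if x: "ennreal (m (norm x)) < T" for x
    proof (rule ccontr)
      assume nv: "\<not> v x > ennreal s"
      then have pos: "m (norm x) > 0" by (auto simp: v_def h_def split: if_splits)
      have "?I \<subseteq> {0<..<m (norm x)}"
      proof
        fix t assume t: "t \<in> ?I"
        then show "t \<in> {0<..<m (norm x)}"
          using nv pos max_rearr_antimono[of "m (norm x)" t f] by (cases "m (norm x) \<le> t") (auto simp: v_def h_def)
      qed
      then have "T \<le> emeasure lborel {0<..<m (norm x)}" unfolding T_def by (intro emeasure_mono) auto
      then show False using x pos by simp
    qed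
    have up: "ennreal (m (norm x)) \<le> T" if x: "v x > ennreal s" for x
    proof (cases "m (norm x) > 0")
      case True
      have "{0<..m (norm x)} \<subseteq> ?I"
      proof
        fix t assume "t \<in> {0<..m (norm x)}"
        then show "t \<in> ?I" using x max_rearr_antimono[of t "m (norm x)" f] True by (auto simp: v_def h_def)
      qed
      then have "emeasure lborel {0<..m (norm x)} \<le> T" unfolding T_def using Ib by (intro emeasure_mono)
      then show ?thesis using True by simp
    qed (simp add: ennreal_neg)
    have "emeasure lebesgue {x::real^'n. ennreal (m (norm x)) < T} \<le> emeasure lebesgue {x. v x > ennreal s}"
      by (intro emeasure_mono superlevel_sets_lebesgue[OF vm]) (use low in blast)
    then have "T \<le> emeasure lebesgue {x. v x > ennreal s}" unfolding lev(2) .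
    \<comment> \<open>\<open>up\<close> gives only a weak inequality, whereas \<open>lev\<close>
      concerns strict sublevel sets; a margin \<open>e\<close> bridges the two.\<close>
    moreover have "emeasure lebesgue {x. v x > ennreal s} \<le> T"
    proof (rule ennreal_le_epsilon)
      fix e :: real assume e: "T < top" "0 < e"
      then obtain t where t: "T = ennreal t" "t \<ge> 0" by (cases T) auto
      have "T < ennreal (t + e)" unfolding t(1) using t(2) e(2) by (intro ennreal_lessI) auto
      then have "T < T + ennreal e" using t e(2) by simp
      then have "{x. v x > ennreal s} \<subseteq> {x. ennreal (m (norm x)) < T + ennreal e}"
        using up le_less_trans by blast
      then have "emeasure lebesgue {x. v x > ennreal s} \<le> emeasure lebesgue {x::real^'n. ennreal (m (norm x)) < T + ennreal e}"
        by (rule emeasure_mono[OF _ lev(1)])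
      then show "emeasure lebesgue {x. v x > ennreal s} \<le> T + ennreal e" unfolding lev(2) .
    qed
    ultimately show ?thesis unfolding T_def by (rule antisym[rotated])
  qed
  then have "equimeasurable lebesgue v (lebesgue_on {0<..}) (max_rearr f)"
    unfolding equimeasurable_def emeasure_lebesgue_on_superlevel_max_rearr by simp
  with vm show ?thesis by blast
qed

text \<open>Nonatomicity of Lebesgue measure; the witness is the part of \<open>D\<close> close to
  the origin.\<close>

lemma lebesgue_subset_of_measure:
  fixes D :: "(real^'n) set"
  assumes "D \<in> sets lebesgue" "T \<le> emeasure lebesgue D"
  obtains B where "B \<in> sets lebesgue" "B \<subseteq> D" "emeasure lebesgue B = T"
  using emeasure_sublevel_volume[OF assms] that by blast

text \<open>Transport of a function to another set of the same measure, by composing its rearrangement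
  with the volume of the part of the target inside a centred ball.\<close>

lemma equimeasurable_transport:
  fixes A B :: "(real^'n) set"
  assumes A: "A \<in> sets lebesgue" and B: "B \<in> sets lebesgue"
    and eq: "emeasure lebesgue A = emeasure lebesgue B"
    and g: "g \<in> borel_measurable lebesgue"
  obtains g' where "g' \<in> borel_measurable lebesgue"
    "\<And>s. s > 0 \<Longrightarrow> emeasure lebesgue {x \<in> B. g' x > ennreal s} = emeasure lebesgue {x \<in> A. g x > ennreal s}"
proof -
  let ?gA = "\<lambda>x. g x * indicator A x"
  have gA: "?gA \<in> borel_measurable lebesgue" using g A by measurable
  define m where "m r = measure lebesgue (B \<inter> ball 0 r)" for r
  define g' where "g' x = decr_rearr ?gA (m (norm x))" for x :: "real^'n"
  have "mono m" unfolding m_def[abs_def] using B by (rule mono_measure_Int_ball)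
  then have "m \<in> borel_measurable borel" by (rule borel_measurable_mono)
  then have "(\<lambda>x::real^'n. m (norm x)) \<in> borel_measurable borel" by measurable
  then have "g' \<in> borel_measurable borel" unfolding g'_def
    by (rule measurable_compose) (rule borel_measurable_antimono_ennreal[OF decr_rearr_antimono])
  then have "g' \<in> borel_measurable lebesgue" by (intro measurable_completion) simp
  moreover have "emeasure lebesgue {x \<in> B. g' x > ennreal s} = emeasure lebesgue {x \<in> A. g x > ennreal s}"
    if s: "s > 0" for s
  proof -
    let ?T = "emeasure lebesgue {x. ?gA x > ennreal s}"
    have eqA: "{x. ?gA x > ennreal s} = {x \<in> A. g x > ennreal s}" by (auto simp: indicator_def)
    then have "?T \<le> emeasure lebesgue B" unfolding eq[symmetric] using A by (intro emeasure_mono) auto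
    \<comment> \<open>The rearrangement at \<open>m (norm x)\<close> exceeds \<open>s\<close>
      exactly when \<open>m (norm x)\<close> lies below \<open>?T\<close>, which is the form of set
      treated by \<open>emeasure_sublevel_volume\<close>.\<close>
    moreover have "{x \<in> B. g' x > ennreal s} = {x \<in> B. ennreal (measure lebesgue (B \<inter> ball 0 (norm x))) < ?T}"
      using decr_rearr_le_iff[OF gA s] by (auto simp: g'_def m_def not_le[symmetric])
    ultimately show ?thesis using emeasure_sublevel_volume(2)[OF B] eqA by simp
  qed
  ultimately show ?thesis by (rule that)
qed

text \<open>Greedy choice: the sets taken so far have total measure equal to the sum of the earlier
  \<open>c l\<close>, so even if all of them lie in \<open>U N\<close> the hypothesis leaves room
  for \<open>c N\<close>. Finiteness of \<open>c\<close> permits the subtraction.\<close>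

lemma disjoint_subsets_exist:
  fixes U :: "nat \<Rightarrow> (real^'n) set" and c :: "nat \<Rightarrow> ennreal"
  assumes U: "\<And>i. U i \<in> sets lebesgue" and c: "\<And>i. c i < \<infinity>"
    and le: "\<And>i. i < N \<Longrightarrow> (\<Sum>l\<le>i. c l) \<le> emeasure lebesgue (U i)"
  shows "\<exists>B. (\<forall>i<N. B i \<in> sets lebesgue \<and> B i \<subseteq> U i \<and> emeasure lebesgue (B i) = c i) \<and>
    disjoint_family_on B {..<N}"
  using le
proof (induction N)
  case (Suc N)
  then obtain B where B: "\<And>i. i < N \<Longrightarrow> B i \<in> sets lebesgue \<and> B i \<subseteq> U i \<and> emeasure lebesgue (B i) = c i"
    and disj: "disjoint_family_on B {..<N}"
    by (metis less_SucI)
  define V where "V = (\<Union>i<N. B i)"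
  have V: "V \<in> sets lebesgue" unfolding V_def using B by (intro sets.finite_UN) auto
  have "emeasure lebesgue V = (\<Sum>i<N. emeasure lebesgue (B i))"
    unfolding V_def using B disj by (intro sum_emeasure[symmetric]) auto
  also have "\<dots> = (\<Sum>i<N. c i)" using B by (intro sum.cong) auto
  finally have mV: "emeasure lebesgue V = (\<Sum>i<N. c i)" .
  have "c N + emeasure lebesgue V = (\<Sum>i\<le>N. c i)"
    unfolding mV lessThan_Suc_atMost[symmetric] by (simp add: add.commute)
  also have "\<dots> \<le> emeasure lebesgue (U N)" by (rule Suc.prems) simp
  also have "\<dots> \<le> emeasure lebesgue ((U N - V) \<union> V)"
    using U V by (intro emeasure_mono) auto
  also have "\<dots> \<le> emeasure lebesgue (U N - V) + emeasure lebesgue V"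
    using U V by (intro emeasure_subadditive) auto
  finally have "c N + emeasure lebesgue V \<le> emeasure lebesgue (U N - V) + emeasure lebesgue V" .
  moreover have "emeasure lebesgue V \<noteq> top"
  proof -
    have "(\<Sum>i<n. c i) < \<infinity>" for n
      by (induction n) (use c in auto)
    then show ?thesis by (simp add: mV less_top)
  qed
  ultimately have "c N \<le> emeasure lebesgue (U N - V)"
    by (simp add: add.commute[of _ "emeasure lebesgue V"] ennreal_add_left_cancel_le)
  then obtain B' where B': "B' \<in> sets lebesgue" "B' \<subseteq> U N - V" "emeasure lebesgue B' = c N"
    using lebesgue_subset_of_measure[of "U N - V" "c N"] U V by blast
  have "(\<forall>i<Suc N. (B(N := B')) i \<in> sets lebesgue \<and> (B(N := B')) i \<subseteq> U i \<and> emeasure lebesgue ((B(N := B')) i) = c i)"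
    using B B' by (auto simp: less_Suc_eq)
  moreover have "disjoint_family_on (B(N := B')) {..<Suc N}"
    using disj B'(2) unfolding disjoint_family_on_def V_def by (auto simp: less_Suc_eq) blast+
  ultimately show ?case by blast
qed (simp add: disjoint_family_on_def)

section \<open>Dyadic truncation and transport of level sets\<close>

lemma disjoint_sum_indicator:
  fixes h :: "'i \<Rightarrow> 'a \<Rightarrow> ennreal"
  assumes "disjoint_family_on A I" "finite I" "i \<in> I" "x \<in> A i"
  shows "(\<Sum>l\<in>I. h l x * indicator (A l) x) = h i x"
proof -
  have "x \<notin> A l" if "l \<in> I" "l \<noteq> i" for l
    using assms that unfolding disjoint_family_on_def by blast
  then have "(\<Sum>l\<in>I - {i}. h l x * indicator (A l) x) = 0"
    by (intro sum.neutral) auto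
  moreover have "(\<Sum>l\<in>I. h l x * indicator (A l) x) =
      h i x * indicator (A i) x + (\<Sum>l\<in>I - {i}. h l x * indicator (A l) x)"
    using assms by (intro sum.remove)
  ultimately show ?thesis using assms(4) by simp
qed

lemma emeasure_superlevel_disjoint_sum:
  fixes h :: "'i \<Rightarrow> (real^'n) \<Rightarrow> ennreal"
  assumes disj: "disjoint_family_on A I" and fin: "finite I"
    and A: "\<And>i. i \<in> I \<Longrightarrow> A i \<in> sets lebesgue"
    and h: "\<And>i. i \<in> I \<Longrightarrow> h i \<in> borel_measurable lebesgue"
  shows "emeasure lebesgue {x. (\<Sum>i\<in>I. h i x * indicator (A i) x) > ennreal s}
    = (\<Sum>i\<in>I. emeasure lebesgue {x \<in> A i. h i x > ennreal s})"
proof -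
  let ?S = "{x. (\<Sum>i\<in>I. h i x * indicator (A i) x) > ennreal s}" and ?L = "\<lambda>i. {x \<in> A i. h i x > ennreal s}"
  have "?S = (\<Union>i\<in>I. (?L i))"
  proof (intro set_eqI iffI)
    fix x assume x: "x \<in> ?S"
    then obtain i where i: "i \<in> I" "x \<in> A i"
      by (metis (no_types, lifting) indicator_simps(2) mem_Collect_eq mult_zero_right not_less_zero sum.neutral)
    then show "x \<in> (\<Union>i\<in>I. (?L i))"
      using x disjoint_sum_indicator[OF disj fin i, of h] by auto
  next
    fix x assume "x \<in> (\<Union>i\<in>I. (?L i))"
    then obtain i where "i \<in> I" "x \<in> A i" "h i x > ennreal s" by auto
    then show "x \<in> ?S"
      using disjoint_sum_indicator[OF disj fin, of i x h] by auto
  qed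
  also have "emeasure lebesgue \<dots> = (\<Sum>i\<in>I. emeasure lebesgue (?L i))"
  proof (intro sum_emeasure[symmetric] fin)
    show "disjoint_family_on (\<lambda>i. (?L i)) I"
      using disj by (auto simp: disjoint_family_on_def)
    have "(?L i) = A i \<inter> {x. h i x > ennreal s}" for i by auto
    then show "(\<lambda>i. (?L i)) ` I \<subseteq> sets lebesgue"
      using A superlevel_sets_lebesgue[OF h] by auto
  qed
  finally show ?thesis .
qed

lemma ennreal_less_mult_iff:
  assumes "a > 0"
  shows "ennreal s < ennreal a * y \<longleftrightarrow> ennreal (s / a) < y"
proof (cases "s \<ge> 0")
  case True
  have "ennreal s = ennreal a * ennreal (s / a)"
    using assms True by (simp add: ennreal_mult[symmetric])
  then show ?thesis using assms by (simp add: not_le[symmetric] ennreal_mult_le_mult_iff)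
next
  case False
  then have "ennreal s = 0" "ennreal (s / a) = 0" using assms by (auto simp: ennreal_neg divide_neg_pos less_imp_le)
  then show ?thesis using assms by (simp add: ennreal_zero_less_mult_iff)
qed

text \<open>Truncating in space, from below and from above leaves finitely many dyadic layers, each
  of finite measure, as \<open>disjoint_subsets_exist\<close> requires.\<close>

definition dyadic_cut :: "nat \<Rightarrow> (real^'n \<Rightarrow> ennreal) \<Rightarrow> real^'n \<Rightarrow> ennreal" where
  "dyadic_cut N F x =
     min (F x) (ennreal (2 ^ N)) * indicator {x. norm x < real N \<and> F x > ennreal (1 / 2 ^ N)} x"

lemma dyadic_cut_measurable:
  fixes F :: "real^'n \<Rightarrow> ennreal"
  assumes [measurable]: "F \<in> borel_measurable lebesgue"
  shows "dyadic_cut N F \<in> borel_measurable lebesgue"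
proof -
  have "{x::real^'n. norm x < real N \<and> F x > ennreal (1 / 2 ^ N)} = ball 0 (real N) \<inter> {x. F x > ennreal (1 / 2 ^ N)}"
    by auto
  then have [measurable]: "{x. norm x < real N \<and> F x > ennreal (1 / 2 ^ N)} \<in> sets lebesgue"
    using superlevel_sets_lebesgue[OF assms] by (auto intro!: sets.Int)
  show ?thesis unfolding dyadic_cut_def[abs_def] by measurable
qed

lemma incseq_dyadic_cut: "incseq (\<lambda>N. dyadic_cut N F x)"
proof (rule incseq_SucI)
  fix N
  have a: "ennreal (1 / 2 ^ Suc N) \<le> ennreal (1 / 2 ^ N)" "ennreal (2 ^ N) \<le> ennreal (2 ^ Suc N)"
    by (auto intro!: ennreal_leI simp: frac_le)
  show "dyadic_cut N F x \<le> dyadic_cut (Suc N) F x"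
  proof (cases "norm x < real N \<and> F x > ennreal (1 / 2 ^ N)")
    case True
    then have "norm x < real (Suc N) \<and> F x > ennreal (1 / 2 ^ Suc N)"
      using le_less_trans[OF a(1)] by simp
    then have eq: "dyadic_cut (Suc N) F x = min (F x) (ennreal (2 ^ Suc N))"
      by (simp only: dyadic_cut_def) simp
    have "dyadic_cut N F x = min (F x) (ennreal (2 ^ N))" using True by (simp add: dyadic_cut_def)
    also have "\<dots> \<le> min (F x) (ennreal (2 ^ Suc N))" by (rule min.mono[OF order_refl a(2)])
    finally show ?thesis unfolding eq .
  qed (simp add: dyadic_cut_def)
qed

lemma SUP_dyadic_cut: "(SUP N. dyadic_cut N F x) = F x"
proof (rule antisym)
  show "(SUP N. dyadic_cut N F x) \<le> F x"
    by (intro SUP_least) (auto simp: dyadic_cut_def indicator_def)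
  show "F x \<le> (SUP N. dyadic_cut N F x)"
  proof (rule ccontr)
    assume "\<not> F x \<le> (SUP N. dyadic_cut N F x)"
    then obtain y where y: "(SUP N. dyadic_cut N F x) < y" "y < F x" using dense by (meson not_le)
    then obtain c where c: "y = ennreal c" "c \<ge> 0" by (cases y) auto
    have "c > 0" using y(1) c by (cases "c = 0") auto
    then obtain n1 where n1: "1 / real (Suc n1) < c" using nat_approx_posE by blast
    obtain n2 where n2: "real n2 > max c (norm x)" using reals_Archimedean2 by blast
    define N where "N = max (Suc n1) n2"
    have two: "real N < 2 ^ N" by (rule of_nat_less_two_power)
    have "real N > c" "real N > norm x" using n2 unfolding N_def by linarith+
    have "1 / 2 ^ N \<le> 1 / real (Suc n1)"
    proof (intro divide_left_mono)
      have "real (Suc n1) \<le> real N" by (simp add: N_def)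
      then show "real (Suc n1) \<le> 2 ^ N" using two by linarith
    qed auto
    then have "1 / 2 ^ N < c" using n1 by linarith
    then have "ennreal (1 / 2 ^ N) \<le> y" unfolding c by (intro ennreal_leI) simp
    then have "F x > ennreal (1 / 2 ^ N)" using y(2) by order
    then have "dyadic_cut N F x = min (F x) (ennreal (2 ^ N))"
      using \<open>real N > norm x\<close> by (simp add: dyadic_cut_def)
    also have "y \<le> \<dots>"
    proof (rule min.boundedI)
      show "y \<le> ennreal (2 ^ N)" unfolding c using \<open>real N > c\<close> two by (intro ennreal_leI) linarith
    qed (use y(2) in auto)
    finally have "y \<le> (SUP N. dyadic_cut N F x)" by (meson SUP_upper UNIV_I order_trans)
    then show False using y(1) by order
  qed
qed

text \<open>The product of \<open>F\<close> and \<open>g\<close>, up to a dyadic discretisation of \<open>F\<close>, is equimeasurable with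
  a function below \<open>v g'\<close>: the pieces of \<open>g\<close> on the level sets of \<open>F\<close> are transported to
  disjoint subsets of the superlevel sets of \<open>v\<close>.\<close>

lemma dyadic_cut_transport:
  fixes F v g :: "real^'n \<Rightarrow> ennreal"
  assumes F: "F \<in> borel_measurable lebesgue" and v: "v \<in> borel_measurable lebesgue"
    and g: "g \<in> borel_measurable lebesgue"
    and le: "\<And>s. s > 0 \<Longrightarrow>
      emeasure lebesgue {x. F x > ennreal s} \<le> emeasure lebesgue {x. v x > ennreal s}"
  obtains g' G W A where
    "g' \<in> borel_measurable lebesgue" "G \<in> borel_measurable lebesgue" "W \<in> borel_measurable lebesgue"
    "A \<in> sets lebesgue"
    "\<And>x. dyadic_cut N F x * g x \<le> 2 * G x" "equimeasurable lebesgue G lebesgue W"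
    "\<And>x. W x \<le> v x * g' x"
    "equimeasurable lebesgue g' lebesgue (\<lambda>x. g x * indicator A x)"
proof -
  let ?p = "\<lambda>B f s. emeasure lebesgue {x \<in> B. f x > ennreal s}"
  \<comment> \<open>The levels are halved successively from \<open>2 ^ N\<close> down to
    \<open>1 / 2 ^ N\<close>, which makes \<open>2 * N + 1\<close> of them.\<close>
  define a :: "nat \<Rightarrow> real" where "a i = 2 ^ N / 2 ^ i" for i
  define K where "K = Suc (2 * N)"
  have a: "a i > 0" and a_Suc: "a i = 2 * a (Suc i)" for i by (simp_all add: a_def)
  have a_last: "a (2 * N) = 1 / 2 ^ N" by (simp add: a_def mult_2 power_add)
  have a_dec: "decseq a" unfolding a_def by (intro decseq_SucI) (simp add: frac_le)
  define L where "L i = {x. norm x < real N \<and> F x > ennreal (a i)}" for i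
  have Lb: "L i = ball 0 (real N) \<inter> {x. F x > ennreal (a i)}" for i by (auto simp: L_def)
  have Ls: "L i \<in> sets lebesgue" for i
    unfolding Lb using superlevel_sets_lebesgue[OF F] by (intro sets.Int) auto
  have Linc: "incseq L"
  proof (rule incseq_SucI)
    fix i
    have "ennreal (a (Suc i)) \<le> ennreal (a i)" using a_dec by (intro ennreal_leI) (simp add: decseq_Suc_iff)
    then show "L i \<subseteq> L (Suc i)" by (auto simp: L_def)
  qed
  \<comment> \<open>\<open>A i\<close> is the part of the ball where \<open>F\<close> lies between
    \<open>a i\<close> and \<open>2 * a i\<close>; only in \<open>A 0\<close> is \<open>F\<close>
    not bounded above.\<close>
  define A where "A = disjointed L"
  have As: "A i \<in> sets lebesgue" for i
    unfolding A_def disjointed_def using Ls by auto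
  have AL: "A i \<subseteq> L i" for i unfolding A_def by (rule disjointed_subset)
  have Adisj: "disjoint_family A" unfolding A_def by (rule disjoint_family_disjointed)
  have Afin: "emeasure lebesgue (A i) < \<infinity>" for i
  proof -
    have "emeasure lebesgue (A i) \<le> emeasure lebesgue (ball (0::real^'n) (real N))"
      using AL[of i] by (intro emeasure_mono) (auto simp: Lb)
    also have "\<dots> < \<infinity>"
      using emeasure_lborel_ball_finite[of "0::real^'n" "real N"] by (simp add: emeasure_lebesgue_borel)
    finally show ?thesis .
  qed
  define U where "U i = {x. v x > ennreal (a i)}" for i
  have Us: "U i \<in> sets lebesgue" for i unfolding U_def by (rule superlevel_sets_lebesgue[OF v])
  \<comment> \<open>The layers up to \<open>i\<close> lie in \<open>L i\<close>, so their total
    measure is controlled by the distribution of \<open>F\<close> at height \<open>a i\<close>,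
    hence by that of \<open>v\<close>. This is the room required for disjoint copies of
    them.\<close>
  have sums: "(\<Sum>l\<le>i. emeasure lebesgue (A l)) \<le> emeasure lebesgue (U i)" for i
  proof -
    have "(\<Sum>l\<le>i. emeasure lebesgue (A l)) = emeasure lebesgue (\<Union>l\<le>i. A l)"
      using As Adisj by (intro sum_emeasure) (auto simp: disjoint_family_on_def)
    also have "\<dots> \<le> emeasure lebesgue {x. F x > ennreal (a i)}"
    proof (intro emeasure_mono superlevel_sets_lebesgue F)
      have "A l \<subseteq> L i" if "l \<le> i" for l using AL[of l] Linc that by (auto simp: incseq_def)
      then show "(\<Union>l\<le>i. A l) \<subseteq> {x. F x > ennreal (a i)}" by (auto simp: L_def)
    qed
    also have "\<dots> \<le> emeasure lebesgue (U i)" unfolding U_def by (rule le[OF a])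
    finally show ?thesis .
  qed
  obtain B where B: "\<And>i. i < K \<Longrightarrow> B i \<in> sets lebesgue"
    "\<And>i. i < K \<Longrightarrow> B i \<subseteq> U i" "\<And>i. i < K \<Longrightarrow> emeasure lebesgue (A i) = emeasure lebesgue (B i)"
    and Bdisj: "disjoint_family_on B {..<K}"
    using disjoint_subsets_exist[of U "\<lambda>i. emeasure lebesgue (A i)" K, OF Us Afin sums] by metis
  have "\<exists>h. h \<in> borel_measurable lebesgue \<and> (\<forall>s>0. ?p (B i) h s
      = ?p (A i) g s)" if i: "i < K" for i
    by (rule equimeasurable_transport[OF As[of i] B(1)[OF i] B(3)[OF i] g]) blast
  then have "\<forall>i. \<exists>h. i < K \<longrightarrow> h \<in> borel_measurable lebesgue \<and> (\<forall>s>0. ?p (B i) h s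
      = ?p (A i) g s)" by blast
  then obtain h where "\<forall>i. i < K \<longrightarrow> h i \<in> borel_measurable lebesgue \<and> (\<forall>s>0. ?p (B i) (h i) s
      = ?p (A i) g s)"
    by (rule choice[THEN exE])
  then have h: "\<And>i. i < K \<Longrightarrow> h i \<in> borel_measurable lebesgue"
     "\<And>i s. i < K \<Longrightarrow> s > 0 \<Longrightarrow>
      ?p (B i) (h i) s = ?p (A i) g s"
    by simp_all
  have disjA: "disjoint_family_on A {..<K}" using Adisj by (auto simp: disjoint_family_on_def)
  define G where "G x = (\<Sum>i<K. (ennreal (a i) * g x) * indicator (A i) x)" for x
  define W where "W x = (\<Sum>i<K. (ennreal (a i) * h i x) * indicator (B i) x)" for x
  define g' where "g' x = (\<Sum>i<K. h i x * indicator (B i) x)" for x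
  have gs: "(\<Sum>i<K. g x * indicator (A i) x) = g x * indicator (\<Union>i<K. A i) x" for x
    using disjA by (simp add: indicator_UN_disjoint sum_distrib_left)
  show ?thesis
  proof (rule that[of g' G W "\<Union>i<K. A i"])
    show "g' \<in> borel_measurable lebesgue" "W \<in> borel_measurable lebesgue"
      unfolding g'_def W_def using h(1) B(1)
      by (intro borel_measurable_sum borel_measurable_times_ennreal borel_measurable_indicator borel_measurable_const; simp)+
    show "G \<in> borel_measurable lebesgue"
      unfolding G_def using g As
      by (intro borel_measurable_sum borel_measurable_times_ennreal borel_measurable_indicator borel_measurable_const; simp)+
    show "(\<Union>i<K. A i) \<in> sets lebesgue" using As by auto
    show "dyadic_cut N F x * g x \<le> 2 * G x" for x
    proof (cases "x \<in> L (2 * N)")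
      case True
      define i where "i = (LEAST i. x \<in> L i)"
      have i: "x \<in> L i" unfolding i_def using True by (rule LeastI)
      have "i \<le> 2 * N" unfolding i_def using True by (rule Least_le)
      then have iK: "i < K" by (simp add: K_def)
      have nl: "x \<notin> L l" if "l < i" for l using not_less_Least[of l "\<lambda>i. x \<in> L i"] that unfolding i_def by auto
      then have "x \<in> A i" unfolding A_def disjointed_def using i by auto
      then have G: "G x = ennreal (a i) * g x"
        unfolding G_def using iK by (intro disjoint_sum_indicator[OF disjA]) auto
      \<comment> \<open>Within a layer \<open>F\<close> is at most twice the lower level, the source
        of the factor 2. In the top layer the cap \<open>2 ^ N\<close> takes the place of the upper
        level.\<close>
      have "dyadic_cut N F x \<le> 2 * ennreal (a i)"
      proof (cases i)
        case 0
        have "dyadic_cut N F x \<le> ennreal (a i)"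
          by (auto simp: dyadic_cut_def indicator_def a_def 0)
        also have "\<dots> \<le> 2 * ennreal (a i)" by (simp add: mult_2)
        finally show ?thesis .
      next
        case (Suc l)
        then have "x \<notin> L l" using nl by simp
        moreover have "norm x < real N" using i by (simp add: L_def)
        ultimately have "F x \<le> ennreal (a l)" by (simp add: L_def)
        also have "\<dots> = 2 * ennreal (a i)"
          using a[of i] unfolding a_Suc[of l] Suc by (subst ennreal_mult) auto
        finally have "F x \<le> 2 * ennreal (a i)" .
        moreover have "dyadic_cut N F x \<le> F x" by (auto simp: dyadic_cut_def indicator_def)
        ultimately show ?thesis by order
      qed
      then show ?thesis unfolding G mult.assoc[symmetric] by (intro mult_right_mono) auto
    next
      case False
      then show ?thesis by (simp add: L_def dyadic_cut_def a_last)
    qed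
    show "W x \<le> v x * g' x" for x
    proof (cases "x \<in> (\<Union>i<K. B i)")
      case True
      then obtain i where i: "i \<in> {..<K}" "x \<in> B i" by auto
      have "W x = ennreal (a i) * h i x"
        unfolding W_def by (rule disjoint_sum_indicator[OF Bdisj _ i]) simp
      moreover have "g' x = h i x"
        unfolding g'_def by (rule disjoint_sum_indicator[OF Bdisj _ i]) simp
      moreover have "ennreal (a i) \<le> v x" using B(2)[of i] i by (auto simp: U_def intro: less_imp_le)
      ultimately show ?thesis by (auto intro: mult_right_mono)
    next
      case False
      then have "W x = 0" unfolding W_def by (intro sum.neutral) auto
      then show ?thesis by simp
    qed
    show "equimeasurable lebesgue G lebesgue W"
      unfolding equimeasurable_def
    proof (intro allI impI)
      fix s :: real assume s: "s > 0"
      have "emeasure lebesgue {x. G x > ennreal s} = (\<Sum>i<K. emeasure lebesgue {x \<in> A i. ennreal (a i) * g x > ennreal s})"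
        unfolding G_def using disjA As g by (intro emeasure_superlevel_disjoint_sum) auto
      also have "\<dots> = (\<Sum>i<K. emeasure lebesgue {x \<in> B i. ennreal (a i) * h i x > ennreal s})"
        unfolding ennreal_less_mult_iff[OF a] using s a h(2) by (intro sum.cong) auto
      also have "\<dots> = emeasure lebesgue {x. W x > ennreal s}"
        unfolding W_def using Bdisj B h by (intro emeasure_superlevel_disjoint_sum[symmetric]) auto
      finally show "emeasure lebesgue {x \<in> space lebesgue. G x > ennreal s}
        = emeasure lebesgue {x \<in> space lebesgue. W x > ennreal s}" by simp
    qed
    show "equimeasurable lebesgue g' lebesgue (\<lambda>x. g x * indicator (\<Union>i<K. A i) x)"
      unfolding equimeasurable_def
    proof (intro allI impI)
      fix s :: real assume s: "s > 0"
      have "emeasure lebesgue {x. g' x > ennreal s} = (\<Sum>i<K. ?p (B i) (h i) s)"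
        unfolding g'_def using Bdisj B h by (intro emeasure_superlevel_disjoint_sum) auto
      also have "\<dots> = (\<Sum>i<K. ?p (A i) g s)"
        using s h(2) by (intro sum.cong) auto
      also have "\<dots> = emeasure lebesgue {x. g x * indicator (\<Union>i<K. A i) x > ennreal s}"
        unfolding gs[symmetric] using disjA As g by (intro emeasure_superlevel_disjoint_sum[symmetric]) auto
      finally show "emeasure lebesgue {x \<in> space lebesgue. g' x > ennreal s}
        = emeasure lebesgue {x \<in> space lebesgue. g x * indicator (\<Union>i<K. A i) x > ennreal s}" by simp
    qed
  qed
qed

section \<open>Norms controlled by distribution functions\<close>

context banach_function_norm
begin

lemma norm_two_mult: "f \<in> borel_measurable lebesgue \<Longrightarrow> \<rho> (\<lambda>x. 2 * f x) = 2 * \<rho> f"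
  using homogeneous[of f 2] by simp

lemma norm_mono:
  "f \<in> borel_measurable lebesgue \<Longrightarrow> g \<in> borel_measurable lebesgue \<Longrightarrow>
    (\<And>x. g x \<le> f x) \<Longrightarrow> \<rho> g \<le> \<rho> f"
  by (rule lattice) auto

text \<open>The truncations increase to \<open>F\<close>, so the Fatou property passes the bound to
  the limit.\<close>

lemma norm_mult_le_of_dyadic_cut:
  assumes F: "F \<in> borel_measurable lebesgue" and g: "g \<in> borel_measurable lebesgue"
    and le: "\<And>N. \<rho> (\<lambda>x. dyadic_cut N F x * g x) \<le> K"
  shows "\<rho> (\<lambda>x. F x * g x) \<le> K"
proof -
  have m: "(\<lambda>x. dyadic_cut N F x * g x) \<in> borel_measurable lebesgue" for N
    using dyadic_cut_measurable[OF F] g by measurable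
  have inc: "incseq (\<lambda>N. dyadic_cut N F x * g x)" for x
    using incseq_dyadic_cut[of F x] by (auto simp: incseq_def intro: mult_right_mono)
  have "(\<lambda>N. dyadic_cut N F x * g x) \<longlonglongrightarrow> F x * g x" for x
    using LIMSEQ_SUP[OF inc[of x]] by (simp add: SUP_mult_right_ennreal[symmetric] SUP_dyadic_cut)
  then have "(\<lambda>N. \<rho> (\<lambda>x. dyadic_cut N F x * g x)) \<longlonglongrightarrow> \<rho> (\<lambda>x. F x * g x)"
    using fatou[of "\<lambda>N x. dyadic_cut N F x * g x" "\<lambda>x. F x * g x"] m F g inc by auto
  then show ?thesis using le by (intro LIMSEQ_le_const2) auto
qed

end

context ri_banach_function_norm
begin

text \<open>The bound is required for all rearrangements \<open>g'\<close> of restrictions of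
  \<open>g\<close>, because the transported function varies with the truncation. Taking
  \<open>g = 1\<close> yields plain norms, and test functions yield multiplier norms.\<close>

lemma norm_mult_le_of_transport:
  assumes F: "F \<in> borel_measurable lebesgue" and v: "v \<in> borel_measurable lebesgue"
    and g: "g \<in> borel_measurable lebesgue"
    and le: "\<And>s. s > 0 \<Longrightarrow>
      emeasure lebesgue {x. F x > ennreal s} \<le> emeasure lebesgue {x. v x > ennreal s}"
    and bound: "\<And>g' A. g' \<in> borel_measurable lebesgue \<Longrightarrow> A \<in> sets lebesgue \<Longrightarrow>
      equimeasurable lebesgue g' lebesgue (\<lambda>x. g x * indicator A x) \<Longrightarrow> \<rho> (\<lambda>x. v x * g' x) \<le> K"
  shows "\<rho> (\<lambda>x. F x * g x) \<le> 2 * K"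
proof (rule norm_mult_le_of_dyadic_cut[OF F g])
  fix N
  obtain g' G W A where *:
    "g' \<in> borel_measurable lebesgue" "G \<in> borel_measurable lebesgue" "W \<in> borel_measurable lebesgue"
    "A \<in> sets lebesgue"
    "\<And>x. dyadic_cut N F x * g x \<le> 2 * G x" "equimeasurable lebesgue G lebesgue W"
    "\<And>x. W x \<le> v x * g' x"
    "equimeasurable lebesgue g' lebesgue (\<lambda>x. g x * indicator A x)"
    using dyadic_cut_transport[OF F v g le, where N = N] by blast
  have "\<rho> (\<lambda>x. dyadic_cut N F x * g x) \<le> \<rho> (\<lambda>x. 2 * G x)"
    using dyadic_cut_measurable[OF F, of N] g *(2,5) by (intro norm_mono) auto
  also have "\<dots> = 2 * \<rho> G" using *(2) by (rule norm_two_mult)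
  also have "\<rho> G = \<rho> W" using *(2,3,6) by (rule rearrangement_invariant)
  also have "\<rho> W \<le> \<rho> (\<lambda>x. v x * g' x)" using *(1,3,7) v by (intro norm_mono) auto
  also have "\<dots> \<le> K" using *(1,4,8) by (rule bound)
  finally show "\<rho> (\<lambda>x. dyadic_cut N F x * g x) \<le> 2 * K"
    by (simp add: mult_left_mono)
qed

text \<open>Transport with \<open>g = 1\<close>: a rearrangement of an indicator is at most 1 almost
  everywhere, so multiplying \<open>v\<close> by it cannot increase the norm.\<close>

lemma norm_le_of_distribution_le:
  assumes F: "F \<in> borel_measurable lebesgue" and v: "v \<in> borel_measurable lebesgue"
    and le: "\<And>s. s > 0 \<Longrightarrow>
      emeasure lebesgue {x. F x > ennreal s} \<le> emeasure lebesgue {x. v x > ennreal s}"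
  shows "\<rho> F \<le> 2 * \<rho> v"
proof -
  have "\<rho> (\<lambda>x. F x * 1) \<le> 2 * \<rho> v"
  proof (rule norm_mult_le_of_transport[OF F v _ le])
    fix g' :: "real^'a \<Rightarrow> ennreal" and A assume g': "g' \<in> borel_measurable lebesgue" and A: "A \<in> sets lebesgue"
      and eq: "equimeasurable lebesgue g' lebesgue (\<lambda>x. 1 * indicator A x)"
    have "{x. 1 * indicator A x > ennreal 1} = {}" by (auto simp: indicator_def)
    then have "emeasure lebesgue {x. g' x > 1} = 0"
      using eq[unfolded equimeasurable_def, rule_format, of 1] by simp
    then have "{x. g' x > 1} \<in> null_sets lebesgue"
      using superlevel_sets_lebesgue[OF g'] by (simp add: null_sets_def)
    then have "AE x in lebesgue. g' x \<le> 1"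
      by (rule AE_I'[where P = "\<lambda>x. g' x \<le> 1"]) (auto simp: not_le)
    then have "AE x in lebesgue. v x * g' x \<le> v x"
      by eventually_elim (metis mult.right_neutral mult_left_mono zero_le)
    then show "\<rho> (\<lambda>x. v x * g' x) \<le> \<rho> v" using v g' by (intro lattice) auto
  qed auto
  then show ?thesis by simp
qed

end

section \<open>Powers and multiplier norms\<close>

lemma ennpowr_top [simp]: "ennpowr top a = top"
  by (simp add: ennpowr_def)

lemma ennpowr_ennreal: "x \<ge> 0 \<Longrightarrow> ennpowr (ennreal x) a = ennreal (x powr a)"
  by (simp add: ennpowr_def)

lemma ennpowr_0 [simp]: "ennpowr 0 a = 0"
  by (simp add: ennpowr_def)

lemma ennpowr_mono:
  assumes "x \<le> y" "a \<ge> 0"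
  shows "ennpowr x a \<le> ennpowr y a"
proof (cases y)
  case (real r)
  then obtain q where q: "x = ennreal q" "0 \<le> q" using assms(1) by (cases x) (auto simp: top_unique)
  then have "q \<le> r" using assms(1) real by simp
  then show ?thesis using q real assms(2) by (simp add: ennpowr_ennreal ennreal_leI powr_mono2)
qed simp

lemma ennpowr_eq_top_iff [simp]: "ennpowr x a = top \<longleftrightarrow> x = top"
  by (simp add: ennpowr_def)

lemma ennpowr_eq_0_iff: "ennpowr x a = 0 \<longleftrightarrow> x = 0"
proof (cases x)
  case (real r)
  then show ?thesis using powr_gt_zero[of r a] by (cases "r = 0") (auto simp: ennpowr_ennreal)
qed simp

lemma less_ennpowr_iff:
  assumes "s > 0" "a > 0"
  shows "ennreal s < ennpowr x a \<longleftrightarrow> ennreal (s powr (1 / a)) < x"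
proof (cases x)
  case (real r)
  have "s < r powr a \<longleftrightarrow> s powr (1 / a) < r"
  proof
    assume "s < r powr a"
    then have "s powr (1 / a) < (r powr a) powr (1 / a)" using assms by (intro powr_less_mono2) auto
    then show "s powr (1 / a) < r" using assms real by (simp add: powr_powr)
  next
    assume "s powr (1 / a) < r"
    then have "(s powr (1 / a)) powr a < r powr a" using assms by (intro powr_less_mono2) auto
    then show "s < r powr a" using assms by (simp add: powr_powr)
  qed
  then show ?thesis using real assms by (simp add: ennpowr_ennreal ennreal_less_iff)
qed (use assms in simp)

lemma ennpowr_measurable [measurable]:
  assumes [measurable]: "f \<in> borel_measurable M"
  shows "(\<lambda>x. ennpowr (f x) a) \<in> borel_measurable M"
  unfolding ennpowr_def by measurable

lemma ennpowr_ennpowr: "ennpowr (ennpowr x a) b = ennpowr x (a * b)"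
  by (cases x) (auto simp: ennpowr_ennreal powr_powr)

lemma ennpowr_1 [simp]: "ennpowr x 1 = x"
  by (cases x) (auto simp: ennpowr_ennreal)

lemma ennpowr_cmult:
  assumes "c > 0"
  shows "ennpowr (ennreal c * x) a = ennreal (c powr a) * ennpowr x a"
proof (cases x)
  case (real r)
  then show ?thesis using assms by (simp add: ennreal_mult[symmetric] ennpowr_ennreal powr_mult)
qed (use assms in \<open>simp add: ennreal_mult_top\<close>)

lemma ennpowr_indicator: "ennpowr (indicator A x) a = indicator A x"
  by (cases "x \<in> A") (simp_all add: ennpowr_def)

lemma equimeasurable_ennpowr:
  assumes "equimeasurable M f N g" "a > 0"
  shows "equimeasurable M (\<lambda>x. ennpowr (f x) a) N (\<lambda>x. ennpowr (g x) a)"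
  using assms by (auto simp: equimeasurable_def less_ennpowr_iff)

context banach_function_norm
begin

text \<open>Local integrability bounds the integral over every ball, and countably many balls cover
  the space.\<close>

lemma AE_finite_of_norm_finite:
  assumes f: "f \<in> borel_measurable lebesgue" and fin: "\<rho> f < \<infinity>"
  shows "AE x in lebesgue. f x < \<infinity>"
proof -
  have "AE x in lebesgue. f x * indicator (ball 0 (real n)) x \<noteq> \<infinity>" for n
  proof (rule nn_integral_PInf_AE)
    have b: "ball (0::real^'a) (real n) \<in> sets lebesgue" by simp
    show "(\<lambda>x. f x * indicator (ball 0 (real n)) x) \<in> borel_measurable lebesgue" using f b by measurable
    have "emeasure lebesgue (ball (0::real^'a) (real n)) < \<infinity>"
      using emeasure_lborel_ball_finite[of "0::real^'a" "real n"] by (simp add: emeasure_lebesgue_borel)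
    then obtain C where "(\<integral>\<^sup>+x\<in>ball 0 (real n). f x \<partial>lebesgue) \<le> ennreal C * \<rho> f"
      using local_integrability[OF b] f by auto
    also have "\<dots> < \<infinity>" using fin by (simp add: ennreal_mult_less_top)
    finally show "(\<integral>\<^sup>+x\<in>ball 0 (real n). f x \<partial>lebesgue) \<noteq> \<infinity>" by auto
  qed
  then have "AE x in lebesgue. \<forall>n. f x * indicator (ball 0 (real n)) x \<noteq> \<infinity>"
    unfolding AE_all_countable by blast
  then show ?thesis
  proof eventually_elim
    fix x assume *: "\<forall>n. f x * indicator (ball 0 (real n)) x \<noteq> \<infinity>"
    obtain n where "norm x < real n" using reals_Archimedean2 by blast
    with *[rule_format, of n] show "f x < \<infinity>" by (simp add: less_top[symmetric])
  qed
qed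

lemma norm_eq_0_of_AE: "f \<in> borel_measurable lebesgue \<Longrightarrow> (AE x in lebesgue. f x = 0) \<Longrightarrow> \<rho> f = 0"
  by (simp add: zero_iff)

lemma power_norm_cmult:
  assumes "f \<in> borel_measurable lebesgue" "c > 0" "p > 0"
  shows "power_norm \<rho> p (\<lambda>x. ennreal c * f x) = ennreal c * power_norm \<rho> p f"
proof -
  have "\<rho> (\<lambda>x. ennreal (c powr p) * ennpowr (f x) p) = ennreal (c powr p) * \<rho> (\<lambda>x. ennpowr (f x) p)"
    using assms(1) by (intro homogeneous) auto
  then show ?thesis
    using assms by (simp add: power_norm_def ennpowr_cmult powr_powr)
qed

lemma power_norm_mono:
  assumes "f \<in> borel_measurable lebesgue" "g \<in> borel_measurable lebesgue" "\<And>x. g x \<le> f x" "p > 0"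
  shows "power_norm \<rho> p g \<le> power_norm \<rho> p f"
  unfolding power_norm_def using assms by (intro ennpowr_mono norm_mono) auto

end

lemma (in ri_banach_function_norm) power_norm_equimeasurable:
  assumes "f \<in> borel_measurable lebesgue" "g \<in> borel_measurable lebesgue"
    "equimeasurable lebesgue f lebesgue g" "p > 0"
  shows "power_norm \<rho> p f = power_norm \<rho> p g"
proof -
  have "\<rho> (\<lambda>x. ennpowr (f x) p) = \<rho> (\<lambda>x. ennpowr (g x) p)"
    using assms by (intro rearrangement_invariant equimeasurable_ennpowr) auto
  then show ?thesis by (simp add: power_norm_def)
qed

section \<open>Multiplier norms\<close>

lemma multiplier_norm_upper:
  assumes "g \<in> borel_measurable lebesgue" "Y g \<le> 1"
  shows "X (\<lambda>x. f x * g x) \<le> multiplier_norm Y X f"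
  unfolding multiplier_norm_def using assms by (intro SUP_upper) auto

lemma multiplier_norm_cmult_le:
  assumes "banach_function_norm X" "f \<in> borel_measurable lebesgue" "c \<ge> 0"
  shows "multiplier_norm Y X (\<lambda>x. ennreal c * f x) \<le> ennreal c * multiplier_norm Y X f"
  unfolding multiplier_norm_def[of Y X "\<lambda>x. ennreal c * f x"]
proof (intro SUP_least)
  interpret X: banach_function_norm X by fact
  fix g assume g: "g \<in> {g \<in> borel_measurable lebesgue. Y g \<le> 1}"
  then have "X (\<lambda>x. ennreal c * (f x * g x)) = ennreal c * X (\<lambda>x. f x * g x)"
    using assms by (intro X.homogeneous) auto
  also have "\<dots> \<le> ennreal c * multiplier_norm Y X f"
    using g by (intro mult_left_mono multiplier_norm_upper) auto
  finally show "X (\<lambda>x. ennreal c * f x * g x) \<le> ennreal c * multiplier_norm Y X f"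
    by (simp add: mult.assoc)
qed

text \<open>Restricting to \<open>A\<close> and rearranging do not increase
  \<open>power_norm Y p\<close>, so the transported test function is again admissible.\<close>

lemma multiplier_norm_le_of_distribution_le:
  fixes X Y :: "(real^'n \<Rightarrow> ennreal) \<Rightarrow> ennreal"
  assumes "ri_banach_function_norm X" "ri_banach_function_norm Y" and p: "p > 0"
    and F: "F \<in> borel_measurable lebesgue" and v: "v \<in> borel_measurable lebesgue"
    and le: "\<And>s. s > 0 \<Longrightarrow>
      emeasure lebesgue {x. F x > ennreal s} \<le> emeasure lebesgue {x. v x > ennreal s}"
  shows "multiplier_norm (power_norm Y p) X F \<le> 2 * multiplier_norm (power_norm Y p) X v"
  unfolding multiplier_norm_def[of "power_norm Y p" X F]
proof (intro SUP_least)
  interpret X: ri_banach_function_norm X by fact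
  interpret Y: ri_banach_function_norm Y by fact
  fix g assume "g \<in> {g \<in> borel_measurable lebesgue. power_norm Y p g \<le> 1}"
  then have g: "g \<in> borel_measurable lebesgue" "power_norm Y p g \<le> 1" by auto
  show "X (\<lambda>x. F x * g x) \<le> 2 * multiplier_norm (power_norm Y p) X v"
  proof (rule X.norm_mult_le_of_transport[OF F v g(1) le])
    fix g' :: "real^'n \<Rightarrow> ennreal" and A :: "(real^'n) set"
    assume g': "g' \<in> borel_measurable lebesgue" and A: "A \<in> sets lebesgue"
      and eq: "equimeasurable lebesgue g' lebesgue (\<lambda>x. g x * indicator A x)"
    have gA: "(\<lambda>x. g x * indicator A x) \<in> borel_measurable lebesgue" using g(1) A by measurable
    have "power_norm Y p g' = power_norm Y p (\<lambda>x. g x * indicator A x)"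
      by (rule Y.power_norm_equimeasurable[OF g' gA eq p])
    also have "\<dots> \<le> power_norm Y p g"
      using g(1) gA p by (intro Y.power_norm_mono) (auto simp: indicator_def)
    finally show "X (\<lambda>x. v x * g' x) \<le> multiplier_norm (power_norm Y p) X v"
      using g' g(2) by (intro multiplier_norm_upper) auto
  qed
qed

text \<open>A small multiple of the indicator of a ball is an admissible test function, so
  finiteness of the multiplier norm gives a finite \<open>X\<close>-norm on that ball.\<close>

lemma AE_finite_of_multiplier_norm_finite:
  fixes X Y :: "(real^'n \<Rightarrow> ennreal) \<Rightarrow> ennreal"
  assumes "banach_function_norm X" "banach_function_norm Y" and p: "p > 0"
    and f: "f \<in> borel_measurable lebesgue" and fin: "multiplier_norm (power_norm Y p) X f < \<infinity>"
  shows "AE x in lebesgue. f x < \<infinity>"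
proof -
  interpret X: banach_function_norm X by fact
  interpret Y: banach_function_norm Y by fact
  have "AE x in lebesgue. norm x < real n \<longrightarrow> f x < \<infinity>" for n
  proof -
    let ?b = "ball (0::real^'n) (real n)"
    have b: "?b \<in> sets lebesgue" by simp
    then have bm: "(indicator ?b :: real^'n \<Rightarrow> ennreal) \<in> borel_measurable lebesgue"
      by (rule borel_measurable_indicator)
    have "emeasure lebesgue ?b < \<infinity>"
      using emeasure_lborel_ball_finite[of "0::real^'n" "real n"] by (simp add: emeasure_lebesgue_borel)
    then have "Y (indicator ?b) < \<infinity>" by (intro Y.finite_indicator) auto
    then have "power_norm Y p (indicator ?b) < \<infinity>"
      by (simp add: power_norm_def ennpowr_indicator less_top[symmetric])
    then obtain t where t: "power_norm Y p (indicator ?b) = ennreal t" "t \<ge> 0"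
      by (cases "power_norm Y p (indicator ?b)") auto
    \<comment> \<open>Dividing by \<open>t + 1\<close> covers the case \<open>t = 0\<close> as
      well.\<close>
    define c where "c = 1 / (t + 1)"
    have c: "c > 0" "c * t \<le> 1" using t(2) by (auto simp: c_def divide_le_eq)
    have cm: "(\<lambda>x. ennreal c * indicator ?b x) \<in> borel_measurable lebesgue" using bm by measurable
    have "power_norm Y p (\<lambda>x. ennreal c * indicator ?b x) = ennreal (c * t)"
      using c t bm p by (subst Y.power_norm_cmult) (auto simp: ennreal_mult[symmetric])
    then have "power_norm Y p (\<lambda>x. ennreal c * indicator ?b x) \<le> 1"
      using c(2) by (simp add: ennreal_le_1)
    then have "X (\<lambda>x. f x * (ennreal c * indicator ?b x)) \<le> multiplier_norm (power_norm Y p) X f"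
      by (rule multiplier_norm_upper[OF cm])
    also have "\<dots> < \<infinity>" by (rule fin)
    finally have "AE x in lebesgue. f x * (ennreal c * indicator ?b x) < \<infinity>"
      using f cm by (intro X.AE_finite_of_norm_finite) auto
    then show ?thesis
    proof eventually_elim
      fix x assume "f x * (ennreal c * indicator ?b x) < \<infinity>"
      then show "norm x < real n \<longrightarrow> f x < \<infinity>"
        using c(1) by (cases "f x = top") (auto simp: ennreal_top_mult less_top[symmetric])
    qed
  qed
  then have "AE x in lebesgue. \<forall>n. norm x < real n \<longrightarrow> f x < \<infinity>"
    unfolding AE_all_countable by blast
  then show ?thesis
    by eventually_elim (use reals_Archimedean2 in blast)
qed

text \<open>Divided by its norm, \<open>F\<close> is a test function for \<open>G\<close>. Norm 0
  cannot be normalised, but then \<open>F\<close> vanishes almost everywhere by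
  \<open>zero_iff\<close>.\<close>

lemma multiplier_hoelder:
  fixes X Y :: "(real^'n \<Rightarrow> ennreal) \<Rightarrow> ennreal"
  assumes "banach_function_norm X" "banach_function_norm Y" and p: "p > 0"
    and F: "F \<in> borel_measurable lebesgue" and G: "G \<in> borel_measurable lebesgue"
    and fin: "power_norm Y p F < \<infinity>"
  shows "X (\<lambda>x. F x * G x) \<le> power_norm Y p F * multiplier_norm (power_norm Y p) X G"
proof -
  interpret X: banach_function_norm X by fact
  interpret Y: banach_function_norm Y by fact
  obtain t where t: "power_norm Y p F = ennreal t" "t \<ge> 0"
    using fin by (cases "power_norm Y p F") auto
  show ?thesis
  proof (cases "t = 0")
    case True
    then have "Y (\<lambda>x. ennpowr (F x) p) = 0"
      using t by (simp add: power_norm_def ennpowr_eq_0_iff)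
    then have "AE x in lebesgue. ennpowr (F x) p = 0" using F by (subst (asm) Y.zero_iff) auto
    then have "AE x in lebesgue. F x * G x = 0" by eventually_elim (simp add: ennpowr_eq_0_iff)
    then show ?thesis using F G by (subst X.norm_eq_0_of_AE) auto
  next
    case False
    then have t0: "t > 0" using t by simp
    define g where "g x = ennreal (1 / t) * F x" for x
    have g: "g \<in> borel_measurable lebesgue" unfolding g_def using F by measurable
    have "power_norm Y p g = 1"
      unfolding g_def using F p t t0 by (subst Y.power_norm_cmult) (auto simp: ennreal_mult[symmetric])
    then have le: "X (\<lambda>x. G x * g x) \<le> multiplier_norm (power_norm Y p) X G"
      using g by (intro multiplier_norm_upper) auto
    have "ennreal t * (G x * g x) = F x * G x" for x
    proof -
      have "ennreal t * (G x * g x) = (ennreal t * ennreal (1 / t)) * (F x * G x)"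
        by (simp only: g_def mult_ac)
      then show ?thesis using t0 by (simp add: ennreal_mult[symmetric])
    qed
    then have "X (\<lambda>x. F x * G x) = ennreal t * X (\<lambda>x. G x * g x)"
      using X.homogeneous[of "\<lambda>x. G x * g x" t] G g t by simp
    also have "\<dots> \<le> ennreal t * multiplier_norm (power_norm Y p) X G"
      using le by (rule mult_left_mono) simp
    finally show ?thesis using t by simp
  qed
qed

section \<open>From a pointwise bound to norms\<close>

lemma repr_norm_max_rearr:
  fixes f :: "real^'n \<Rightarrow> ennreal" and W :: "(real^'n \<Rightarrow> ennreal) \<Rightarrow> ennreal"
  obtains v where "v \<in> borel_measurable lebesgue" "repr_norm W (max_rearr f) = W v"
    "\<And>s. s > 0 \<Longrightarrow> emeasure lebesgue {x. v x > ennreal s} = emeasure lborel {t \<in> {0<..}. max_rearr f t > ennreal s}"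
proof -
  define v where "v = (SOME v :: real^'n \<Rightarrow> ennreal. v \<in> borel_measurable lebesgue \<and>
                equimeasurable lebesgue v (lebesgue_on {0<..}) (max_rearr f))"
  have v: "v \<in> borel_measurable lebesgue \<and> equimeasurable lebesgue v (lebesgue_on {0<..}) (max_rearr f)"
    unfolding v_def by (rule someI_ex[OF max_rearr_equimeasurable_exists])
  show ?thesis
  proof (rule that[of v])
    show "v \<in> borel_measurable lebesgue" "repr_norm W (max_rearr f) = W v"
      using v by (simp_all add: repr_norm_def v_def)
    fix s :: real assume "s > 0"
    then show "emeasure lebesgue {x. v x > ennreal s} = emeasure lborel {t \<in> {0<..}. max_rearr f t > ennreal s}"
      using v emeasure_lebesgue_on_superlevel_max_rearr[where f = f and s = s] by (simp add: equimeasurable_def)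
  qed
qed

lemma hl_max_scaled_distribution_le:
  fixes f v :: "real^'n \<Rightarrow> ennreal"
  assumes f: "f \<in> borel_measurable lebesgue"
    and v: "\<And>s. s > 0 \<Longrightarrow> emeasure lebesgue {x. v x > ennreal s} =
      emeasure lborel {t \<in> {0<..}. max_rearr f t > ennreal s}"
    and s: "s > 0"
  shows "emeasure lebesgue {x. ennreal (1 / hl_const TYPE('n)) * hl_max f x > ennreal s}
    \<le> emeasure lebesgue {x. v x > ennreal s}"
proof -
  have "{x. ennreal (1 / hl_const TYPE('n)) * hl_max f x > ennreal s}
    = {x. hl_max f x > ennreal (hl_const TYPE('n) * s)}"
    using hl_const_pos[where 'n = 'n] by (subst ennreal_less_mult_iff) (auto simp: mult.commute)
  then show ?thesis using hl_max_distribution_le[OF f s] v[OF s] by simp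
qed

text \<open>Transport costs a factor 2 for \<open>Y\<close>, which is then raised to the power
  \<theta>, and another factor 2 for the multiplier norm; together they are at most 4. The powers
  \<theta> and 1 - \<theta> of \<open>hl_const\<close> combine to one factor.\<close>

lemma interpolation_of_pointwise_bound:
  fixes X Y :: "(real^'n \<Rightarrow> ennreal) \<Rightarrow> ennreal" and h u U :: "real^'n \<Rightarrow> ennreal"
  assumes riX: "ri_banach_function_norm X" and riY: "ri_banach_function_norm Y"
    and \<theta>: "0 < \<theta>" "\<theta> < 1" and C: "C > 0"
    and h: "h \<in> borel_measurable lebesgue"
    and u: "u \<in> borel_measurable lebesgue" and U: "U \<in> borel_measurable lebesgue"
    and bound: "AE x in lebesgue. hl_max u x < \<infinity> \<longrightarrow> hl_max U x < \<infinity> \<longrightarrow>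
      h x \<le> ennreal C * (ennpowr (hl_max U x) \<theta> * ennpowr (hl_max u x) (1 - \<theta>))"
  shows "X h \<le> ennreal (4 * C * hl_const TYPE('n)) *
      norm_prod (ennpowr (repr_norm Y (max_rearr U)) \<theta>)
        (ennpowr (repr_norm (power_norm (multiplier_norm (power_norm Y (1 / \<theta>)) X) (1 - \<theta>)) (max_rearr u)) (1 - \<theta>))"
proof -
  interpret X: ri_banach_function_norm X by fact
  interpret Y: ri_banach_function_norm Y by fact
  have bfX: "banach_function_norm X" and bfY: "banach_function_norm Y" by unfold_locales
  let ?Z = "power_norm Y (1 / \<theta>)"
  let ?m = "multiplier_norm ?Z X"
  define c where "c = hl_const TYPE('n)"
  have c: "c > 0" unfolding c_def by (rule hl_const_pos)
  obtain v1 where v1: "v1 \<in> borel_measurable lebesgue" "repr_norm Y (max_rearr U) = Y v1"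
    "\<And>s. s > 0 \<Longrightarrow> emeasure lebesgue {x. v1 x > ennreal s} = emeasure lborel {t \<in> {0<..}. max_rearr U t > ennreal s}"
    by (rule repr_norm_max_rearr[where W = Y and f = U], rule that)
  obtain v2 where v2: "v2 \<in> borel_measurable lebesgue"
     "repr_norm (power_norm ?m (1 - \<theta>)) (max_rearr u) = power_norm ?m (1 - \<theta>) v2"
    "\<And>s. s > 0 \<Longrightarrow> emeasure lebesgue {x. v2 x > ennreal s} = emeasure lborel {t \<in> {0<..}. max_rearr u t > ennreal s}"
    by (rule repr_norm_max_rearr[where W = "power_norm ?m (1 - \<theta>)" and f = u], rule that)
  define P where "P = ennpowr (Y v1) \<theta>"
  define Q where "Q = ?m (\<lambda>x. ennpowr (v2 x) (1 - \<theta>))"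
  \<comment> \<open>The outer power 1 - \<theta> cancels the root in \<open>power_norm\<close>, so
    the second factor becomes the multiplier norm of a power of \<open>v2\<close>.\<close>
  have PQ: "norm_prod (ennpowr (repr_norm Y (max_rearr U)) \<theta>)
        (ennpowr (repr_norm (power_norm ?m (1 - \<theta>)) (max_rearr u)) (1 - \<theta>)) = norm_prod P Q"
    unfolding v1(2) v2(2) P_def Q_def using \<theta> by (simp add: power_norm_def ennpowr_ennpowr)
  show ?thesis unfolding PQ c_def[symmetric]
  proof (cases "P = \<infinity> \<or> Q = \<infinity>")
    case True
    then show "X h \<le> ennreal (4 * C * c) * norm_prod P Q"
      using C c by (simp add: norm_prod_def ennreal_mult_top)
  next
    case False
    define a where "a = hl_max u"
    define b where "b = hl_max U"
    let ?A = "?m (\<lambda>x. ennpowr (a x) (1 - \<theta>))" and ?B = "?Z (\<lambda>x. ennpowr (b x) \<theta>)"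
    have am: "a \<in> borel_measurable lebesgue" and bm: "b \<in> borel_measurable lebesgue"
      unfolding a_def b_def by (rule hl_max_measurable)+
    define a' where "a' x = ennreal (1 / c) * a x" for x
    define b' where "b' x = ennreal (1 / c) * b x" for x
    let ?A' = "?m (\<lambda>x. ennpowr (a' x) (1 - \<theta>))" and ?c = "c powr (1 - \<theta>)"
    have a'm: "a' \<in> borel_measurable lebesgue" and b'm: "b' \<in> borel_measurable lebesgue"
      unfolding a'_def b'_def using am bm by measurable
    have scale: "ennreal c * (ennreal (1 / c) * y) = y" for y
      unfolding mult.assoc[symmetric] using c by (simp add: ennreal_mult[symmetric])
    have aa: "a x = ennreal c * a' x" and bb: "b x = ennreal c * b' x" for x
      by (simp_all add: a'_def b'_def scale)
    have "Y b' \<le> 2 * Y v1"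
    proof (rule Y.norm_le_of_distribution_le[OF b'm v1(1)])
      fix s :: real assume "s > 0"
      then show "emeasure lebesgue {x. b' x > ennreal s} \<le> emeasure lebesgue {x. v1 x > ennreal s}"
        unfolding b'_def b_def c_def by (intro hl_max_scaled_distribution_le[OF U] v1(3))
    qed
    moreover have "Y b = ennreal c * Y b'"
      using Y.homogeneous[OF b'm, of c] c by (simp add: bb[abs_def, symmetric])
    ultimately have "Y b \<le> ennreal c * (2 * Y v1)" by (simp add: mult_left_mono)
    also have "\<dots> = ennreal (2 * c) * Y v1" using c by (simp add: ennreal_mult mult_ac)
    finally have Yb: "Y b \<le> ennreal (2 * c) * Y v1" .
    have "?A' \<le> 2 * Q"
      unfolding Q_def
    proof (rule multiplier_norm_le_of_distribution_le[OF riX riY])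
      fix s :: real assume s: "s > 0"
      show "emeasure lebesgue {x. ennpowr (a' x) (1 - \<theta>) > ennreal s}
         \<le> emeasure lebesgue {x. ennpowr (v2 x) (1 - \<theta>) > ennreal s}"
        using \<theta> s unfolding a'_def a_def c_def
        by (simp only: less_ennpowr_iff diff_gt_0_iff_gt)
          (intro hl_max_scaled_distribution_le[OF u] v2(3), simp_all)
    qed (use \<theta> a'm v2(1) in auto)
    then have "ennreal (?c) * ?A' \<le> ennreal (?c) * (2 * Q)"
      by (rule mult_left_mono) simp
    moreover have "?A \<le> ennreal (?c) * ?A'"
      unfolding aa ennpowr_cmult[OF c] using a'm by (intro multiplier_norm_cmult_le[OF bfX]) auto
    ultimately have "?A \<le> ennreal (?c) * (2 * Q)" by order
    also have "\<dots> = ennreal (2 * ?c) * Q" by (simp add: ennreal_mult mult_ac)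
    finally have ma: "?A \<le> ennreal (2 * ?c) * Q" .
    \<comment> \<open>Finite norms make both maximal functions finite almost everywhere, the
      condition under which \<open>bound\<close> gives information.\<close>
    have "Y v1 < \<infinity>" using False by (simp add: P_def less_top[symmetric])
    then have "Y b < \<infinity>" by (intro le_less_trans[OF Yb]) (simp add: ennreal_mult_less_top)
    then have bfin: "AE x in lebesgue. b x < \<infinity>" by (rule Y.AE_finite_of_norm_finite[OF bm])
    have "Q < \<infinity>" using False by (simp add: less_top[symmetric])
    then have "?A < \<infinity>"
      by (intro le_less_trans[OF ma]) (simp add: ennreal_mult_less_top)
    then have "AE x in lebesgue. ennpowr (a x) (1 - \<theta>) < \<infinity>"
      using \<theta> am by (intro AE_finite_of_multiplier_norm_finite[OF bfX bfY]) auto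
    then have afin: "AE x in lebesgue. a x < \<infinity>" by (simp add: less_top[symmetric])
    define FG where "FG x = ennpowr (b x) \<theta> * ennpowr (a x) (1 - \<theta>)" for x
    have FGm: "FG \<in> borel_measurable lebesgue" unfolding FG_def using am bm by measurable
    have "X h \<le> X (\<lambda>x. ennreal C * FG x)"
    proof (rule X.lattice)
      show "AE x in lebesgue. h x \<le> ennreal C * FG x"
        using afin bfin bound by eventually_elim (simp add: a_def b_def FG_def)
    qed (use h FGm in auto)
    also have "\<dots> = ennreal C * X FG" using FGm C by (intro X.homogeneous) auto
    also have "\<dots> \<le> ennreal C * (P * ennreal ((2 * c) powr \<theta>) * (ennreal (2 * ?c) * Q))"
    proof (intro mult_left_mono)
      \<comment> \<open>The exponent \<open>1 / \<theta>\<close> of the power space undoes the power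
        \<theta> of \<open>b\<close>, leaving the norm of the maximal function itself.\<close>
      have "?B = ennpowr (Y b) \<theta>"
        using \<theta> by (simp add: power_norm_def ennpowr_ennpowr)
      also have "\<dots> \<le> ennpowr (ennreal (2 * c) * Y v1) \<theta>" using Yb \<theta> by (intro ennpowr_mono) auto
      also have "\<dots> = P * ennreal ((2 * c) powr \<theta>)"
        unfolding P_def using c by (subst ennpowr_cmult) (auto simp: mult.commute)
      finally have ZF: "?B \<le> P * ennreal ((2 * c) powr \<theta>)" .
      have "P < \<infinity>" using False by (simp add: less_top[symmetric])
      then have "?B < \<infinity>"
        by (intro le_less_trans[OF ZF]) (simp add: ennreal_mult_less_top)
      then have "X FG \<le> ?B * ?A"
        unfolding FG_def using \<theta> am bm by (intro multiplier_hoelder[OF bfX bfY]) auto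
      also have "\<dots> \<le> P * ennreal ((2 * c) powr \<theta>) * (ennreal (2 * ?c) * Q)"
        by (intro mult_mono ZF ma) auto
      finally show "X FG \<le> P * ennreal ((2 * c) powr \<theta>) * (ennreal (2 * ?c) * Q)" .
    qed simp
    also have "\<dots> = ennreal (C * (2 * c) powr \<theta> * (2 * ?c)) * (P * Q)"
      using C by (simp add: ennreal_mult mult_ac)
    also have "\<dots> \<le> ennreal (4 * C * c) * (P * Q)"
    proof (intro mult_right_mono ennreal_leI)
      have "(2 * c) powr \<theta> * ?c = 2 powr \<theta> * (c powr \<theta> * ?c)"
        using c by (simp add: powr_mult)
      also have "c powr \<theta> * ?c = c" using c by (simp add: powr_add[symmetric])
      also have "2 powr \<theta> * c \<le> 2 * c" using \<theta> c powr_mono[of \<theta> 1 2] by (intro mult_right_mono) auto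
      finally have "(2 * C) * ((2 * c) powr \<theta> * ?c) \<le> (2 * C) * (2 * c)"
        using C by (intro mult_left_mono) auto
      then show "C * (2 * c) powr \<theta> * (2 * ?c) \<le> 4 * C * c" by (simp add: mult_ac)
    qed simp
    also have "P * Q = norm_prod P Q" using False by (auto simp: norm_prod_def)
    finally show "X h \<le> ennreal (4 * C * c) * norm_prod P Q" .
  qed
qed

section \<open>Weak derivatives and kernel means\<close>

definition tensor :: "('n \<Rightarrow> real \<Rightarrow> real) \<Rightarrow> real^'n \<Rightarrow> real" where
  "tensor g y = (\<Prod>i\<in>UNIV. g i (y $ i))"

lemma tensor_has_derivative:
  fixes g :: "'n::finite \<Rightarrow> real \<Rightarrow> real"
  assumes "\<And>i. smooth_real (g i)"
  shows "(tensor g has_derivative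
    (\<lambda>h. \<Sum>i\<in>UNIV. deriv (g i) (x $ i) * (h $ i) * (\<Prod>l\<in>UNIV - {i}. g l (x $ l)))) (at x)"
proof -
  have "((\<lambda>y. g i (y $ i)) has_derivative (\<lambda>h. deriv (g i) (x $ i) * (h $ i))) (at x)" for i
  proof -
    have "(g i has_derivative (*) (deriv (g i) (x $ i))) (at (x $ i))"
      using smooth_real_has_derivative[OF assms, of 0 i] by (simp add: has_field_derivative_def)
    from has_derivative_compose[OF bounded_linear.has_derivative[OF bounded_linear_vec_nth has_derivative_ident] this]
    show ?thesis by simp
  qed
  then show ?thesis unfolding tensor_def[abs_def] by (intro has_derivative_prod)
qed

lemma partial_deriv_tensor:
  assumes "\<And>i. smooth_real (g i)"
  shows "partial_deriv i (tensor g) = tensor (g(i := deriv (g i)))"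
proof
  fix x
  have "partial_deriv i (tensor g) x =
      (\<Sum>l\<in>UNIV. deriv (g l) (x $ l) * (axis i 1 $ l) * (\<Prod>l'\<in>UNIV - {l}. g l' (x $ l')))"
    unfolding partial_deriv_def
    by (subst frechet_derivative_at[OF tensor_has_derivative[OF assms], symmetric]) simp
  also have "\<dots> = deriv (g i) (x $ i) * (\<Prod>l\<in>UNIV - {i}. g l (x $ l))"
    by (subst sum.remove[of UNIV i]) (auto simp: axis_def intro!: sum.neutral)
  also have "\<dots> = tensor (g(i := deriv (g i))) x"
    unfolding tensor_def by (subst prod.remove[of UNIV i]) (auto intro!: prod.cong)
  finally show "partial_deriv i (tensor g) x = tensor (g(i := deriv (g i))) x" .
qed

lemma iter_partial_deriv_tensor:
  assumes "\<And>i. smooth_real (g i)"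
  shows "iter_partial_deriv js (tensor g) = tensor (\<lambda>i. (deriv ^^ count_list js i) (g i))"
proof (induction js)
  case (Cons j js)
  have "iter_partial_deriv (j # js) (tensor g) = partial_deriv j (iter_partial_deriv js (tensor g))"
    by (simp add: iter_partial_deriv_def)
  also have "\<dots> = tensor ((\<lambda>i. (deriv ^^ count_list js i) (g i))(j := deriv ((deriv ^^ count_list js j) (g j))))"
    unfolding Cons by (rule partial_deriv_tensor) (rule smooth_real_deriv_funpow[OF assms])
  also have "(\<lambda>i. (deriv ^^ count_list js i) (g i))(j := deriv ((deriv ^^ count_list js j) (g j)))
      = (\<lambda>i. (deriv ^^ count_list (j # js) i) (g i))"
    by (auto simp: fun_eq_iff)
  finally show ?case .
qed (simp add: iter_partial_deriv_def)

lemma test_function_tensor: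
  fixes g :: "'n::finite \<Rightarrow> real \<Rightarrow> real"
  assumes sm: "\<And>i. smooth_real (g i)" and supp: "\<And>y. tensor g y \<noteq> 0 \<Longrightarrow> y \<in> cbox a b"
  shows "test_function (tensor g)"
  unfolding test_function_def
proof (intro conjI allI)
  fix js
  have "tensor h differentiable_on UNIV" if "\<And>i. smooth_real (h i)" for h :: "'n \<Rightarrow> real \<Rightarrow> real"
    using tensor_has_derivative[of h, OF that] unfolding differentiable_on_def differentiable_def by blast
  then show "iter_partial_deriv js (tensor g) differentiable_on UNIV"
    unfolding iter_partial_deriv_tensor[of g, OF sm] by (simp add: smooth_real_deriv_funpow[OF sm])
  have "{y. tensor g y \<noteq> 0} \<subseteq> cbox a b" using supp by auto
  then have "closure {y. tensor g y \<noteq> 0} \<subseteq> cbox a b" by (intro closure_minimal closed_cbox)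
  then show "compact (closure {y. tensor g y \<noteq> 0})"
    by (metis bounded_cbox bounded_subset closed_closure compact_eq_bounded_closed)
qed

lemma continuous_tensor:
  assumes "\<And>i. smooth_real (g i)"
  shows "continuous_on UNIV (tensor g)"
  by (intro continuous_at_imp_continuous_on ballI has_derivative_continuous[OF tensor_has_derivative[of g, OF assms]])

lemma tensor_measurable:
  assumes "\<And>i. smooth_real (g i)"
  shows "tensor g \<in> borel_measurable lebesgue"
  using borel_measurable_continuous_onI[OF continuous_tensor[of g, OF assms]]
  by (intro measurable_completion) simp

text \<open>\<open>lborel\<close> on vectors is the image of a product measure indexed by
  \<open>Basis\<close>; reindexing the basis vectors by coordinates reduces the claim to Fubini for
  products.\<close>

lemma integral_tensor:
  fixes g :: "'n::finite \<Rightarrow> real \<Rightarrow> real"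
  assumes sm: "\<And>i. smooth_real (g i)" and int: "\<And>i. integrable lborel (g i)"
  shows "integral\<^sup>L lebesgue (tensor g) = (\<Prod>i\<in>UNIV. integral\<^sup>L lborel (g i))"
proof -
  interpret product_sigma_finite "\<lambda>_::real^'n. lborel :: real measure"
    by (simp add: product_sigma_finite_def sigma_finite_lborel)
  have inj: "inj_on (\<lambda>i::'n. axis i (1::real)) UNIV" by (auto simp: inj_on_def axis_eq_axis)
  have Bas: "(Basis :: (real^'n) set) = (\<lambda>i. axis i 1) ` UNIV" by (auto simp: Basis_vec_def)
  define G where "G b = g (axis_index b)" for b :: "real^'n"
  have Gi: "G (axis i 1) = g i" for i by (simp add: G_def)
  have tm: "tensor g \<in> borel_measurable borel"
    using continuous_tensor[of g, OF sm] by (rule borel_measurable_continuous_onI)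
  have comp: "tensor g (\<Sum>b\<in>Basis. f b *\<^sub>R b) = (\<Prod>b\<in>Basis. G b (f b))" for f :: "real^'n \<Rightarrow> real"
  proof -
    have "(\<Sum>b\<in>Basis. f b *\<^sub>R b) $ i = f (axis i 1)" for i
    proof -
      have "(\<Sum>b\<in>Basis. f b *\<^sub>R b) $ i = (\<Sum>b\<in>Basis. f b *\<^sub>R b) \<bullet> axis i 1" by (rule cart_eq_inner_axis)
      also have "\<dots> = f (axis i 1)" by (rule inner_sum_left_Basis) (simp add: Bas)
      finally show ?thesis .
    qed
    then show ?thesis unfolding tensor_def Bas by (simp add: prod.reindex[OF inj] Gi)
  qed
  have "integral\<^sup>L lebesgue (tensor g) = integral\<^sup>L lborel (tensor g)"
    using tm by (intro integral_completion) simp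
  also have "\<dots> = integral\<^sup>L (\<Pi>\<^sub>M b\<in>Basis. lborel) (\<lambda>f. tensor g (\<Sum>b\<in>Basis. f b *\<^sub>R b))"
    by (subst lborel_eq) (rule integral_distr, use tm in \<open>auto intro!: borel_measurable_sum\<close>)
  also have "\<dots> = (\<integral>f. (\<Prod>b\<in>Basis. G b (f b)) \<partial>(\<Pi>\<^sub>M b\<in>Basis. lborel))"
    by (simp only: comp)
  also have "\<dots> = (\<Prod>b\<in>Basis. integral\<^sup>L lborel (G b))"
    by (rule product_integral_prod) (auto simp: G_def int)
  also have "\<dots> = (\<Prod>i\<in>UNIV. integral\<^sup>L lborel (g i))"
    unfolding Bas by (simp add: prod.reindex[OF inj] Gi)
  finally show ?thesis .
qed

text \<open>The kernel \<open>\<rho>\<^sup>-\<^sup>1 g ((t - x) / \<rho>)\<close> lives to the right of \<open>x\<close>, because the library's differentiation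
  theorem concerns cubes with a corner at \<open>x\<close>.\<close>

definition scaled_kernel :: "real \<Rightarrow> real^'n \<Rightarrow> ('n \<Rightarrow> real \<Rightarrow> real) \<Rightarrow> 'n \<Rightarrow> real \<Rightarrow> real" where
  "scaled_kernel \<rho> x g i t = (1 / \<rho>) * g i ((1 / \<rho>) * t + (- (x $ i) / \<rho>))"

definition kernel_mean :: "real \<Rightarrow> (real^'n \<Rightarrow> real) \<Rightarrow> ('n \<Rightarrow> real \<Rightarrow> real) \<Rightarrow> real^'n \<Rightarrow> real" where
  "kernel_mean \<rho> v g x = (LINT y|lebesgue. v y * tensor (scaled_kernel \<rho> x g) y)"

lemma smooth_scaled_kernel:
  assumes "smooth_real (g i)"
  shows "smooth_real (scaled_kernel \<rho> x g i)"
    and "(deriv ^^ n) (scaled_kernel \<rho> x g i) t =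
      (1 / \<rho>) ^ n * scaled_kernel \<rho> x (\<lambda>i. (deriv ^^ n) (g i)) i t"
proof -
  let ?h = "\<lambda>t. g i ((1 / \<rho>) * t + (- (x $ i) / \<rho>))"
  have h: "smooth_real ?h" by (rule smooth_real_affine[OF assms])
  have eq: "scaled_kernel \<rho> x g i = (\<lambda>t. (1 / \<rho>) * ?h t + 0 * ?h t)"
    by (simp add: scaled_kernel_def fun_eq_iff)
  show "smooth_real (scaled_kernel \<rho> x g i)" unfolding eq by (rule smooth_real_lincomb(1)[OF h h])
  show "(deriv ^^ n) (scaled_kernel \<rho> x g i) t =
      (1 / \<rho>) ^ n * scaled_kernel \<rho> x (\<lambda>i. (deriv ^^ n) (g i)) i t"
    unfolding eq smooth_real_lincomb(2)[OF h h] deriv_funpow_affine[OF assms]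
    by (simp add: scaled_kernel_def)
qed

lemma add_scaleR_One_component: "(x + \<rho> *\<^sub>R One) $ i = x $ i + \<rho>" for x :: "real^'n"
proof -
  have "(One :: real^'n) $ i = (\<Sum>b\<in>Basis. 1 *\<^sub>R b) \<bullet> (axis i 1 :: real^'n)"
    unfolding scaleR_one by (rule cart_eq_inner_axis)
  also have "\<dots> = 1" by (rule inner_sum_left_Basis) (auto simp: Basis_vec_def)
  finally show ?thesis by (simp only: vector_add_component vector_scaleR_component) simp
qed

lemma mem_cbox_One_cart:
  fixes x y :: "real^'n"
  shows "y \<in> cbox x (x + \<rho> *\<^sub>R One) \<longleftrightarrow> (\<forall>i. x $ i \<le> y $ i \<and> y $ i \<le> x $ i + \<rho>)"
  by (simp only: mem_box_cart add_scaleR_One_component)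

lemma scaled_kernel_tensor_bound:
  fixes x :: "real^'n"
  assumes g: "\<And>i. unit_kernel (g i)" and B: "\<And>i t. \<bar>g i t\<bar> \<le> B" and \<rho>: "\<rho> > 0"
  shows "\<bar>tensor (scaled_kernel \<rho> x g) y\<bar> \<le> B ^ CARD('n) / \<rho> ^ CARD('n) * indicator (cbox x (x + \<rho> *\<^sub>R One)) y"
proof (cases "y \<in> cbox x (x + \<rho> *\<^sub>R One)")
  case True
  have "\<bar>tensor (scaled_kernel \<rho> x g) y\<bar> = (\<Prod>i\<in>UNIV. \<bar>scaled_kernel \<rho> x g i (y $ i)\<bar>)"
    by (simp add: tensor_def abs_prod)
  also have "\<dots> \<le> (\<Prod>i\<in>(UNIV :: 'n set). B / \<rho>)"
    using B \<rho> by (intro prod_mono) (auto simp: scaled_kernel_def abs_mult divide_right_mono)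
  also have "\<dots> = B ^ CARD('n) / \<rho> ^ CARD('n)" by (simp add: power_divide)
  finally show ?thesis using True by simp
next
  case False
  then obtain i where "\<not> (x $ i \<le> y $ i \<and> y $ i \<le> x $ i + \<rho>)" unfolding mem_cbox_One_cart by blast
  moreover have "(1 / \<rho>) * y $ i + (- (x $ i) / \<rho>) = (y $ i - x $ i) / \<rho>" by (simp add: diff_divide_distrib)
  ultimately have "(1 / \<rho>) * y $ i + (- (x $ i) / \<rho>) \<notin> {0..1}"
    using \<rho> by (auto simp: zero_le_divide_iff divide_le_eq)
  then have "scaled_kernel \<rho> x g i (y $ i) = 0"
    using g[of i] by (simp add: scaled_kernel_def unit_kernel_def)
  then have "tensor (scaled_kernel \<rho> x g) y = 0"
    unfolding tensor_def by (intro prod_zero) auto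
  then show ?thesis using False by simp
qed

lemma unit_kernel_family_bounded:
  fixes g :: "'n::finite \<Rightarrow> real \<Rightarrow> real"
  assumes "\<And>i. unit_kernel (g i)"
  obtains B where "\<And>i t. \<bar>g i t\<bar> \<le> B"
proof -
  have "\<forall>i. \<exists>B. \<forall>t. \<bar>g i t\<bar> \<le> B"
  proof
    fix i
    from unit_kernel_bounded[OF assms[of i]] show "\<exists>B. \<forall>t. \<bar>g i t\<bar> \<le> B" by metis
  qed
  then obtain Bf where Bf: "\<forall>i t. \<bar>g i t\<bar> \<le> Bf i" by (rule choice[THEN exE])
  have "\<bar>g i t\<bar> \<le> Max (range Bf)" for i t
    by (rule order_trans[OF Bf[rule_format] Max_ge]) auto
  with that show ?thesis by blast
qed

lemma test_function_scaled_kernel: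
  fixes x :: "real^'n"
  assumes g: "\<And>i. unit_kernel (g i)" and \<rho>: "\<rho> > 0"
  shows "test_function (tensor (scaled_kernel \<rho> x g))"
proof (rule test_function_tensor)
  show "smooth_real (scaled_kernel \<rho> x g i)" for i
    using g[of i] by (intro smooth_scaled_kernel) (simp add: unit_kernel_def)
  fix y assume y: "tensor (scaled_kernel \<rho> x g) y \<noteq> 0"
  obtain B where B: "\<And>i t. \<bar>g i t\<bar> \<le> B" by (rule unit_kernel_family_bounded[of g, OF g], rule that)
  from scaled_kernel_tensor_bound[where g = g and x = x and y = y, OF g B \<rho>] y
  show "y \<in> cbox x (x + \<rho> *\<^sub>R One)" by (cases "y \<in> cbox x (x + \<rho> *\<^sub>R One)") auto
qed

lemma exists_list_with_counts:
  fixes \<alpha> :: "'n::finite \<Rightarrow> nat"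
  shows "\<exists>js. count_list js = \<alpha>"
proof -
  have "\<exists>js. \<forall>i. count_list js i = (if i \<in> S then \<alpha> i else 0)" if "finite S" for S
    using that
  proof (induction S)
    case empty
    show ?case by (intro exI[of _ "[]"]) simp
  next
    case (insert a S)
    then obtain js where "\<forall>i. count_list js i = (if i \<in> S then \<alpha> i else 0)" by blast
    moreover have "count_list (replicate n a) i = (if i = a then n else 0)" for n i
      by (induction n) auto
    ultimately show ?case using insert(2) by (intro exI[of _ "replicate (\<alpha> a) a @ js"]) auto
  qed
  from this[of UNIV] show ?thesis by (auto simp: fun_eq_iff)
qed

section \<open>Moving derivatives between function and kernel\<close>

text \<open>The scaled tensor kernel is itself the test function. Each derivative falling on it
  releases \<open>1 / \<rho>\<close>, and the signs of integration by parts are collected in the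
  powers of \<open>- \<rho>\<close>.\<close>

lemma kernel_mean_weak_deriv:
  fixes u v :: "real^'n \<Rightarrow> real"
  assumes wd: "has_weak_deriv \<alpha> u v" and g: "\<And>i. unit_kernel (g i)" and \<rho>: "\<rho> > 0"
  shows "kernel_mean \<rho> u (\<lambda>i. (deriv ^^ \<alpha> i) (g i)) x = (- \<rho>) ^ (\<Sum>i\<in>UNIV. \<alpha> i) * kernel_mean \<rho> v g x"
proof -
  let ?n = "\<Sum>i\<in>UNIV. \<alpha> i"
  let ?\<phi> = "tensor (scaled_kernel \<rho> x g)"
  let ?g = "\<lambda>i. (deriv ^^ \<alpha> i) (g i)"
  have sm: "smooth_real (g i)" for i using g[of i] by (simp add: unit_kernel_def)
  obtain js where js: "count_list js = \<alpha>" using exists_list_with_counts by blast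
  have iter: "iter_partial_deriv js ?\<phi> y = (1 / \<rho>) ^ ?n * tensor (scaled_kernel \<rho> x ?g) y" for y
  proof -
    have "iter_partial_deriv js ?\<phi> y = (\<Prod>i\<in>UNIV. (deriv ^^ \<alpha> i) (scaled_kernel \<rho> x g i) (y $ i))"
      by (simp add: iter_partial_deriv_tensor[OF smooth_scaled_kernel(1)[OF sm]] js tensor_def)
    also have "\<dots> = (\<Prod>i\<in>UNIV. (1 / \<rho>) ^ \<alpha> i * scaled_kernel \<rho> x ?g i (y $ i))"
      by (intro prod.cong refl) (simp add: smooth_scaled_kernel(2)[OF sm] scaled_kernel_def)
    also have "\<dots> = (1 / \<rho>) ^ ?n * tensor (scaled_kernel \<rho> x ?g) y"
      by (simp add: prod.distrib tensor_def power_sum)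
    finally show ?thesis .
  qed
  have u_iter: "u y * iter_partial_deriv js ?\<phi> y =
      (1 / \<rho>) ^ ?n * (u y * tensor (scaled_kernel \<rho> x ?g) y)" for y
    unfolding iter by (rule mult.left_commute)
  have "(LINT y|lebesgue. u y * iter_partial_deriv js ?\<phi> y) = (- 1) ^ ?n * (LINT y|lebesgue. v y * ?\<phi> y)"
    by (rule wd[unfolded has_weak_deriv_def, THEN conjunct2, THEN conjunct2, rule_format,
          OF conjI[OF test_function_scaled_kernel[where g = g, OF g \<rho>] js]])
  then have "(LINT y|lebesgue. (1 / \<rho>) ^ ?n * (u y * tensor (scaled_kernel \<rho> x ?g) y))
      = (- 1) ^ ?n * (LINT y|lebesgue. v y * ?\<phi> y)"
    unfolding u_iter .
  then have "(1 / \<rho>) ^ ?n * kernel_mean \<rho> u ?g x = (- 1) ^ ?n * kernel_mean \<rho> v g x"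
    unfolding kernel_mean_def by (simp only: integral_mult_right_zero)
  then have "\<rho> ^ ?n * ((1 / \<rho>) ^ ?n * kernel_mean \<rho> u ?g x)
     = \<rho> ^ ?n * ((- 1) ^ ?n * kernel_mean \<rho> v g x)" by simp
  moreover have "\<rho> ^ ?n * (1 / \<rho>) ^ ?n = 1" using \<rho> by (simp add: power_mult_distrib[symmetric])
  moreover have "\<rho> ^ ?n * (- 1) ^ ?n = (- \<rho>) ^ ?n" by (simp add: power_mult_distrib[symmetric])
  ultimately show ?thesis by (metis mult.assoc mult_1)
qed

text \<open>The kernel is at most \<open>(B / \<rho>) ^ CARD('n)\<close> and lives on a cube of side
  \<rho> with corner \<open>x\<close>, which the l1 norm places in the ball of radius
  \<open>CARD('n) * \<rho>\<close>. The powers of \<rho> cancel, so the bound is uniform in the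
  scale.\<close>

lemma kernel_mean_hl_max_bound:
  fixes v :: "real^'n \<Rightarrow> real"
  assumes v: "v \<in> borel_measurable lebesgue"
    and g: "\<And>i. unit_kernel (g i)" and B: "\<And>i t. \<bar>g i t\<bar> \<le> B" and \<rho>: "\<rho> > 0"
  shows "ennreal \<bar>kernel_mean \<rho> v g x\<bar> \<le> ennreal ((B * real CARD('n)) ^ CARD('n)) * hl_max (\<lambda>y. ennreal \<bar>v y\<bar>) x"
proof -
  let ?\<phi> = "tensor (scaled_kernel \<rho> x g)"
  let ?N = "CARD('n)"
  let ?c = "B ^ ?N / \<rho> ^ ?N" and ?i = "indicator (cball x (real ?N * \<rho>))"
  have B0: "B \<ge> 0" using B[of undefined 0] by linarith
  have "ennreal \<bar>kernel_mean \<rho> v g x\<bar> \<le> (\<integral>\<^sup>+y. ennreal \<bar>v y * ?\<phi> y\<bar> \<partial>lebesgue)"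
  \<comment> \<open>If the product is not integrable, the Bochner integral is 0 by convention and
    the estimate is trivial.\<close>
  proof (cases "integrable lebesgue (\<lambda>y. v y * ?\<phi> y)")
    case True
    then show ?thesis using integral_norm_bound_ennreal[OF True] by (simp add: kernel_mean_def)
  qed (simp add: kernel_mean_def not_integrable_integral_eq)
  also have "\<dots> \<le> (\<integral>\<^sup>+y. ennreal (?c) * (ennreal \<bar>v y\<bar> * ?i y) \<partial>lebesgue)"
  proof (intro nn_integral_mono)
    fix y
    have "\<bar>v y * ?\<phi> y\<bar> \<le> \<bar>v y\<bar> * (?c * indicator (cbox x (x + \<rho> *\<^sub>R One)) y)"
      unfolding abs_mult by (intro mult_left_mono scaled_kernel_tensor_bound g B \<rho>) auto
    also have "\<dots> \<le> ?c * (\<bar>v y\<bar> * ?i y)"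
    proof (cases "y \<in> cbox x (x + \<rho> *\<^sub>R One)")
      case True
      have "norm (x - y) \<le> (\<Sum>i\<in>UNIV. \<bar>(x - y) $ i\<bar>)" by (rule norm_le_l1_cart)
      also have "\<dots> \<le> (\<Sum>i\<in>(UNIV::'n set). \<rho>)"
        using True unfolding mem_cbox_One_cart by (intro sum_mono) (auto simp: abs_le_iff algebra_simps)
      finally have "y \<in> cball x (real ?N * \<rho>)" by (simp add: dist_norm)
      then show ?thesis using True by (simp add: mult.commute)
    qed (use B0 \<rho> in auto)
    finally have "\<bar>v y * ?\<phi> y\<bar> \<le> ?c * (\<bar>v y\<bar> * ?i y)" .
    then have "ennreal \<bar>v y * ?\<phi> y\<bar> \<le> ennreal (?c * (\<bar>v y\<bar> * ?i y))"
      by (rule ennreal_leI)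
    also have "\<dots> = ennreal (?c) * (ennreal \<bar>v y\<bar> * ?i y)"
      using B0 \<rho> by (auto simp: ennreal_mult[symmetric] indicator_def)
    finally show "ennreal \<bar>v y * ?\<phi> y\<bar> \<le> ennreal (?c) * (ennreal \<bar>v y\<bar> * ?i y)" .
  qed
  also have "\<dots> \<le> ennreal (?c) * (\<integral>\<^sup>+y. ennreal \<bar>v y\<bar> * ?i y \<partial>lebesgue)"
    using v by (subst nn_integral_cmult) (auto intro!: borel_measurable_times_ennreal borel_measurable_indicator)
  also have "\<dots> \<le> ennreal (?c) * (ennreal ((real ?N * \<rho>) ^ ?N) * hl_max (\<lambda>y. ennreal \<bar>v y\<bar>) x)"
    using \<rho> by (intro mult_left_mono hl_max_upper) auto
  also have "\<dots> = ennreal ((B * real ?N) ^ ?N) * hl_max (\<lambda>y. ennreal \<bar>v y\<bar>) x"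
    unfolding mult.assoc[symmetric] using B0 \<rho>
    by (subst ennreal_mult[symmetric]) (auto simp: power_mult_distrib)
  finally show ?thesis .
qed

lemma content_cbox_One:
  fixes x :: "real^'n"
  assumes "\<rho> > 0"
  shows "measure lborel (cbox x (x + \<rho> *\<^sub>R One)) = \<rho> ^ CARD('n)"
proof -
  have "x \<in> cbox x (x + \<rho> *\<^sub>R One)" using assms by (simp add: mem_cbox_One_cart)
  then have "cbox x (x + \<rho> *\<^sub>R One) \<noteq> {}" by blast
  then have "measure lborel (cbox x (x + \<rho> *\<^sub>R One)) = (\<Prod>i\<in>UNIV. (x + \<rho> *\<^sub>R One) $ i - x $ i)"
    by (rule content_cbox_cart)
  also have "\<dots> = (\<Prod>i\<in>(UNIV :: 'n set). \<rho>)"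
    by (intro prod.cong refl) (simp only: add_scaleR_One_component add_diff_cancel_left')
  finally show ?thesis by simp
qed

lemma integrable_mult_scaled_kernel:
  fixes v :: "real^'n \<Rightarrow> real"
  assumes v: "locally_integrable v" and g: "\<And>i. unit_kernel (g i)" and \<rho>: "\<rho> > 0"
  shows "integrable lebesgue (\<lambda>y. v y * tensor (scaled_kernel \<rho> x g) y)"
proof -
  obtain B where B: "\<And>i t. \<bar>g i t\<bar> \<le> B" by (rule unit_kernel_family_bounded[of g, OF g], rule that)
  let ?b = "cbox x (x + \<rho> *\<^sub>R One)"
  let ?c = "B ^ CARD('n) / \<rho> ^ CARD('n)"
  have vm: "v \<in> borel_measurable lebesgue" and vi: "integrable lebesgue (\<lambda>y. indicator ?b y *\<^sub>R v y)"
    using v by (auto simp: locally_integrable_def set_integrable_def)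
  have sm: "smooth_real (scaled_kernel \<rho> x g i)" for i
    using g[of i] by (intro smooth_scaled_kernel) (simp add: unit_kernel_def)
  show ?thesis
  proof (rule Bochner_Integration.integrable_bound)
    show "integrable lebesgue (\<lambda>y. ?c * (indicator ?b y *\<^sub>R v y))"
      using vi by (intro integrable_mult_right)
    show "(\<lambda>y. v y * tensor (scaled_kernel \<rho> x g) y) \<in> borel_measurable lebesgue"
      using vm tensor_measurable[of "scaled_kernel \<rho> x g", OF sm] by (rule borel_measurable_times)
    show "AE y in lebesgue. norm (v y * tensor (scaled_kernel \<rho> x g) y)
      \<le> norm (?c * (indicator ?b y *\<^sub>R v y))"
    proof (rule AE_I2)
      fix y
      have "norm (v y * tensor (scaled_kernel \<rho> x g) y) = \<bar>v y\<bar> * \<bar>tensor (scaled_kernel \<rho> x g) y\<bar>"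
        by (simp add: abs_mult)
      also have "\<dots> \<le> \<bar>v y\<bar> * (B ^ CARD('n) / \<rho> ^ CARD('n) * indicator ?b y)"
        by (intro mult_left_mono scaled_kernel_tensor_bound[where g = g, OF g B \<rho>]) auto
      also have "\<dots> = ?c * (indicator ?b y * \<bar>v y\<bar>)" by (simp only: mult_ac)
      also have "\<dots> \<le> \<bar>?c * (indicator ?b y * \<bar>v y\<bar>)\<bar>" by (rule abs_ge_self)
      also have "\<dots> = norm (?c * (indicator ?b y *\<^sub>R v y))"
        by (simp only: abs_mult real_norm_def real_scaleR_def abs_abs)
      finally show "norm (v y * tensor (scaled_kernel \<rho> x g) y)
        \<le> norm (?c * (indicator ?b y *\<^sub>R v y))" .
    qed
  qed
qed

section \<open>Dyadic descent in the scale\<close>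

lemma kernel_mean_diff:
  fixes v :: "real^'n \<Rightarrow> real"
  assumes v: "locally_integrable v" and g: "\<And>i. unit_kernel (g i)" and \<rho>: "\<rho> > 0"
    and p: "unit_kernel p" and q: "unit_kernel q"
  shows "kernel_mean \<rho> v (g(i := \<lambda>t. p t - q t)) x =
    kernel_mean \<rho> v (g(i := p)) x - kernel_mean \<rho> v (g(i := q)) x"
proof -
  have upd: "tensor (scaled_kernel \<rho> x (g(i := r))) y =
      (1 / \<rho>) * r ((1 / \<rho>) * (y $ i) + (- (x $ i) / \<rho>)) * (\<Prod>l\<in>UNIV - {i}. scaled_kernel \<rho> x g l (y $ l))" for r y
    unfolding tensor_def by (subst prod.remove[of UNIV i]) (auto simp: scaled_kernel_def intro!: prod.cong)
  have "v y * tensor (scaled_kernel \<rho> x (g(i := \<lambda>t. p t - q t))) y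
      = v y * tensor (scaled_kernel \<rho> x (g(i := p))) y - v y * tensor (scaled_kernel \<rho> x (g(i := q))) y" for y
    unfolding upd by (simp add: algebra_simps)
  moreover have i1: "integrable lebesgue (\<lambda>y. v y * tensor (scaled_kernel \<rho> x (g(i := p))) y)"
    by (rule integrable_mult_scaled_kernel[OF v _ \<rho>]) (use g p in auto)
  moreover have i2: "integrable lebesgue (\<lambda>y. v y * tensor (scaled_kernel \<rho> x (g(i := q))) y)"
    by (rule integrable_mult_scaled_kernel[OF v _ \<rho>]) (use g q in auto)
  ultimately show ?thesis
    unfolding kernel_mean_def
    using Bochner_Integration.integral_diff[OF i1 i2] by simp
qed

text \<open>This turns a change of scale into a change of kernel at fixed \<rho>.\<close>

lemma kernel_mean_half:
  assumes "\<rho> > 0"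
  shows "kernel_mean (\<rho> / 2) v (\<lambda>_. f) x = kernel_mean \<rho> v (\<lambda>_ t. 2 * f (2 * t)) x"
proof -
  have "scaled_kernel (\<rho> / 2) x (\<lambda>_. f) i t = scaled_kernel \<rho> x (\<lambda>_ t. 2 * f (2 * t)) i t" for i t
  proof -
    have dil: "2 * ((1 / \<rho>) * t + (- (x $ i) / \<rho>)) = (1 / (\<rho> / 2)) * t + (- (x $ i) / (\<rho> / 2))"
      using assms by (simp add: field_simps)
    show ?thesis unfolding scaled_kernel_def dil[symmetric] by simp
  qed
  then have "scaled_kernel (\<rho> / 2) x (\<lambda>_. f) = scaled_kernel \<rho> x (\<lambda>_ t. 2 * f (2 * t))" by (intro ext)
  then show ?thesis by (simp add: kernel_mean_def)
qed

text \<open>Both \<open>w\<close> and \<open>w'\<close> are given as derivatives of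
  \<open>u\<close>, so both sides are rewritten as means of \<open>u\<close> with all derivatives on
  the kernel, where they coincide. The common factor from the order of \<alpha> is then
  cancelled.\<close>

lemma kernel_mean_deriv_shift:
  fixes u w w' :: "real^'n \<Rightarrow> real"
  assumes w: "has_weak_deriv \<alpha> u w" and w': "has_weak_deriv (\<alpha>(i := \<alpha> i + m)) u w'"
    and h: "\<And>l. unit_kernel (h l)" and \<theta>: "unit_kernel \<theta>" and \<rho>: "\<rho> > 0"
  shows "kernel_mean \<rho> w (h(i := (deriv ^^ m) \<theta>)) x = (- \<rho>) ^ m * kernel_mean \<rho> w' (h(i := \<theta>)) x"
proof -
  let ?\<beta> = "\<alpha>(i := \<alpha> i + m)"
  let ?g = "h(i := (deriv ^^ m) \<theta>)" and ?g' = "h(i := \<theta>)"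
  let ?n = "\<Sum>l\<in>UNIV. \<alpha> l"
  have uk: "unit_kernel (?g l)" "unit_kernel (?g' l)" for l
    using h \<theta> unit_kernel_deriv_funpow[OF \<theta>] by auto
  have "(\<Sum>l\<in>UNIV. ?\<beta> l) = ?n + m"
    by (subst (1 2) sum.remove[of UNIV i]) auto
  then have "(- \<rho>) ^ (?n + m) * kernel_mean \<rho> w' ?g' x = kernel_mean \<rho> u (\<lambda>l. (deriv ^^ ?\<beta> l) (?g' l)) x"
    using kernel_mean_weak_deriv[where g = ?g', OF w' uk(2) \<rho>] by simp
  also have "(\<lambda>l. (deriv ^^ ?\<beta> l) (?g' l)) = (\<lambda>l. (deriv ^^ \<alpha> l) (?g l))"
    by (auto simp: fun_eq_iff funpow_add)
  also have "kernel_mean \<rho> u (\<lambda>l. (deriv ^^ \<alpha> l) (?g l)) x = (- \<rho>) ^ ?n * kernel_mean \<rho> w ?g x"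
    by (rule kernel_mean_weak_deriv[where g = ?g, OF w uk(1) \<rho>])
  finally have "(- \<rho>) ^ ?n * kernel_mean \<rho> w ?g x = (- \<rho>) ^ ?n * ((- \<rho>) ^ m * kernel_mean \<rho> w' ?g' x)"
    by (simp only: power_add mult.assoc)
  then show ?thesis using \<rho> by simp
qed

text \<open>One dyadic step: replacing the kernel by its dilate one coordinate at a time, each replacement
  costs an \<open>m\<close>-fold derivative in that coordinate.\<close>

lemma kernel_mean_dyadic_step:
  fixes w :: "real^'n \<Rightarrow> real" and w' :: "'n \<Rightarrow> real^'n \<Rightarrow> real"
  assumes w: "has_weak_deriv \<alpha> u w" and w': "\<And>i. has_weak_deriv (\<alpha>(i := \<alpha> i + m)) u (w' i)"
    and f: "unit_kernel f" and \<theta>: "unit_kernel \<theta>" and \<rho>: "\<rho> > 0"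
    and eq: "(\<lambda>t. 2 * f (2 * t) - f t) = (deriv ^^ m) \<theta>"
    and B: "\<And>t. \<bar>f t\<bar> \<le> B" "\<And>t. \<bar>\<theta> t\<bar> \<le> B"
    and D: "\<And>i g. (\<And>l. unit_kernel (g l)) \<Longrightarrow> (\<And>l t. \<bar>g l t\<bar> \<le> 2 * B) \<Longrightarrow> \<bar>kernel_mean \<rho> (w' i) g x\<bar> \<le> D"
  shows "\<bar>kernel_mean (\<rho> / 2) w (\<lambda>_. f) x - kernel_mean \<rho> w (\<lambda>_. f) x\<bar> \<le> real CARD('n) * \<rho> ^ m * D"
proof -
  define f2 where "f2 t = 2 * f (2 * t)" for t
  have f2: "unit_kernel f2"
    using unit_kernel_lincomb[OF unit_kernel_dilate[OF f] unit_kernel_dilate[OF f], of 2 0]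
    by (simp add: f2_def[abs_def])
  have B0: "B \<ge> 0" using B(1)[of 0] by linarith
  \<comment> \<open>The dilated kernel is doubled, hence the bound \<open>2 * B\<close> in the
    hypothesis \<open>D\<close>.\<close>
  have b2: "\<bar>f2 t\<bar> \<le> 2 * B" for t using B(1)[of "2 * t"] by (simp add: f2_def)
  have b1: "\<bar>f t\<bar> \<le> 2 * B" "\<bar>\<theta> t\<bar> \<le> 2 * B" for t using B(1)[of t] B(2)[of t] B0 by linarith+
  have li: "locally_integrable w" using w by (simp add: has_weak_deriv_def)
  \<comment> \<open>\<open>G S\<close> uses the dilated kernel in the coordinates of
    \<open>S\<close>; enlarging \<open>S\<close> from the empty set to \<open>UNIV\<close>
    telescopes the change.\<close>
  define G where "G S = (\<lambda>i. if i \<in> S then f2 else f)" for S :: "'n set"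
  have G: "unit_kernel (G S i)" "\<bar>G S i t\<bar> \<le> 2 * B" for S i t
    using f f2 b1 b2 by (auto simp: G_def)
  have main: "\<bar>kernel_mean \<rho> w (G S) x - kernel_mean \<rho> w (G {}) x\<bar> \<le> real (card S) * (\<rho> ^ m * D)"
    if "finite S" for S
    using that
  proof (induction S)
    case (insert i S)
    have upd2: "G (insert i S) = (G S)(i := f2)" and upd: "G S = (G S)(i := f)"
      using insert(2) by (auto simp: G_def fun_eq_iff)
    have "kernel_mean \<rho> w (G (insert i S)) x - kernel_mean \<rho> w (G S) x
        = kernel_mean \<rho> w ((G S)(i := f2)) x - kernel_mean \<rho> w ((G S)(i := f)) x"
      using upd2 upd by metis
    also have "\<dots> = kernel_mean \<rho> w ((G S)(i := \<lambda>t. f2 t - f t)) x"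
      by (rule kernel_mean_diff[symmetric, OF li G(1) \<rho> f2 f])
    also have "(\<lambda>t. f2 t - f t) = (deriv ^^ m) \<theta>" unfolding f2_def by (rule eq)
    also have "kernel_mean \<rho> w ((G S)(i := (deriv ^^ m) \<theta>)) x = (- \<rho>) ^ m * kernel_mean \<rho> (w' i) ((G S)(i := \<theta>)) x"
      by (rule kernel_mean_deriv_shift[OF w w' G(1) \<theta> \<rho>])
    finally have step: "kernel_mean \<rho> w (G (insert i S)) x - kernel_mean \<rho> w (G S) x
        = (- \<rho>) ^ m * kernel_mean \<rho> (w' i) ((G S)(i := \<theta>)) x" .
    have "\<bar>kernel_mean \<rho> (w' i) ((G S)(i := \<theta>)) x\<bar> \<le> D"
    proof (rule D)
      show "unit_kernel (((G S)(i := \<theta>)) l)" for l using G(1) \<theta> by simp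
      show "\<bar>((G S)(i := \<theta>)) l t\<bar> \<le> 2 * B" for l t using G(2) b1(2) by simp
    qed
    then have "\<bar>(- \<rho>) ^ m * kernel_mean \<rho> (w' i) ((G S)(i := \<theta>)) x\<bar> \<le> \<rho> ^ m * D"
      using \<rho> by (simp add: abs_mult power_abs mult_left_mono)
    then show ?case using insert step by (simp add: algebra_simps)
  qed simp
  have "kernel_mean (\<rho> / 2) w (\<lambda>_. f) x = kernel_mean \<rho> w (G UNIV) x"
    unfolding kernel_mean_half[OF \<rho>] by (simp add: G_def f2_def[abs_def])
  moreover have "kernel_mean \<rho> w (\<lambda>_. f) x = kernel_mean \<rho> w (G {}) x" by (simp add: G_def)
  ultimately show ?thesis using main[of UNIV] by (simp add: mult.assoc)
qed

lemma kernel_mean_dyadic_bound: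
  fixes w :: "real^'n \<Rightarrow> real" and w' :: "'n \<Rightarrow> real^'n \<Rightarrow> real"
  assumes w: "has_weak_deriv \<alpha> u w" and w': "\<And>i. has_weak_deriv (\<alpha>(i := \<alpha> i + m)) u (w' i)"
    and f: "unit_kernel f" and \<theta>: "unit_kernel \<theta>" and r: "r > 0" and m: "m \<ge> 1"
    and eq: "(\<lambda>t. 2 * f (2 * t) - f t) = (deriv ^^ m) \<theta>"
    and B: "\<And>t. \<bar>f t\<bar> \<le> B" "\<And>t. \<bar>\<theta> t\<bar> \<le> B"
    and D: "\<And>i g \<rho>. \<rho> > 0 \<Longrightarrow> (\<And>l. unit_kernel (g l)) \<Longrightarrow> (\<And>l t. \<bar>g l t\<bar> \<le> 2 * B) \<Longrightarrow>
      \<bar>kernel_mean \<rho> (w' i) g x\<bar> \<le> D"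
  shows "\<bar>kernel_mean (r / 2 ^ N) w (\<lambda>_. f) x - kernel_mean r w (\<lambda>_. f) x\<bar> \<le> 2 * real CARD('n) * r ^ m * D"
proof -
  let ?\<kappa> = "\<lambda>r. kernel_mean r w (\<lambda>_. f) x"
  let ?K = "real CARD('n) * r ^ m * D"
  have D0: "D \<ge> 0"
  proof -
    have "\<bar>kernel_mean r (w' undefined) (\<lambda>_. f) x\<bar> \<le> D"
    proof (rule D[OF r])
      show "\<bar>f t\<bar> \<le> 2 * B" for t using B(1)[of t] abs_ge_zero[of "f t"] by linarith
    qed (rule f)
    then show ?thesis by linarith
  qed
  have K: "?K \<ge> 0" using D0 r by simp
  \<comment> \<open>\<open>2 - 2 / 2 ^ N\<close> is the sum of the first \<open>N\<close> terms of
    the series \<open>1 / 2 ^ i\<close>, kept exact so that the induction closes. Since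
    \<open>m >= 1\<close>, the true ratio \<open>1 / 2 ^ m\<close> is at most one half.\<close>
  have "\<bar>?\<kappa> (r / 2 ^ N) - ?\<kappa> r\<bar> \<le> (2 - 2 / 2 ^ N) * ?K"
  proof (induction N)
    case (Suc N)
    have rN: "r / 2 ^ N > 0" using r by simp
    have "\<bar>kernel_mean (r / 2 ^ N / 2) w (\<lambda>_. f) x - ?\<kappa> (r / 2 ^ N)\<bar>
        \<le> real CARD('n) * (r / 2 ^ N) ^ m * D"
      by (rule kernel_mean_dyadic_step[OF w w' f \<theta> rN eq B D[OF rN]])
    also have "\<dots> \<le> real CARD('n) * (r ^ m * (1 / 2 ^ N)) * D"
    proof -
      have "(1 / 2 ^ N :: real) ^ m \<le> (1 / 2 ^ N) ^ 1"
        using m by (intro power_decreasing) auto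
      then have "r ^ m * (1 / 2 ^ N) ^ m \<le> r ^ m * (1 / 2 ^ N)"
        using r by (intro mult_left_mono) auto
      then show ?thesis using D0 by (intro mult_right_mono mult_left_mono) (auto simp: power_divide)
    qed
    also have "\<dots> = ?K / 2 ^ N" by simp
    finally have "\<bar>?\<kappa> (r / 2 ^ Suc N) - ?\<kappa> (r / 2 ^ N)\<bar> \<le> ?K / 2 ^ N"
      by (simp add: divide_divide_eq_left mult.commute)
    with Suc have "\<bar>?\<kappa> (r / 2 ^ Suc N) - ?\<kappa> r\<bar>
        \<le> (2 - 2 / 2 ^ N) * ?K + ?K / 2 ^ N" by linarith
    also have "\<dots> = (2 - 2 / 2 ^ Suc N) * ?K" by (simp add: field_simps)
    finally show ?case .
  qed simp
  also have "\<dots> \<le> 2 * ?K" using K by (intro mult_right_mono) auto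
  finally show ?thesis by (simp only: mult.assoc)
qed

text \<open>The differentiation theorem is applied to \<open>\<bar>w y - q\<bar>\<close> for all
  rational \<open>q\<close>, whose countably many null sets can be united; a rational close to
  \<open>w x\<close> then controls the mean of \<open>\<bar>w y - w x\<bar>\<close>. The kernel has
  integral 1 and size at most \<open>K / \<rho> ^ CARD('n)\<close> on its cube, so the error is at
  most \<open>K\<close> times that mean.\<close>

lemma kernel_mean_tendsto:
  fixes w :: "real^'n \<Rightarrow> real"
  assumes w: "locally_integrable w" and f: "unit_kernel f" and f1: "integral\<^sup>L lborel f = 1"
  shows "AE x in lebesgue. ((\<lambda>\<rho>. kernel_mean \<rho> w (\<lambda>_. f) x) \<longlongrightarrow> w x) (at_right 0)"
proof -
  have si: "(\<lambda>y. \<bar>w y - q\<bar>) absolutely_integrable_on cbox a b" for q and a b :: "real^'n"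
  proof -
    have "w absolutely_integrable_on cbox a b" using w by (simp add: locally_integrable_def)
    moreover have "(\<lambda>_. q) absolutely_integrable_on cbox a b" by (rule absolutely_integrable_on_const) simp
    ultimately have "(\<lambda>y. w y - q) absolutely_integrable_on cbox a b" by (rule set_integral_diff)
    then show ?thesis by (rule set_integrable_abs)
  qed
  have hk: "(\<lambda>y. \<bar>w y - q\<bar>) integrable_on cbox a b" for q and a b :: "real^'n"
    using si by (rule set_lebesgue_integral_eq_integral(1))
  let ?I = "\<lambda>q \<rho> x. integral (cbox x (x + \<rho> *\<^sub>R One)) (\<lambda>y. \<bar>w y - q\<bar>)"
  let ?P = "\<lambda>q N. negligible N \<and> (\<forall>x e. x \<notin> N \<longrightarrow> e > 0 \<longrightarrow> (\<exists>d>0. \<forall>h. 0 < h \<and> h < d \<longrightarrow>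
      norm (?I q h x /\<^sub>R h ^ DIM(real^'n) - \<bar>w x - q\<bar>) < e))"
  have "\<forall>q. \<exists>N. ?P q N"
  proof
    fix q
    show "\<exists>N. ?P q N"
      by (rule integrable_ccontinuous_explicit[of "\<lambda>y. \<bar>w y - q\<bar>", OF hk]) blast
  qed
  then obtain N where N: "\<forall>q. ?P q (N q)"
    by (rule choice[THEN exE])
  have "AE x in lebesgue. \<forall>q\<in>\<rat>. x \<notin> N q"
  proof (subst AE_ball_countable[OF countable_rat], rule ballI)
    fix q
    have "N q \<in> null_sets lebesgue" using N negligible_iff_null_sets by blast
    then show "AE x in lebesgue. x \<notin> N q" by (rule AE_not_in)
  qed
  then show ?thesis
  proof eventually_elim
    fix x assume x: "\<forall>q\<in>\<rat>. x \<notin> N q"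
    let ?\<kappa> = "\<lambda>\<rho>. kernel_mean \<rho> w (\<lambda>_. f) x"
    obtain B where "B > 0" and B: "\<And>t. \<bar>f t\<bar> \<le> B" using unit_kernel_bounded[OF f] by blast
    define K where "K = B ^ CARD('n)"
    have K: "K > 0" using \<open>B > 0\<close> by (simp add: K_def)
    show "((\<lambda>\<rho>. ?\<kappa> \<rho>) \<longlongrightarrow> w x) (at_right 0)"
    proof (rule tendstoI)
      fix e :: real assume e: "e > 0"
      \<comment> \<open>The mean of \<open>\<bar>w y - q\<bar>\<close> will be below
        \<open>2 * e'\<close> and \<open>\<bar>w x - q\<bar>\<close> below \<open>e'\<close>; their
        sum is multiplied by \<open>K\<close>.\<close>
      define e' where "e' = e / (3 * K)"
      have e': "e' > 0" using e K by (simp add: e'_def)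
      obtain q where q: "q \<in> \<rat>" "w x - e' < q" "q < w x + e'"
        using Rats_dense_in_real[of "w x - e'" "w x + e'"] e' by auto
      then have wq: "\<bar>w x - q\<bar> < e'" by (simp add: abs_less_iff)
      obtain d where d: "d > 0" "\<And>h. 0 < h \<Longrightarrow> h < d \<Longrightarrow> norm (?I q h x /\<^sub>R h ^ DIM(real^'n) - \<bar>w x - q\<bar>) < e'"
        using N x q(1) e' by meson
      have "dist (?\<kappa> \<rho>) (w x) < e" if \<rho>: "0 < \<rho>" "\<rho> < d" for \<rho>
      proof -
        let ?b = "cbox x (x + \<rho> *\<^sub>R One)"
        let ?p = "\<rho> ^ CARD('n)"
        let ?\<phi> = "tensor (scaled_kernel \<rho> x (\<lambda>_. f))"
        have sm: "smooth_real (scaled_kernel \<rho> x (\<lambda>_. f) i)" for i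
          using f by (intro smooth_scaled_kernel) (simp add: unit_kernel_def)
        have one: "locally_integrable (\<lambda>_::real^'n. 1)"
          unfolding locally_integrable_def
          by (auto intro!: absolutely_integrable_on_const lmeasurable_compact)
        have "integrable lborel (\<lambda>t. f ((- (x $ i) / \<rho>) + (1 / \<rho>) * t))" for i
          using unit_kernel_integrable[OF f] \<rho>(1) by (intro lborel_integrable_real_affine) auto
        then have ski: "integrable lborel (scaled_kernel \<rho> x (\<lambda>_. f) i)" for i
          unfolding scaled_kernel_def[abs_def] by (intro integrable_mult_right) (simp add: add.commute)
        have sk1: "integral\<^sup>L lborel (scaled_kernel \<rho> x (\<lambda>_. f) i) = 1" for i
        proof -
          have "integral\<^sup>L lborel f = \<bar>1 / \<rho>\<bar> *\<^sub>R (\<integral>t. f ((- (x $ i) / \<rho>) + (1 / \<rho>) * t) \<partial>lborel)"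
            using \<rho>(1) by (intro lborel_integral_real_affine) auto
          then show ?thesis using f1 \<rho>(1)
            by (simp add: scaled_kernel_def[abs_def] add.commute)
        qed
        have int1: "integral\<^sup>L lebesgue ?\<phi> = 1"
          using integral_tensor[of "scaled_kernel \<rho> x (\<lambda>_. f)", OF sm ski] by (simp add: sk1)
        have i1: "integrable lebesgue (\<lambda>y. w y * ?\<phi> y)"
          using integrable_mult_scaled_kernel[of w "\<lambda>_. f", OF w f \<rho>(1)] .
        have i2: "integrable lebesgue (\<lambda>y. w x * ?\<phi> y)"
          using integrable_mult_scaled_kernel[of "\<lambda>_. 1" "\<lambda>_. f", OF one f \<rho>(1)]
          by (intro integrable_mult_right) simp
        have "?\<kappa> \<rho> - w x = (LINT y|lebesgue. w y * ?\<phi> y - w x * ?\<phi> y)"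
          using Bochner_Integration.integral_diff[OF i1 i2] int1 by (simp add: kernel_mean_def)
        also have "\<bar>\<dots>\<bar> \<le> (LINT y|lebesgue. (K / ?p) * (indicator ?b y *\<^sub>R \<bar>w y - w x\<bar>))"
          unfolding real_norm_def[symmetric]
        proof (rule Bochner_Integration.integral_norm_bound_integral)
          show "integrable lebesgue (\<lambda>y. w y * ?\<phi> y - w x * ?\<phi> y)" using i1 i2 by (rule Bochner_Integration.integrable_diff)
          show "integrable lebesgue (\<lambda>y. (K / ?p) * (indicator ?b y *\<^sub>R norm (w y - w x)))"
            using si[where q = "w x" and a = x and b = "x + \<rho> *\<^sub>R One"] unfolding set_integrable_def real_norm_def by (rule integrable_mult_right)
          fix y
          have "norm (w y * ?\<phi> y - w x * ?\<phi> y) = \<bar>w y - w x\<bar> * \<bar>?\<phi> y\<bar>"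
            by (simp add: abs_mult left_diff_distrib[symmetric])
          also have "\<dots> \<le> \<bar>w y - w x\<bar> * (B ^ CARD('n) / ?p * indicator ?b y)"
            by (intro mult_left_mono scaled_kernel_tensor_bound[where g = "\<lambda>_. f", OF f B \<rho>(1)]) auto
          finally show "norm (w y * ?\<phi> y - w x * ?\<phi> y) \<le> (K / ?p) * (indicator ?b y *\<^sub>R norm (w y - w x))"
            by (simp add: K_def mult_ac)
        qed
        also have "\<dots> = (K / ?p) * (LINT y:?b|lebesgue. \<bar>w y - w x\<bar>)"
          by (simp add: set_lebesgue_integral_def)
        also have "(LINT y:?b|lebesgue. \<bar>w y - w x\<bar>) = ?I (w x) \<rho> x"
          by (rule set_lebesgue_integral_eq_integral(2)[OF si])
        also have "?I (w x) \<rho> x \<le> integral ?b (\<lambda>y. \<bar>w y - q\<bar> + \<bar>w x - q\<bar>)"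
        proof (rule integral_le[OF hk])
          show "(\<lambda>y. \<bar>w y - q\<bar> + \<bar>w x - q\<bar>) integrable_on ?b"
            by (intro integrable_add hk integrable_const)
        qed linarith
        also have "integral ?b (\<lambda>y. \<bar>w y - q\<bar> + \<bar>w x - q\<bar>) = ?I q \<rho> x + ?p * \<bar>w x - q\<bar>"
          by (subst Henstock_Kurzweil_Integration.integral_add[OF hk integrable_const])
            (simp add: content_cbox_One[OF \<rho>(1)])
        finally have le: "\<bar>?\<kappa> \<rho> - w x\<bar> \<le> (K / ?p) * (?I q \<rho> x + ?p * \<bar>w x - q\<bar>)"
          using K \<rho>(1) by (simp add: mult_left_mono divide_right_mono)
        have "?I q \<rho> x /\<^sub>R \<rho> ^ DIM(real^'n) = ?I q \<rho> x / ?p"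
          by (simp add: divide_inverse mult.commute)
        then have "\<bar>?I q \<rho> x / ?p - \<bar>w x - q\<bar>\<bar> < e'"
          using d(2)[OF \<rho>] unfolding real_norm_def by simp
        then have "?I q \<rho> x / ?p < 2 * e'" using wq by linarith
        then have "(K / ?p) * (?I q \<rho> x + ?p * \<bar>w x - q\<bar>) < K * (3 * e')"
        proof -
          assume "?I q \<rho> x / ?p < 2 * e'"
          moreover have "(K / ?p) * (?I q \<rho> x + ?p * \<bar>w x - q\<bar>)
             = K * (?I q \<rho> x / ?p + \<bar>w x - q\<bar>)"
            using \<rho>(1) by (simp add: field_simps)
          ultimately show ?thesis using K wq by (simp add: mult_strict_left_mono)
        qed
        also have "K * (3 * e') = e" using K by (simp add: e'_def)
        finally show ?thesis using le by (simp add: dist_real_def)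
      qed
      then show "\<forall>\<^sub>F \<rho> in at_right 0. dist (?\<kappa> \<rho>) (w x) < e"
        unfolding eventually_at_right_field using d(1) by blast
    qed
  qed
qed

section \<open>Interpolation\<close>

lemma finite_multi_indices: "finite (multi_indices m :: ('n::finite \<Rightarrow> nat) set)"
proof (rule finite_subset)
  show "multi_indices m \<subseteq> (UNIV :: 'n set) \<rightarrow>\<^sub>E {..m}"
  proof (intro subsetI PiE_I)
    fix \<alpha> :: "'n \<Rightarrow> nat" and i assume "\<alpha> \<in> multi_indices m"
    then show "\<alpha> i \<in> {..m}"
      using member_le_sum[of i UNIV \<alpha>] by (simp add: multi_indices_def)
  qed simp
  show "finite ((UNIV :: 'n set) \<rightarrow>\<^sub>E {..m})" by (intro finite_PiE) auto
qed

lemma has_weak_deriv_weak_deriv: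
  assumes "weakly_differentiable k u" "\<alpha> \<in> multi_indices m" "m \<le> k"
  shows "has_weak_deriv \<alpha> u (weak_deriv \<alpha> u)"
proof -
  have "\<exists>v. has_weak_deriv \<alpha> u v" using assms by (auto simp: weakly_differentiable_def)
  then show ?thesis unfolding weak_deriv_def by (rule someI_ex)
qed

lemma weak_deriv_measurable:
  assumes "weakly_differentiable k u" "\<alpha> \<in> multi_indices m" "m \<le> k"
  shows "weak_deriv \<alpha> u \<in> borel_measurable lebesgue"
  using has_weak_deriv_weak_deriv[OF assms] by (simp add: has_weak_deriv_def locally_integrable_def)

lemma abs_grad_measurable:
  assumes "weakly_differentiable k u" "m \<le> k"
  shows "abs_grad m u \<in> borel_measurable lebesgue"
proof -
  have "(\<lambda>x. \<Sum>\<alpha>\<in>multi_indices m. (weak_deriv \<alpha> u x)\<^sup>2) \<in> borel_measurable lebesgue"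
    using weak_deriv_measurable[OF assms(1) _ assms(2)]
    by (intro borel_measurable_sum borel_measurable_power)
  then have "(\<lambda>x. L2_set (\<lambda>\<alpha>. weak_deriv \<alpha> u x) (multi_indices m)) \<in> borel_measurable lebesgue"
    unfolding L2_set_def by measurable
  then show ?thesis unfolding abs_grad_def[abs_def] by measurable
qed

lemma abs_weak_deriv_le_abs_grad:
  assumes "\<alpha> \<in> multi_indices m"
  shows "ennreal \<bar>weak_deriv \<alpha> u x\<bar> \<le> abs_grad m u x"
proof -
  have "\<bar>weak_deriv \<alpha> u x\<bar> \<le> L2_set (\<lambda>\<alpha>. \<bar>weak_deriv \<alpha> u x\<bar>) (multi_indices m)"
    using assms by (intro member_le_L2_set finite_multi_indices)
  also have "\<dots> = L2_set (\<lambda>\<alpha>. weak_deriv \<alpha> u x) (multi_indices m)"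
    by (simp add: L2_set_def)
  finally show ?thesis unfolding abs_grad_def by (rule ennreal_leI)
qed

section \<open>Optimisation in the scale\<close>

lemma interpolate_two_term_bound_pos:
  fixes a b :: real
  assumes bound: "\<And>r. r > 0 \<Longrightarrow> y \<le> A * (a / r ^ j + b * r ^ m)"
    and pos: "a > 0" "b > 0" and "j + m > 0"
  shows "y \<le> 2 * A * (b powr (real j / real (j + m)) * a powr (1 - real j / real (j + m)))"
proof -
  define k where "k = real (j + m)"
  have k: "k > 0" unfolding k_def using assms(4) by (simp only: of_nat_0_less_iff)
  have jmk: "real j + real m = k" by (simp add: k_def)
  have m: "real m / k = 1 - real j / k" using k jmk by (simp add: field_simps)
  \<comment> \<open>This radius balances the two terms: \<open>r ^ (j + m) = a / b\<close>, so
    \<open>a / r ^ j = b * r ^ m\<close>.\<close>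
  define r where "r = (a / b) powr (1 / k)"
  have r: "r > 0" using pos by (simp add: r_def)
  have "r ^ j = (a / b) powr (j / k)"
    using r by (simp add: r_def powr_powr flip: powr_realpow)
  then have 1: "a / r ^ j = b powr (j / k) * a powr (1 - j / k)"
    using pos by (simp add: powr_divide powr_diff)
  have "r ^ m = (a / b) powr (1 - j / k)"
    using r m by (simp add: r_def powr_powr flip: powr_realpow)
  then have 2: "b * r ^ m = b powr (j / k) * a powr (1 - j / k)"
    using pos by (simp add: powr_divide powr_diff)
  have "y \<le> A * (a / r ^ j + b * r ^ m)" by (rule bound[OF r])
  also have "\<dots> = 2 * A * (b powr (j / k) * a powr (1 - j / k))" unfolding 1 2 by simp
  finally show ?thesis unfolding k_def .
qed

text \<open>The balancing radius degenerates when \<open>a\<close> or \<open>b\<close> is 0. Adding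
  \<epsilon> to both preserves the hypothesis, and positivity of both exponents allows \<epsilon> to
  tend to 0.\<close>

lemma interpolate_two_term_bound:
  fixes a b :: real
  assumes bound: "\<And>r. r > 0 \<Longrightarrow> y \<le> A * (a / r ^ j + b * r ^ m)"
    and nn: "a \<ge> 0" "b \<ge> 0" "A \<ge> 0" and jm: "j \<ge> 1" "m \<ge> 1"
  shows "y \<le> 2 * A * (b powr (real j / real (j + m)) * a powr (1 - real j / real (j + m)))"
proof (rule tendsto_lowerbound)
  let ?p = "real j / real (j + m)"
  have p: "?p > 0" "1 - ?p > 0" using jm by (auto simp: divide_less_eq)
  have "((\<lambda>\<epsilon>. 2 * A * ((b + \<epsilon>) powr ?p * (a + \<epsilon>) powr (1 - ?p))) \<longlongrightarrow>
      2 * A * ((b + 0) powr ?p * (a + 0) powr (1 - ?p))) (at_right 0)"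
  proof (intro tendsto_intros tendsto_powr')
    show "b + 0 \<noteq> 0 \<or> 0 < ?p \<and> (\<forall>\<^sub>F \<epsilon> in at_right 0. 0 \<le> b + \<epsilon>)"
      using p nn eventually_at_right_less[of "0::real"] by (auto elim!: eventually_mono)
    show "a + 0 \<noteq> 0 \<or> 0 < 1 - ?p \<and> (\<forall>\<^sub>F \<epsilon> in at_right 0. 0 \<le> a + \<epsilon>)"
      using p nn eventually_at_right_less[of "0::real"] by (auto elim!: eventually_mono)
  qed
  then show "((\<lambda>\<epsilon>. 2 * A * ((b + \<epsilon>) powr ?p * (a + \<epsilon>) powr (1 - ?p))) \<longlongrightarrow>
      2 * A * (b powr ?p * a powr (1 - ?p))) (at_right 0)" by simp
  show "\<forall>\<^sub>F \<epsilon> in at_right 0. y \<le> 2 * A * ((b + \<epsilon>) powr ?p * (a + \<epsilon>) powr (1 - ?p))"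
    using eventually_at_right_less[of "0::real"]
  proof eventually_elim
    fix \<epsilon> :: real assume \<epsilon>: "0 < \<epsilon>"
    show "y \<le> 2 * A * ((b + \<epsilon>) powr ?p * (a + \<epsilon>) powr (1 - ?p))"
    proof (rule interpolate_two_term_bound_pos)
      fix r :: real assume r: "r > 0"
      have "a / r ^ j + b * r ^ m \<le> (a + \<epsilon>) / r ^ j + (b + \<epsilon>) * r ^ m"
        using r \<epsilon> by (intro add_mono divide_right_mono mult_right_mono) auto
      then have "A * (a / r ^ j + b * r ^ m) \<le> A * ((a + \<epsilon>) / r ^ j + (b + \<epsilon>) * r ^ m)"
        using nn(3) by (rule mult_left_mono)
      with bound[OF r] show "y \<le> A * ((a + \<epsilon>) / r ^ j + (b + \<epsilon>) * r ^ m)" by linarith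
    qed (use nn \<epsilon> jm in auto)
  qed
qed simp

section \<open>The pointwise interpolation inequality\<close>

text \<open>One constant serves both terms: \<open>2 * B\<close> bounds the mixed kernels of the
  dyadic descent and, generously, the derivatives of \<open>f\<close> against which \<open>u\<close>
  itself is averaged.\<close>

lemma weak_deriv_two_term_bound:
  fixes u :: "real^'n \<Rightarrow> real"
  assumes jm: "j \<ge> 1" "m \<ge> 1" and wd: "weakly_differentiable (j + m) u"
    and \<alpha>: "\<alpha> \<in> multi_indices j"
    and f: "unit_kernel f" and \<theta>: "unit_kernel \<theta>"
    and eq: "(\<lambda>t. 2 * f (2 * t) - f t) = (deriv ^^ m) \<theta>"
    and B: "\<And>l t. l \<le> j \<Longrightarrow> \<bar>(deriv ^^ l) f t\<bar> \<le> B" "\<And>t. \<bar>\<theta> t\<bar> \<le> B"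
    and a: "hl_max (\<lambda>x. ennreal \<bar>u x\<bar>) x = ennreal a" "a \<ge> 0"
    and b: "hl_max (abs_grad (j + m) u) x = ennreal b" "b \<ge> 0"
    and lim: "((\<lambda>\<rho>. kernel_mean \<rho> (weak_deriv \<alpha> u) (\<lambda>_. f) x) \<longlongrightarrow> weak_deriv \<alpha> u x) (at_right 0)"
    and r: "r > 0"
  shows "\<bar>weak_deriv \<alpha> u x\<bar> \<le> (2 * B * real CARD('n)) ^ CARD('n) * (a / r ^ j + 2 * real CARD('n) * b * r ^ m)"
proof -
  let ?w = "weak_deriv \<alpha> u"
  let ?\<kappa> = "kernel_mean r ?w (\<lambda>_. f) x"
  let ?N = "CARD('n)"
  define K where "K = (2 * B * real ?N) ^ ?N"
  have B0: "B \<ge> 0" using B(2)[of 0] by linarith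
  have K0: "K \<ge> 0" unfolding K_def using B0 by simp
  have w: "has_weak_deriv \<alpha> u ?w" by (rule has_weak_deriv_weak_deriv[OF wd \<alpha>]) simp
  have \<alpha>sum: "(\<Sum>i\<in>UNIV. \<alpha> i) = j" using \<alpha> by (simp add: multi_indices_def)
  have mi: "\<alpha>(i := \<alpha> i + m) \<in> multi_indices (j + m)" for i
  proof -
    have "(\<Sum>l\<in>UNIV. (\<alpha>(i := \<alpha> i + m)) l) = (\<Sum>l\<in>UNIV. \<alpha> l) + m"
      by (subst (1 2) sum.remove[of UNIV i]) auto
    then show ?thesis using \<alpha>sum by (simp add: multi_indices_def)
  qed
  have w': "has_weak_deriv (\<alpha>(i := \<alpha> i + m)) u (weak_deriv (\<alpha>(i := \<alpha> i + m)) u)" for i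
    by (rule has_weak_deriv_weak_deriv[OF wd mi]) simp
  have D: "\<bar>kernel_mean \<rho> (weak_deriv (\<alpha>(i := \<alpha> i + m)) u) g x\<bar> \<le> K * b"
    if \<rho>: "\<rho> > 0" and g: "\<And>l. unit_kernel (g l)" and gB: "\<And>l t. \<bar>g l t\<bar> \<le> 2 * B" for i g \<rho>
  proof -
    let ?v = "weak_deriv (\<alpha>(i := \<alpha> i + m)) u"
    have vm: "?v \<in> borel_measurable lebesgue" by (rule weak_deriv_measurable[OF wd mi]) simp
    have "ennreal \<bar>kernel_mean \<rho> ?v g x\<bar> \<le> ennreal K * hl_max (\<lambda>y. ennreal \<bar>?v y\<bar>) x"
      unfolding K_def by (rule kernel_mean_hl_max_bound[where g = g, OF vm g gB \<rho>])
    also have "\<dots> \<le> ennreal K * hl_max (abs_grad (j + m) u) x"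
      by (intro mult_left_mono hl_max_mono abs_weak_deriv_le_abs_grad mi) simp
    also have "\<dots> = ennreal (K * b)" unfolding b(1) using K0 b(2) by (simp add: ennreal_mult)
    finally show ?thesis using K0 b(2) by (simp add: ennreal_le_iff)
  qed
  have fB: "\<bar>f t\<bar> \<le> B" for t using B(1)[of 0] by simp
  have "\<bar>kernel_mean (r / 2 ^ M) ?w (\<lambda>_. f) x - ?\<kappa>\<bar> \<le> 2 * real ?N * r ^ m * (K * b)" for M
    by (rule kernel_mean_dyadic_bound[OF w w' f \<theta> r jm(2) eq fB B(2) D])
  moreover have "(\<lambda>M. \<bar>kernel_mean (r / 2 ^ M) ?w (\<lambda>_. f) x - ?\<kappa>\<bar>)
      \<longlonglongrightarrow> \<bar>?w x - ?\<kappa>\<bar>"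
  proof -
    have "(\<lambda>M. r / 2 ^ M) \<longlonglongrightarrow> 0"
      by (rule LIMSEQ_divide_realpow_zero) simp
    then have "filterlim (\<lambda>M. r / 2 ^ M) (at_right 0) sequentially"
      using r by (auto simp: filterlim_at)
    from filterlim_compose[OF lim this] show ?thesis by (intro tendsto_intros)
  qed
  \<comment> \<open>For fixed \<open>r\<close> the descent bound is independent of \<open>M\<close>,
    so it survives the limit in which the mean becomes \<open>?w x\<close>.\<close>
  ultimately have d1: "\<bar>?w x - ?\<kappa>\<bar> \<le> 2 * real ?N * r ^ m * (K * b)"
    by (intro LIMSEQ_le_const2) auto
  have d2: "\<bar>?\<kappa>\<bar> \<le> K * a / r ^ j"
  proof -
    have um: "u \<in> borel_measurable lebesgue"
      using wd by (simp add: weakly_differentiable_def locally_integrable_def)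
    have "\<bar>(deriv ^^ \<alpha> i) f t\<bar> \<le> 2 * B" for i t
    proof -
      have "\<alpha> i \<le> j" unfolding \<alpha>sum[symmetric] by (rule member_le_sum) auto
      then show ?thesis using B(1)[of "\<alpha> i" t] B0 by linarith
    qed
    then have "ennreal \<bar>kernel_mean r u (\<lambda>i. (deriv ^^ \<alpha> i) f) x\<bar> \<le> ennreal K * hl_max (\<lambda>y. ennreal \<bar>u y\<bar>) x"
      unfolding K_def using unit_kernel_deriv_funpow[OF f]
      by (intro kernel_mean_hl_max_bound[OF um _ _ r])
    also have "\<dots> = ennreal (K * a)" unfolding a(1) using K0 a(2) by (simp add: ennreal_mult)
    finally have "\<bar>kernel_mean r u (\<lambda>i. (deriv ^^ \<alpha> i) f) x\<bar> \<le> K * a"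
      using K0 a(2) by (simp add: ennreal_le_iff)
    also have "kernel_mean r u (\<lambda>i. (deriv ^^ \<alpha> i) f) x = (- r) ^ j * ?\<kappa>"
      using kernel_mean_weak_deriv[where g = "\<lambda>_. f", OF w f r] unfolding \<alpha>sum .
    finally have "r ^ j * \<bar>?\<kappa>\<bar> \<le> K * a"
      using r by (simp add: abs_mult power_abs)
    then show ?thesis using r by (simp add: pos_le_divide_eq mult.commute)
  qed
  have "\<bar>?w x\<bar> \<le> K * a / r ^ j + 2 * real ?N * r ^ m * (K * b)" using d1 d2 by linarith
  also have "\<dots> = K * (a / r ^ j + 2 * real ?N * b * r ^ m)" by (simp add: algebra_simps)
  finally show ?thesis unfolding K_def .
qed

text \<open>The kernels are chosen from \<open>m\<close> alone and their bounds from
  \<open>j\<close> and \<open>m\<close>, before \<open>u\<close> enters; this makes \<open>C\<close>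
  uniform in \<open>u\<close>.\<close>

lemma abs_grad_pointwise_bound:
  assumes jm: "j \<ge> 1" "m \<ge> 1"
  shows "\<exists>C>0. \<forall>u :: real^'n \<Rightarrow> real. weakly_differentiable (j + m) u \<longrightarrow>
    (AE x in lebesgue. hl_max (\<lambda>x. ennreal \<bar>u x\<bar>) x < \<infinity> \<longrightarrow> hl_max (abs_grad (j + m) u) x < \<infinity> \<longrightarrow>
      abs_grad j u x \<le> ennreal C * (ennpowr (hl_max (abs_grad (j + m) u) x) (real j / real (j + m)) *
        ennpowr (hl_max (\<lambda>x. ennreal \<bar>u x\<bar>) x) (1 - real j / real (j + m))))"
    (is "\<exists>C>0. \<forall>u. _ \<longrightarrow> ?P C u")
proof -
  obtain f \<theta> where f: "unit_kernel f" "integral\<^sup>L lborel f = 1" and \<theta>: "unit_kernel \<theta>"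
    and "(\<lambda>t. 2 * f (2 * t) - f t) = (deriv ^^ Suc (m - 1)) \<theta>"
    using moment_kernel_exists[of "m - 1"] by auto
  then have eq: "(\<lambda>t. 2 * f (2 * t) - f t) = (deriv ^^ m) \<theta>" using jm by simp
  have "\<forall>l. \<exists>B. \<forall>t. \<bar>(deriv ^^ l) f t\<bar> \<le> B"
  proof
    fix l
    from unit_kernel_bounded[OF unit_kernel_deriv_funpow[OF f(1), of l]]
    show "\<exists>B. \<forall>t. \<bar>(deriv ^^ l) f t\<bar> \<le> B" by metis
  qed
  then obtain Bf where "\<forall>l t. \<bar>(deriv ^^ l) f t\<bar> \<le> Bf l" by (rule choice[THEN exE])
  then have Bf: "\<bar>(deriv ^^ l) f t\<bar> \<le> Bf l" for l t by blast
  obtain B\<theta> where B\<theta>: "B\<theta> > 0" "\<And>t. \<bar>\<theta> t\<bar> \<le> B\<theta>" using unit_kernel_bounded[OF \<theta>] by blast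
  have Bf0: "Bf l \<ge> 0" for l using Bf[of l 0] by linarith
  \<comment> \<open>One bound for \<theta> and for all derivatives of \<open>f\<close> up to order
    \<open>j\<close>; the summand \<open>B\<theta>\<close> also makes it positive.\<close>
  define B where "B = B\<theta> + (\<Sum>l\<le>j. Bf l)"
  have "(\<Sum>l\<le>j. Bf l) \<ge> 0" using Bf0 by (intro sum_nonneg)
  then have B2: "\<bar>\<theta> t\<bar> \<le> B" and B0: "B > 0" for t using B\<theta>(1) B\<theta>(2)[of t] unfolding B_def by linarith+
  have B1: "\<bar>(deriv ^^ l) f t\<bar> \<le> B" if "l \<le> j" for l t
  proof -
    have "Bf l \<le> (\<Sum>l\<le>j. Bf l)" using that Bf0 by (intro member_le_sum) auto
    then show ?thesis using Bf[of l t] B\<theta>(1) unfolding B_def by linarith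
  qed
  let ?N = "CARD('n)" and ?I = "multi_indices j :: ('n \<Rightarrow> nat) set"
  \<comment> \<open>The factor \<open>2 * real ?N\<close> of the second term is conceded to the
    first one as well, so that a single constant multiplies both.\<close>
  define A where "A = (2 * B * real ?N) ^ ?N * (2 * real ?N)"
  have A0: "A > 0" using B0 by (simp add: A_def)
  \<comment> \<open>The Euclidean length is estimated by the sum over all multi-indices; the added 1
    gives positivity whatever their number.\<close>
  define C where "C = (real (card ?I) + 1) * (2 * A)"
  have C0: "C > 0" using A0 by (simp add: C_def add_nonneg_pos)
  have "?P C u"
    if wd: "weakly_differentiable (j + m) u" for u :: "real^'n \<Rightarrow> real"
  proof -
    have "AE x in lebesgue. \<forall>\<alpha>\<in>?I.
        ((\<lambda>\<rho>. kernel_mean \<rho> (weak_deriv \<alpha> u) (\<lambda>_. f) x) \<longlongrightarrow> weak_deriv \<alpha> u x) (at_right 0)"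
    proof (rule AE_ball_countable')
      fix \<alpha> assume "\<alpha> \<in> ?I"
      then have "has_weak_deriv \<alpha> u (weak_deriv \<alpha> u)" by (rule has_weak_deriv_weak_deriv[OF wd]) simp
      then have "locally_integrable (weak_deriv \<alpha> u)" by (simp add: has_weak_deriv_def)
      then show "AE x in lebesgue.
        ((\<lambda>\<rho>. kernel_mean \<rho> (weak_deriv \<alpha> u) (\<lambda>_. f) x) \<longlongrightarrow> weak_deriv \<alpha> u x) (at_right 0)"
        using f by (rule kernel_mean_tendsto)
    qed (simp add: countable_finite finite_multi_indices)
    then show ?thesis
    proof (eventually_elim, intro impI)
      fix x
      let ?R = "ennreal C * (ennpowr (hl_max (abs_grad (j + m) u) x) (real j / real (j + m)) *
        ennpowr (hl_max (\<lambda>x. ennreal \<bar>u x\<bar>) x) (1 - real j / real (j + m)))"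
      assume lim: "\<forall>\<alpha>\<in>?I. ((\<lambda>\<rho>. kernel_mean \<rho> (weak_deriv \<alpha> u) (\<lambda>_. f) x) \<longlongrightarrow> weak_deriv \<alpha> u x) (at_right 0)"
        and fin: "hl_max (\<lambda>x. ennreal \<bar>u x\<bar>) x < \<infinity>" "hl_max (abs_grad (j + m) u) x < \<infinity>"
      obtain a where a: "hl_max (\<lambda>x. ennreal \<bar>u x\<bar>) x = ennreal a" "a \<ge> 0"
        using fin(1) by (cases "hl_max (\<lambda>x. ennreal \<bar>u x\<bar>) x") auto
      obtain b where b: "hl_max (abs_grad (j + m) u) x = ennreal b" "b \<ge> 0"
        using fin(2) by (cases "hl_max (abs_grad (j + m) u) x") auto
      define P where "P = b powr (real j / real (j + m)) * a powr (1 - real j / real (j + m))"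
      have P0: "P \<ge> 0" by (simp add: P_def)
      have le: "\<bar>weak_deriv \<alpha> u x\<bar> \<le> 2 * A * P" if \<alpha>: "\<alpha> \<in> ?I" for \<alpha>
        unfolding P_def
      proof (rule interpolate_two_term_bound)
        fix r :: real assume r: "r > 0"
        have "\<bar>weak_deriv \<alpha> u x\<bar> \<le> (2 * B * real ?N) ^ ?N * (a / r ^ j + 2 * real ?N * b * r ^ m)"
          by (rule weak_deriv_two_term_bound[OF jm wd \<alpha> f(1) \<theta> eq B1 B2 a b lim[rule_format, OF \<alpha>] r])
        also have "\<dots> \<le> (2 * B * real ?N) ^ ?N * (2 * real ?N * (a / r ^ j) + 2 * real ?N * b * r ^ m)"
        proof (intro mult_left_mono add_right_mono)
          have "1 * (a / r ^ j) \<le> 2 * real ?N * (a / r ^ j)"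
          proof (rule mult_right_mono)
            have "CARD('n) \<ge> 1" by (simp add: Suc_leI)
            then show "1 \<le> 2 * real ?N" by linarith
          qed (use a(2) r in simp)
          then show "a / r ^ j \<le> 2 * real ?N * (a / r ^ j)" by simp
        qed (use B0 in simp)
        also have "\<dots> = A * (a / r ^ j + b * r ^ m)" by (simp add: A_def algebra_simps)
        finally show "\<bar>weak_deriv \<alpha> u x\<bar> \<le> A * (a / r ^ j + b * r ^ m)" .
      qed (use a b A0 jm in auto)
      have "L2_set (\<lambda>\<alpha>. weak_deriv \<alpha> u x) ?I \<le> (\<Sum>\<alpha>\<in>?I. \<bar>weak_deriv \<alpha> u x\<bar>)"
        by (rule L2_set_le_sum_abs)
      also have "\<dots> \<le> (\<Sum>\<alpha>\<in>?I. 2 * A * P)" by (intro sum_mono le)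
      also have "\<dots> \<le> C * P" using A0 P0 by (simp add: C_def algebra_simps)
      finally have "abs_grad j u x \<le> ennreal (C * P)" unfolding abs_grad_def by (rule ennreal_leI)
      also have "\<dots> = ?R"
        unfolding a(1) b(1) ennpowr_ennreal[OF a(2)] ennpowr_ennreal[OF b(2)] P_def
        using C0 by (simp add: ennreal_mult)
      finally show "abs_grad j u x \<le> ?R" .
    qed
  qed
  with C0 show ?thesis by blast
qed

theorem theorem1p2:
  fixes X Y :: "(real^'n \<Rightarrow> ennreal) \<Rightarrow> ennreal" and j k :: nat
  assumes "1 \<le> j" and "j < k"
    and "ri_banach_function_norm X" and "ri_banach_function_norm Y"
    and "locally_embedded (power_norm Y (real k / real j)) X"
  shows "\<exists>C>0. \<forall>u :: real^'n \<Rightarrow> real. weakly_differentiable k u \<longrightarrow>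
           X (abs_grad j u) \<le>
             ennreal C *
             norm_prod
               (ennpowr (repr_norm Y (max_rearr (abs_grad k u))) (real j / real k))
               (ennpowr
                  (repr_norm
                     (power_norm (multiplier_norm (power_norm Y (real k / real j)) X)
                        (1 - real j / real k))
                     (max_rearr (\<lambda>x. ennreal \<bar>u x\<bar>)))
                  (1 - real j / real k))"
proof -
  define m where "m = k - j"
  have m: "m \<ge> 1" and k: "k = j + m" using assms(2) by (auto simp: m_def)
  obtain C where C: "C > 0" and bound: "\<And>u :: real^'n \<Rightarrow> real. weakly_differentiable k u \<Longrightarrow>
    (AE x in lebesgue. hl_max (\<lambda>x. ennreal \<bar>u x\<bar>) x < \<infinity> \<longrightarrow> hl_max (abs_grad k u) x < \<infinity> \<longrightarrow>
      abs_grad j u x \<le> ennreal C * (ennpowr (hl_max (abs_grad k u) x) (real j / real k) *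
        ennpowr (hl_max (\<lambda>x. ennreal \<bar>u x\<bar>) x) (1 - real j / real k)))"
    using abs_grad_pointwise_bound[OF assms(1) m, where 'n = 'n] unfolding k by blast
  have \<theta>: "0 < real j / real k" "real j / real k < 1" using assms(1,2) by auto
  \<comment> \<open>The interpolation lemma is stated for the exponent \<open>1 / \<theta>\<close>
    with \<theta> equal to \<open>j / k\<close>.\<close>
  have inv: "real k / real j = 1 / (real j / real k)" by simp
  show ?thesis
  proof (intro exI[of _ "4 * C * hl_const TYPE('n)"] conjI allI impI)
    show "4 * C * hl_const TYPE('n) > 0" using C hl_const_pos[where 'n = 'n] by simp
    fix u :: "real^'n \<Rightarrow> real" assume wd: "weakly_differentiable k u"
    have um: "(\<lambda>x. ennreal \<bar>u x\<bar>) \<in> borel_measurable lebesgue"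
    proof -
      have [measurable]: "u \<in> borel_measurable lebesgue"
        using wd by (simp add: weakly_differentiable_def locally_integrable_def)
      show ?thesis by measurable
    qed
    have "abs_grad j u \<in> borel_measurable lebesgue" "abs_grad k u \<in> borel_measurable lebesgue"
      using abs_grad_measurable[OF wd] assms(2) by simp_all
    from interpolation_of_pointwise_bound[OF assms(3,4) \<theta> C this(1) um this(2) bound[OF wd]]
    show "X (abs_grad j u) \<le> ennreal (4 * C * hl_const TYPE('n)) * norm_prod
        (ennpowr (repr_norm Y (max_rearr (abs_grad k u))) (real j / real k))
        (ennpowr (repr_norm (power_norm (multiplier_norm (power_norm Y (real k / real j)) X)
          (1 - real j / real k)) (max_rearr (\<lambda>x. ennreal \<bar>u x\<bar>))) (1 - real j / real k))"
      unfolding inv .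
  qed
qed

end
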